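(* Let $\kappa$ be an uncountable cardinal such that $\mu^\omega < \kappa$ for every cardinal $\mu < \kappa$. \begin{enumerate} \item If $\kappa^{<\kappa} = \kappa$ and every abstract elementary class (AEC) with L\"owenheim--Skolem number less than $\kappa$ is $(<\kappa, \kappa)$-tame, then $\kappa$ is almost weakly compact. \item If every AEC with L\"owenheim--Skolem number less than $\kappa$ is $\kappa$-local, then $\kappa$ is almost measurable. \item If every AEC with L\"owenheim--Skolem number less than $\kappa$ is $<\kappa$-tame, then $\kappa$ is almost strongly compact. \end{enumerate}
   Context: **Large cardinals.** Let $\kappa$ be an uncountable cardinal. A filter is $\delta$-complete if it is closed under intersections of fewer than $\delta$ of its members; a filter on $\kappa$ is uniform if all its members have cardinality $\kappa$. - $\kappa$ is $\delta$-weakly compact if for every field $\mathcal{A}\subset\mathcal{P}(\kappa)$ of sets with $|\mathcal{A}|=\kappa$ there is a nonprincipal $\delta$-complete uniform filter on $\kappa$ measuring each set in $\mathcal{A}$ (i.e. containing it or its complement). $\kappa$ is almost weakly compact if it is $\delta$-weakly compact for all $\delta<\kappa$. - $\kappa$ is $\delta$-measurable if there is a uniform $\delta$-complete ultrafilter on $\kappa$. $\kappa$ is almost measurable if it is $\delta$-measurable for all $\delta<\kappa$. - For $\delta\le\kappa\le\lambda$, $\kappa$ is $(\delta,\lambda)$-strongly compact if there is a $\delta$-complete fine ultrafilter on $\mathcal{P}_\kappa\lambda=\{x\subseteq\lambda: |x|<\kappa\}$ (fine: it contains $\{x:\alpha\in x\}$ for every $\alpha<\lambda$). $\kappa$ is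 $(\delta,\infty)$-strongly compact if it is $(\delta,\lambda)$-strongly compact for all $\lambda\ge\kappa$. $\kappa$ is almost strongly compact if it is $(\delta,\infty)$-strongly compact for all $\delta<\kappa$. **AECs and Galois types.** An AEC is a class $\mathbb{K}$ of structures in a fixed (possibly many-sorted) language $\tau$ with a partial order $\prec_{\mathbb{K}}$ on $\mathbb{K}$, such that: $\mathbb{K}$ and $\prec_{\mathbb{K}}$ are closed under isomorphism; $M\prec_{\mathbb K}N$ implies $M$ is a substructure of $N$; (coherence) if $M_0\subseteq M_1$, $M_0\prec_{\mathbb K}M_2$ and $M_1\prec_{\mathbb K}M_2$ then $M_0\prec_{\mathbb K}M_1$; the union of a $\prec_{\mathbb K}$-increasing continuous chain is in $\mathbb K$, is $\prec_{\mathbb K}$-above each member of the chain, and is $\prec_{\mathbb K}N$ if all members are $\prec_{\mathbb K}N$; and there is a least cardinal $\mathrm{LS}(\mathbb K)\ge|\tau|+\aleph_0$ (the L\"owenheim--Skolem number) such that for every $N\in\mathbb K$ and $X\subseteq N$ there is $M\prec_{\mathbb K}N$ containing $X$ with $|M|\le|X|+\mathrm{LS}(\mathbb K)$. A $\mathbb K$-embedding is an isomorphism onto a $\prec_{\mathbb K}$-submodel. For $M\prec_{\mathbb K}N$ and $a\in N$, the Galois type $gtp(a/M;N)$ is the class of $(a,M,N)$ under the transitive closure of the relation: $(a_1,M,N_1)\sim(a_2,M,N_2)$ iff there are $N^*\in\mathbb K$ and $\mathbb K$-embeddings $f_\ell:N_\ell\to N^*$ fixing $M$ pointwise with $f_1(a_1)=f_2(a_2)$.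 $\mathrm{gS}(M)$ is the collection of Galois types over $M$. For $M_0\prec_{\mathbb K}M$, the restriction is $gtp(a/M;N)\upharpoonright M_0=gtp(a/M_0;N)$. **Tameness and locality.** For $\kappa\le\lambda$, $\mathbb K$ is $(<\kappa,\lambda)$-tame if for every $M\in\mathbb K$ of size $\lambda$ and $p\ne q\in\mathrm{gS}(M)$ there is $M_0\prec_{\mathbb K}M$ of size $<\kappa$ such that $p\upharpoonright M_0\ne q\upharpoonright M_0$. $\mathbb K$ is $<\kappa$-tame if it is $(<\kappa,\mu)$-tame for all $\mu\ge\kappa$. $\mathbb K$ is $\kappa$-local if for every $M\in\mathbb K$, $p\ne q\in\mathrm{gS}(M)$, and resolution $\langle M_i\in\mathbb K\mid i<\kappa\rangle$ of $M$ ($\prec_{\mathbb K}$-increasing continuous chain with union $M$), there is $i_0<\kappa$ with $p\upharpoonright M_{i_0}\ne q\upharpoonright M_{i_0}$. *)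

theory Defs
  imports "HOL-Analysis.Sigma_Algebra"
begin

unbundle cardinal_syntax

section \<open>The set-theoretic universe\<close>

text \<open>
  The ambient set theory is a type \<^emph>\<open>V\<close> satisfying the axioms of ZF, with Replacement for arbitrary
  functions on the type. Choice is inherited from HOL; Pairing and Separation follow from the axioms
  below. HOL sets over \<^emph>\<open>V\<close> play the role of classes; such a class is a set of the universe
  iff it is \<^emph>\<open>small\<close>. This is what makes it possible to speak inside one formula about
  all AECs (proper classes of structures) and about all cardinals.
\<close>

class zfc =
  fixes elts :: "'a \<Rightarrow> 'a set"
  assumes extensionality: "elts x = elts y \<Longrightarrow> x = y"
    and foundation: "wf {(x, y). x \<in> elts y}"
    and infinity: "\<exists>w. (\<exists>e \<in> elts w. elts e = {}) \<and>
                       (\<forall>x \<in> elts w. \<exists>y \<in> elts w. elts y = insert x (elts x))"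
    and union: "\<exists>u. elts u = \<Union> (elts ` elts x)"
    and powerset: "\<exists>p. elts p = {y. elts y \<subseteq> elts x}"
    and replacement: "\<exists>y. elts y = f ` elts x"

definition small :: "'v::zfc set \<Rightarrow> bool" where
  "small A \<longleftrightarrow> A \<in> range elts"


section \<open>Cardinals\<close>

text \<open>
  Cardinals are the well-orders \<^term>\<open>r\<close> with \<^prop>\<open>Card_order r\<close> of the library, i.e. initial
  ordinals up to isomorphism; finite ones are included.
\<close>

definition cardinal :: "'v::zfc rel \<Rightarrow> bool" where
  "cardinal \<kappa> \<longleftrightarrow> Card_order \<kappa> \<and> small (Field \<kappa>)"

text \<open>The weak power: the number of functions from some ordinal below \<open>\<kappa>\<close> to \<open>\<kappa>\<close>.\<close>

definition weak_power :: "'v rel \<Rightarrow> ('v \<times> ('v \<Rightarrow> 'v)) rel" where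
  "weak_power \<kappa> = |Sigma (Field \<kappa>) (\<lambda>\<alpha>. Func (underS \<kappa> \<alpha>) (Field \<kappa>))|"


section \<open>Filters and large cardinals\<close>

definition filter_on :: "'a set \<Rightarrow> 'a set set \<Rightarrow> bool" where
  "filter_on X F \<longleftrightarrow>
     F \<subseteq> Pow X \<and> X \<in> F \<and> {} \<notin> F \<and>
     (\<forall>A \<in> F. \<forall>B \<in> F. A \<inter> B \<in> F) \<and>
     (\<forall>A \<in> F. \<forall>B. A \<subseteq> B \<and> B \<subseteq> X \<longrightarrow> B \<in> F)"

definition ultrafilter_on :: "'a set \<Rightarrow> 'a set set \<Rightarrow> bool" where
  "ultrafilter_on X U \<longleftrightarrow> filter_on X U \<and> (\<forall>A. A \<subseteq> X \<longrightarrow> A \<in> U \<or> X - A \<in> U)"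

definition complete_filter :: "'v rel \<Rightarrow> 'a set set \<Rightarrow> bool" where
  "complete_filter \<delta> F \<longleftrightarrow> (\<forall>S. S \<subseteq> F \<and> S \<noteq> {} \<and> |S| <o \<delta> \<longrightarrow> \<Inter> S \<in> F)"

definition uniform_filter :: "'v rel \<Rightarrow> 'v set set \<Rightarrow> bool" where
  "uniform_filter \<kappa> F \<longleftrightarrow> (\<forall>A \<in> F. |A| =o \<kappa>)"

definition principal_filter :: "'a set \<Rightarrow> 'a set set \<Rightarrow> bool" where
  "principal_filter X F \<longleftrightarrow> (\<exists>A \<subseteq> X. F = {B. A \<subseteq> B \<and> B \<subseteq> X})"

definition delta_weakly_compact :: "'v::zfc rel \<Rightarrow> 'v rel \<Rightarrow> bool" where
  "delta_weakly_compact \<delta> \<kappa> \<longleftrightarrow>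
     (\<forall>\<A>. algebra (Field \<kappa>) \<A> \<and> |\<A>| =o \<kappa> \<longrightarrow>
        (\<exists>F. filter_on (Field \<kappa>) F \<and> \<not> principal_filter (Field \<kappa>) F \<and>
             complete_filter \<delta> F \<and> uniform_filter \<kappa> F \<and>
             (\<forall>A \<in> \<A>. A \<in> F \<or> Field \<kappa> - A \<in> F)))"

definition almost_weakly_compact :: "'v::zfc rel \<Rightarrow> bool" where
  "almost_weakly_compact \<kappa> \<longleftrightarrow>
     (\<forall>\<delta>::'v rel. cardinal \<delta> \<and> \<delta> <o \<kappa> \<longrightarrow> delta_weakly_compact \<delta> \<kappa>)"

definition delta_measurable :: "'v::zfc rel \<Rightarrow> 'v rel \<Rightarrow> bool" where
  "delta_measurable \<delta> \<kappa> \<longleftrightarrow>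
     (\<exists>U. ultrafilter_on (Field \<kappa>) U \<and> uniform_filter \<kappa> U \<and> complete_filter \<delta> U)"

definition almost_measurable :: "'v::zfc rel \<Rightarrow> bool" where
  "almost_measurable \<kappa> \<longleftrightarrow>
     (\<forall>\<delta>::'v rel. cardinal \<delta> \<and> \<delta> <o \<kappa> \<longrightarrow> delta_measurable \<delta> \<kappa>)"

definition small_subsets :: "'v rel \<Rightarrow> 'v rel \<Rightarrow> 'v set set" where
  "small_subsets \<kappa> \<theta> = {x. x \<subseteq> Field \<theta> \<and> |x| <o \<kappa>}"

definition fine :: "'v rel \<Rightarrow> 'v rel \<Rightarrow> 'v set set set \<Rightarrow> bool" where
  "fine \<kappa> \<theta> U \<longleftrightarrow> (\<forall>\<alpha> \<in> Field \<theta>. {x \<in> small_subsets \<kappa> \<theta>. \<alpha> \<in> x} \<in> U)"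

definition strongly_compact_at :: "'v::zfc rel \<Rightarrow> 'v rel \<Rightarrow> 'v rel \<Rightarrow> bool" where
  "strongly_compact_at \<delta> \<theta> \<kappa> \<longleftrightarrow>
     (\<exists>U. ultrafilter_on (small_subsets \<kappa> \<theta>) U \<and> complete_filter \<delta> U \<and> fine \<kappa> \<theta> U)"

definition strongly_compact_inf :: "'v::zfc rel \<Rightarrow> 'v rel \<Rightarrow> bool" where
  "strongly_compact_inf \<delta> \<kappa> \<longleftrightarrow>
     (\<forall>\<theta>::'v rel. cardinal \<theta> \<and> \<kappa> \<le>o \<theta> \<longrightarrow> strongly_compact_at \<delta> \<theta> \<kappa>)"

definition almost_strongly_compact :: "'v::zfc rel \<Rightarrow> bool" where
  "almost_strongly_compact \<kappa> \<longleftrightarrow>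
     (\<forall>\<delta>::'v rel. cardinal \<delta> \<and> \<delta> <o \<kappa> \<longrightarrow> strongly_compact_inf \<delta> \<kappa>)"


section \<open>Many-sorted languages and structures\<close>

record 'v lang =
  Sorts :: "'v set"
  Funs :: "'v set"
  Rels :: "'v set"
  fun_args :: "'v \<Rightarrow> 'v list"
  fun_res :: "'v \<Rightarrow> 'v"
  rel_args :: "'v \<Rightarrow> 'v list"

definition language :: "'v::zfc lang \<Rightarrow> bool" where
  "language \<tau> \<longleftrightarrow>
     small (Sorts \<tau>) \<and> small (Funs \<tau>) \<and> small (Rels \<tau>) \<and>
     (\<forall>f \<in> Funs \<tau>. set (fun_args \<tau> f) \<subseteq> Sorts \<tau> \<and> fun_res \<tau> f \<in> Sorts \<tau>) \<and>
     (\<forall>R \<in> Rels \<tau>. set (rel_args \<tau> R) \<subseteq> Sorts \<tau>)"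

definition lang_card :: "'v lang \<Rightarrow> ('v + 'v + 'v) rel" where
  "lang_card \<tau> = |Sorts \<tau> <+> (Funs \<tau> <+> Rels \<tau>)|"

record 'v struc =
  univ :: "'v \<Rightarrow> 'v set"
  fun_int :: "'v \<Rightarrow> 'v list \<Rightarrow> 'v"
  rel_int :: "'v \<Rightarrow> 'v list set"

abbreviation tuples :: "'v struc \<Rightarrow> 'v list \<Rightarrow> 'v list set" where
  "tuples M ss \<equiv> listset (map (univ M) ss)"

text \<open>
  The universes of distinct sorts are taken to be disjoint, so that an element of a structure is
  just an element of the union of its sorts. Interpretations get default values outside of their
  domain: thus records are equal iff they are equal as structures, and \<open>\<prec>\<close> can be antisymmetric.
\<close>

definition structure_of :: "'v::zfc lang \<Rightarrow> 'v struc \<Rightarrow> bool" where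
  "structure_of \<tau> M \<longleftrightarrow>
     (\<forall>s \<in> Sorts \<tau>. small (univ M s)) \<and>
     (\<forall>s. s \<notin> Sorts \<tau> \<longrightarrow> univ M s = {}) \<and>
     (\<forall>s t. s \<noteq> t \<longrightarrow> univ M s \<inter> univ M t = {}) \<and>
     (\<forall>f \<in> Funs \<tau>. \<forall>xs \<in> tuples M (fun_args \<tau> f). fun_int M f xs \<in> univ M (fun_res \<tau> f)) \<and>
     (\<forall>f xs. \<not> (f \<in> Funs \<tau> \<and> xs \<in> tuples M (fun_args \<tau> f)) \<longrightarrow> fun_int M f xs = undefined) \<and>
     (\<forall>R \<in> Rels \<tau>. rel_int M R \<subseteq> tuples M (rel_args \<tau> R)) \<and>
     (\<forall>R. R \<notin> Rels \<tau> \<longrightarrow> rel_int M R = {})"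

definition elems :: "'v struc \<Rightarrow> 'v set" where
  "elems M = (\<Union>s. univ M s)"

definition substructure :: "'v lang \<Rightarrow> 'v struc \<Rightarrow> 'v struc \<Rightarrow> bool" where
  "substructure \<tau> M N \<longleftrightarrow>
     (\<forall>s \<in> Sorts \<tau>. univ M s \<subseteq> univ N s) \<and>
     (\<forall>f \<in> Funs \<tau>. \<forall>xs \<in> tuples M (fun_args \<tau> f). fun_int M f xs = fun_int N f xs) \<and>
     (\<forall>R \<in> Rels \<tau>. rel_int M R = rel_int N R \<inter> tuples M (rel_args \<tau> R))"

definition iso_struc :: "'v lang \<Rightarrow> ('v \<Rightarrow> 'v) \<Rightarrow> 'v struc \<Rightarrow> 'v struc \<Rightarrow> bool" where
  "iso_struc \<tau> h M N \<longleftrightarrow>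
     (\<forall>s \<in> Sorts \<tau>. bij_betw h (univ M s) (univ N s)) \<and>
     (\<forall>f \<in> Funs \<tau>. \<forall>xs \<in> tuples M (fun_args \<tau> f). h (fun_int M f xs) = fun_int N f (map h xs)) \<and>
     (\<forall>R \<in> Rels \<tau>. \<forall>xs \<in> tuples M (rel_args \<tau> R). xs \<in> rel_int M R \<longleftrightarrow> map h xs \<in> rel_int N R)"

text \<open>
  For a nonempty chain of structures (under \<^const>\<open>substructure\<close>), the union of the chain is the only
  structure with the following property, since the arities are finite.
\<close>

definition is_union :: "'v::zfc lang \<Rightarrow> 'v set \<Rightarrow> ('v \<Rightarrow> 'v struc) \<Rightarrow> 'v struc \<Rightarrow> bool" where
  "is_union \<tau> I M N \<longleftrightarrow>
     structure_of \<tau> N \<and> (\<forall>s \<in> Sorts \<tau>. univ N s = (\<Union>i \<in> I. univ (M i) s)) \<and>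
     (\<forall>i \<in> I. substructure \<tau> (M i) N)"


section \<open>Abstract elementary classes\<close>

record 'v aec =
  lang_of :: "'v lang"
  models :: "'v struc set"
  strong :: "'v struc rel"

text \<open>An ordinal is given by a small well-order; its elements are the indices of the chain.\<close>

definition limit_elem :: "'v rel \<Rightarrow> 'v \<Rightarrow> bool" where
  "limit_elem r i \<longleftrightarrow> i \<in> Field r \<and> underS r i \<noteq> {} \<and>
     (\<forall>j \<in> underS r i. \<exists>k \<in> underS r i. j \<in> underS r k)"

definition continuous_chain :: "'v::zfc aec \<Rightarrow> 'v rel \<Rightarrow> ('v \<Rightarrow> 'v struc) \<Rightarrow> bool" where
  "continuous_chain K r M \<longleftrightarrow>
     (\<forall>i \<in> Field r. M i \<in> models K) \<and>
     (\<forall>i j. (i, j) \<in> r \<longrightarrow> (M i, M j) \<in> strong K) \<and>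
     (\<forall>i. limit_elem r i \<longrightarrow> is_union (lang_of K) (underS r i) M (M i))"

definition LS_property :: "'v::zfc aec \<Rightarrow> 'v rel \<Rightarrow> bool" where
  "LS_property K \<mu> \<longleftrightarrow>
     cardinal \<mu> \<and> lang_card (lang_of K) +c natLeq \<le>o \<mu> \<and>
     (\<forall>N \<in> models K. \<forall>X \<subseteq> elems N.
        \<exists>M. (M, N) \<in> strong K \<and> X \<subseteq> elems M \<and> |elems M| \<le>o |X| +c \<mu>)"

definition LS_number :: "'v::zfc aec \<Rightarrow> 'v rel \<Rightarrow> bool" where
  "LS_number K \<mu> \<longleftrightarrow> LS_property K \<mu> \<and> (\<forall>\<nu>. LS_property K \<nu> \<longrightarrow> \<mu> \<le>o \<nu>)"

definition AEC :: "'v::zfc aec \<Rightarrow> bool" where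
  "AEC K \<longleftrightarrow>
     language (lang_of K) \<and>
     (\<forall>M \<in> models K. structure_of (lang_of K) M) \<and>
     partial_order_on (models K) (strong K) \<and>
     (\<forall>M N h. M \<in> models K \<and> structure_of (lang_of K) N \<and> iso_struc (lang_of K) h M N \<longrightarrow>
        N \<in> models K) \<and>
     (\<forall>M N M' N' h. (M, N) \<in> strong K \<and>
        structure_of (lang_of K) M' \<and> structure_of (lang_of K) N' \<and>
        iso_struc (lang_of K) h N N' \<and> iso_struc (lang_of K) h M M' \<longrightarrow> (M', N') \<in> strong K) \<and>
     (\<forall>M N. (M, N) \<in> strong K \<longrightarrow> substructure (lang_of K) M N) \<and>
     (\<forall>M0 M1 M2. substructure (lang_of K) M0 M1 \<and> (M0, M2) \<in> strong K \<and> (M1, M2) \<in> strong K \<longrightarrow>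
        (M0, M1) \<in> strong K) \<and>
     (\<forall>r M U. Well_order r \<and> small (Field r) \<and> Field r \<noteq> {} \<and>
        continuous_chain K r M \<and> is_union (lang_of K) (Field r) M U \<longrightarrow>
        U \<in> models K \<and> (\<forall>i \<in> Field r. (M i, U) \<in> strong K) \<and>
        (\<forall>N. (\<forall>i \<in> Field r. (M i, N) \<in> strong K) \<longrightarrow> (U, N) \<in> strong K)) \<and>
     (\<exists>\<mu>. LS_number K \<mu>)"

definition K_embedding :: "'v aec \<Rightarrow> ('v \<Rightarrow> 'v) \<Rightarrow> 'v struc \<Rightarrow> 'v struc \<Rightarrow> bool" where
  "K_embedding K f M N \<longleftrightarrow> (\<exists>M'. (M', N) \<in> strong K \<and> iso_struc (lang_of K) f M M')"


section \<open>Galois types, tameness and locality\<close>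

type_synonym 'v triple = "'v \<times> 'v struc \<times> 'v struc"

definition gal_rel :: "'v aec \<Rightarrow> 'v triple rel" where
  "gal_rel K = {((a1, M, N1), (a2, M, N2)) | a1 a2 M N1 N2.
     (M, N1) \<in> strong K \<and> a1 \<in> elems N1 \<and> (M, N2) \<in> strong K \<and> a2 \<in> elems N2 \<and>
     (\<exists>N \<in> models K. \<exists>f1 f2. K_embedding K f1 N1 N \<and> K_embedding K f2 N2 N \<and>
        (\<forall>m \<in> elems M. f1 m = m \<and> f2 m = m) \<and> f1 a1 = f2 a2)}"

definition gtp :: "'v aec \<Rightarrow> 'v \<Rightarrow> 'v struc \<Rightarrow> 'v struc \<Rightarrow> 'v triple set" where
  "gtp K a M N = {t. ((a, M, N), t) \<in> (gal_rel K)\<^sup>+}"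

definition gS :: "'v aec \<Rightarrow> 'v struc \<Rightarrow> 'v triple set set" where
  "gS K M = {gtp K a M N | a N. (M, N) \<in> strong K \<and> a \<in> elems N}"

definition gres :: "'v aec \<Rightarrow> 'v triple set \<Rightarrow> 'v struc \<Rightarrow> 'v triple set" where
  "gres K p M0 = (THE q. \<exists>a M N. (a, M, N) \<in> p \<and> q = gtp K a M0 N)"

definition tame_at :: "'v::zfc aec \<Rightarrow> 'v rel \<Rightarrow> 'v rel \<Rightarrow> bool" where
  "tame_at K \<kappa> \<theta> \<longleftrightarrow>
     (\<forall>M \<in> models K. |elems M| =o \<theta> \<longrightarrow>
        (\<forall>p \<in> gS K M. \<forall>q \<in> gS K M. p \<noteq> q \<longrightarrow>
           (\<exists>M0. (M0, M) \<in> strong K \<and> |elems M0| <o \<kappa> \<and> gres K p M0 \<noteq> gres K q M0)))"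

definition tame :: "'v::zfc aec \<Rightarrow> 'v rel \<Rightarrow> bool" where
  "tame K \<kappa> \<longleftrightarrow> (\<forall>\<mu>::'v rel. cardinal \<mu> \<and> \<kappa> \<le>o \<mu> \<longrightarrow> tame_at K \<kappa> \<mu>)"

definition resolution :: "'v::zfc aec \<Rightarrow> 'v rel \<Rightarrow> ('v \<Rightarrow> 'v struc) \<Rightarrow> 'v struc \<Rightarrow> bool" where
  "resolution K \<kappa> Ms M \<longleftrightarrow> continuous_chain K \<kappa> Ms \<and> is_union (lang_of K) (Field \<kappa>) Ms M"

definition local_at :: "'v::zfc aec \<Rightarrow> 'v rel \<Rightarrow> bool" where
  "local_at K \<kappa> \<longleftrightarrow>
     (\<forall>M \<in> models K. \<forall>p \<in> gS K M. \<forall>q \<in> gS K M. p \<noteq> q \<longrightarrow>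
        (\<forall>Ms. resolution K \<kappa> Ms M \<longrightarrow>
           (\<exists>i \<in> Field \<kappa>. gres K p (Ms i) \<noteq> gres K q (Ms i))))"

end

theory Submission
  imports Defs
begin

text \<open>
  Large cardinal filters are obtained from tameness or locality of one kind of abstract elementary
  class, whose models are bundles of finite sets.

  Fix a set \<open>X\<close>, a set \<open>D\<close> of size at least \<open>\<delta>\<close> and below \<open>\<kappa>\<close>, functions \<open>f : X \<rightarrow> D\<close>, and subsets \<open>C z\<close> of \<open>X\<close>,
  the demands. A filter on \<open>X\<close> that contains the demands and is sufficiently complete selects a value of each \<open>f\<close>,
  attained on every \<open>C z\<close>, and the selection commutes with composition by maps \<open>\<pi> : D \<rightarrow> D\<close>.
  Conversely, such a coherent selection yields a filter whose members are
  the sets that are declared large. So the aim is a coherent selection.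

  To express coherent selections by Galois types, the values of \<open>f\<close> on \<open>C z\<close> are replaced by the vector
  space over the field with two elements that they span, the fibre over the index \<open>(f, z)\<close>; the relation
  \<open>link\<close> is the graph of the linear maps induced by the maps \<open>\<pi>\<close>. Let \<open>M\<close> be the bare set of
  indices, \<open>N\<close> the bundle over it, and \<open>p\<close> and \<open>q\<close> the types over \<open>M\<close> of the vectors \<open>0\<close> and \<open>d\<close> in a fibre over the
  constant function with value \<open>d\<close>. A point \<open>x \<in> X\<close> gives the translation of each fibre by the value \<open>f x\<close>. It is an
  automorphism over those indices whose demand contains \<open>x\<close>, and takes \<open>0\<close> to \<open>d\<close>. Hence \<open>p\<close> and \<open>q\<close> agree over
  every set of indices whose demands have a common point (\<open>local_gtp_eq\<close>). Tameness or locality then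
  forces \<open>p = q\<close>. Strong embeddings do not enlarge fibres, so \<open>p = q\<close> provides a global map
  of the fibres that takes \<open>0\<close> to \<open>d\<close>; the images of the zero vectors are a coherent assignment of
  nonempty finite sets of values (\<open>gtp_eq_imp_section\<close>).

  Finite sets are reduced to single values by counting (\<open>coherent_choice\<close>). Refining a function cannot
  decrease the number of its values; if every countable set of functions has a common refinement, the number is
  bounded, and where it is maximal one value can be singled out coherently. Countable refinements exist when
  the countable power of \<open>D\<close> is no larger than \<open>D\<close>, and \<open>D\<close> can be chosen so by the
  hypothesis on \<open>\<kappa>\<close> (\<open>countable_power_closed_subset\<close>). The filter is built in \<open>gtp_eq_imp_filter\<close>.

  The three parts of the theorem differ only in the points and the demands: elements of \<open>\<kappa>\<close> and final segments for
  weak compactness and measurability, and small subsets of \<open>\<theta>\<close> and the sets \<open>{x. \<alpha> \<in> x}\<close> for strong compactness.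
\<close>

section \<open>Small sets\<close>

lemma small_image:
  fixes f :: "'v::zfc \<Rightarrow> 'v"
  assumes "small A" shows "small (f ` A)"
proof -
  obtain a where "A = elts a" using assms unfolding small_def by blast
  moreover obtain b where "elts b = f ` elts a" using replacement by blast
  ultimately show ?thesis unfolding small_def by (metis rangeI)
qed

lemma small_subset: assumes "small B" "A \<subseteq> B" shows "small (A::'v::zfc set)"
proof (cases "A = {}")
  case True
  obtain w e :: 'v where "elts e = {}" using infinity by blast
  then show ?thesis using True unfolding small_def by (metis rangeI)
next
  case False
  then obtain a where "a \<in> A" by blast
  then have "A = (\<lambda>x. if x \<in> A then x else a) ` B" using assms(2) by auto
  then show ?thesis using small_image[OF assms(1)] by metis
qed

lemma small_Un: assumes "small A" "small B" shows "small (A \<union> B :: 'v::zfc set)"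
proof -
  obtain e :: 'v where e: "elts e = {}" using infinity by blast
  obtain o1 :: 'v where o1: "elts o1 = {y. elts y \<subseteq> elts e}" using powerset by blast
  obtain o2 :: 'v where o2: "elts o2 = {y. elts y \<subseteq> elts o1}" using powerset by blast
  have "e \<in> elts o2" "o1 \<in> elts o2" "o1 \<noteq> e" using e o1 o2 by auto
  obtain a b where ab: "A = elts a" "B = elts b" using assms unfolding small_def by blast
  obtain c where c: "elts c = (\<lambda>x. if x = e then a else b) ` elts o2" using replacement by blast
  obtain u where "elts u = \<Union> (elts ` elts c)" using union by blast
  moreover have "\<Union> (elts ` elts c) = A \<union> B"
    using c ab \<open>e \<in> elts o2\<close> \<open>o1 \<in> elts o2\<close> \<open>o1 \<noteq> e\<close> by (auto split: if_splits)
  ultimately show ?thesis unfolding small_def by (metis rangeI)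
qed

text \<open>
  Test functions, indices and points of fibres live in various HOL types, but the elements of a
  structure must be elements of the universe. All the sets that are needed have a small code, and
  the closure properties below are the set-theoretic axioms read at the level of cardinality.
\<close>

definition codable :: "'v::zfc itself \<Rightarrow> 'a set \<Rightarrow> bool" where
  "codable (_ :: 'v itself) A \<longleftrightarrow> (\<exists>c :: 'a \<Rightarrow> 'v. inj_on c A \<and> small (c ` A))"

lemma codable_inj:
  assumes "codable TYPE('v::zfc) B" "inj_on f A" "f ` A \<subseteq> B"
  shows "codable TYPE('v) A"
proof -
  obtain c :: "_ \<Rightarrow> 'v" where c: "inj_on c B" "small (c ` B)"
    using assms(1) unfolding codable_def by blast
  have "inj_on (c \<circ> f) A" using assms(2,3) c(1) by (meson comp_inj_on inj_on_subset)
  moreover have "small ((c \<circ> f) ` A)"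
    by (rule small_subset[OF c(2)]) (use assms(3) in auto)
  ultimately show ?thesis unfolding codable_def by blast
qed

lemma codable_small: "small (A::'v::zfc set) \<Longrightarrow> codable TYPE('v) A"
  unfolding codable_def by (rule exI[of _ id]) auto

lemma codable_Pow:
  assumes "codable TYPE('v::zfc) A"
  shows "codable TYPE('v) (Pow A)"
proof -
  obtain c :: "_ \<Rightarrow> 'v" where c: "inj_on c A" "small (c ` A)"
    using assms unfolding codable_def by blast
  then obtain b where b: "c ` A = elts b" unfolding small_def by blast
  obtain p where p: "elts p = {y. elts y \<subseteq> elts b}" using powerset by blast
  define code :: "'v set \<Rightarrow> 'v" where "code B = (SOME y. elts y = B)" for B
  have code: "elts (code B) = B" if "B \<subseteq> elts b" for B
  proof -
    have "small B" using that small_subset unfolding small_def by blast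
    then have "\<exists>y. elts y = B" unfolding small_def by blast
    then show ?thesis unfolding code_def by (rule someI_ex)
  qed
  have "codable TYPE('v) (elts p)" by (rule codable_small) (simp add: small_def)
  moreover have "inj_on (\<lambda>B. code (c ` B)) (Pow A)"
  proof (rule inj_onI)
    fix B C assume BC: "B \<in> Pow A" "C \<in> Pow A" "code (c ` B) = code (c ` C)"
    then have "c ` B = c ` C" using code b by (metis Pow_iff image_mono)
    then show "B = C" using c(1) BC by (simp add: inj_on_image_eq_iff)
  qed
  moreover have "(\<lambda>B. code (c ` B)) ` Pow A \<subseteq> elts p"
  proof clarify
    fix B assume "B \<subseteq> A"
    then have "c ` B \<subseteq> elts b" using b by blast
    then show "code (c ` B) \<in> elts p" using code p by simp
  qed
  ultimately show ?thesis by (rule codable_inj)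
qed

lemma codable_Times:
  assumes "codable TYPE('v::zfc) A" "codable TYPE('v) B"
  shows "codable TYPE('v) (A \<times> B)"
proof -
  obtain c :: "_ \<Rightarrow> 'v" where c: "inj_on c A" "small (c ` A)"
    using assms unfolding codable_def by blast
  obtain d :: "_ \<Rightarrow> 'v" where d: "inj_on d B" "small (d ` B)"
    using assms unfolding codable_def by blast
  let ?W = "Pow (Pow (c ` A \<union> d ` B))"
  have "codable TYPE('v) ?W"
    by (intro codable_Pow codable_small small_Un c d)
  moreover have "inj_on (\<lambda>(a, b). {{c a}, {c a, d b}}) (A \<times> B)"
  proof (rule inj_onI, clarify)
    fix a b a' b' assume m: "a \<in> A" "b \<in> B" "a' \<in> A" "b' \<in> B"
      and eq: "{{c a}, {c a, d b}} = {{c a'}, {c a', d b'}}"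
    have "c a = c a' \<and> d b = d b'" using eq by (metis doubleton_eq_iff insert_absorb2)
    then show "a = a' \<and> b = b'" using m c(1) d(1) by (meson inj_onD)
  qed
  ultimately show ?thesis by (rule codable_inj) auto
qed

lemma codable_Plus:
  assumes "codable TYPE('v::zfc) A" "codable TYPE('v) B"
  shows "codable TYPE('v) (A <+> B)"
proof (rule codable_inj)
  show "codable TYPE('v) (Pow A \<times> Pow B)" by (intro codable_Times codable_Pow assms)
  show "inj_on (case_sum (\<lambda>a. ({a}, {})) (\<lambda>b. ({}, {b}))) (A <+> B)"
    by (auto simp: inj_on_def)
qed auto

lemma codable_Func:
  assumes "codable TYPE('v::zfc) A" "codable TYPE('v) B"
  shows "codable TYPE('v) (Func A B)"
proof (rule codable_inj)
  show "codable TYPE('v) (Pow (A \<times> B))" by (intro codable_Times codable_Pow assms)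
  show "inj_on (\<lambda>f. {(a, f a) | a. a \<in> A}) (Func A B)"
  proof (rule inj_onI, rule ext)
    fix f g a assume fg: "f \<in> Func A B" "g \<in> Func A B"
      "{(a, f a) | a. a \<in> A} = {(a, g a) | a. a \<in> A}"
    show "f a = g a"
    proof (cases "a \<in> A")
      case True
      then have "(a, f a) \<in> {(a, g a) | a. a \<in> A}" using fg(3) by blast
      then show ?thesis by simp
    qed (use fg in \<open>auto simp: Func_def\<close>)
  qed
  show "(\<lambda>f. {(a, f a) | a. a \<in> A}) ` Func A B \<subseteq> Pow (A \<times> B)"
    by (auto simp: Func_def)
qed

section \<open>Cardinal arithmetic\<close>

lemma cardinal_card_of: "small A \<Longrightarrow> cardinal |A|"
  unfolding cardinal_def by (simp add: Field_card_of card_of_card_order_on)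

text \<open>
  Replacing \<open>S\<close> by its countable power gives a set \<open>D\<close> that absorbs its own countable sequences, because
  \<open>\<omega> * \<omega> = \<omega>\<close>. The hypothesis on countable powers below \<open>\<kappa>\<close> keeps the size of \<open>D\<close>,
  which bounds a Loewenheim-Skolem number, below \<open>\<kappa>\<close>.
\<close>

lemma countable_power_closed_subset:
  fixes \<kappa> :: "'v::zfc rel"
  assumes \<kappa>: "cardinal \<kappa>" "natLeq <o \<kappa>"
    and pow: "\<forall>\<mu>::'v rel. cardinal \<mu> \<and> \<mu> <o \<kappa> \<longrightarrow> \<mu> ^c natLeq <o \<kappa>"
    and S: "S \<subseteq> Field \<kappa>" "|S| <o \<kappa>"
  obtains D and e :: "(nat \<Rightarrow> 'v) \<Rightarrow> 'v" where
    "D \<subseteq> Field \<kappa>" "|S| \<le>o |D|" "|D| <o \<kappa>" "infinite D"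
    "inj_on e {\<phi>. range \<phi> \<subseteq> D}" "e ` {\<phi>. range \<phi> \<subseteq> D} \<subseteq> D"
proof -
  have Co: "Card_order \<kappa>" and sm: "small (Field \<kappa>)" using \<kappa>(1) unfolding cardinal_def by auto
  have F\<kappa>: "|Field \<kappa>| =o \<kappa>" using Co by (simp add: card_of_Field_ordIso)
  have emb: "\<exists>f. inj_on f W \<and> f ` W \<subseteq> Field \<kappa>" if "|W| \<le>o \<kappa>" for W :: "'b set"
  proof -
    have "|W| \<le>o |Field \<kappa>|" using that F\<kappa> ordIso_symmetric ordLeq_ordIso_trans by blast
    then show ?thesis by (simp add: card_of_ordLeq)
  qed
  have "|UNIV::nat set| =o natLeq" by (metis Field_natLeq card_of_Field_ordIso natLeq_Card_order)
  then have nat: "|UNIV::nat set| <o \<kappa>" using \<kappa>(2) ordIso_ordLess_trans by blast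
  then obtain f :: "nat \<Rightarrow> 'v" where f: "inj f" "range f \<subseteq> Field \<kappa>"
    using emb[of "UNIV :: nat set"] ordLess_imp_ordLeq by blast
  define N where "N = S \<union> range f"
  have inf\<kappa>: "\<not> finite (Field \<kappa>)" using f by (meson infinite_UNIV_nat finite_imageD finite_subset)
  have "|range f| <o \<kappa>"
    using nat card_of_image ordLeq_ordLess_trans by blast
  then have "|N| <o \<kappa>" unfolding N_def
    using S(2) inf\<kappa> Co by (intro card_of_Un_ordLess_infinite_Field) auto
  moreover have "small N" unfolding N_def using S(1) f(2) small_subset[OF sm] by simp
  ultimately have "|N| ^c natLeq <o \<kappa>" using pow cardinal_card_of by blast
  moreover define W where "W = Func (UNIV :: nat set) N"
  ultimately have W: "|W| <o \<kappa>"
    by (simp add: cexp_def Field_natLeq Field_card_of)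
  obtain g where g: "inj_on g W" "g ` W \<subseteq> Field \<kappa>"
    using emb[OF ordLess_imp_ordLeq[OF W]] by blast
  define D where "D = g ` W"
  have gb: "bij_betw g W D" using g unfolding D_def by (simp add: bij_betw_def)
  have DW: "|D| =o |W|" using gb card_of_ordIsoI ordIso_symmetric by blast
  have WNc: "|W| = |N| ^c natLeq" unfolding W_def cexp_def by (simp add: Field_natLeq Field_card_of)
  have "infinite N" unfolding N_def using f(1) by (simp add: finite_image_iff)
  have "|N| \<le>o |W|"
  proof -
    have "inj_on (\<lambda>a (n::nat). a) N" by (auto simp: inj_on_def fun_eq_iff)
    moreover have "(\<lambda>a (n::nat). a) ` N \<subseteq> W" unfolding W_def Func_def by auto
    ultimately show ?thesis using card_of_ordLeq by blast
  qed
  then have ND: "|N| \<le>o |D|" using DW ordIso_symmetric ordLeq_ordIso_trans by blast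
  have D\<kappa>: "|D| <o \<kappa>" using DW W ordIso_ordLess_trans by blast
  have SD: "|S| \<le>o |D|" using ND card_of_mono1[of S N] N_def ordLeq_transitive by blast
  have infD: "infinite D" using ND \<open>infinite N\<close> card_of_ordLeq_infinite by blast
  have "|Func (UNIV::nat set) D| = |D| ^c natLeq"
    unfolding cexp_def by (simp add: Field_natLeq Field_card_of)
  moreover have "|D| ^c natLeq =o |W| ^c natLeq"
    using DW by (rule cexp_cong1) (rule natLeq_Card_order)
  moreover have "|W| ^c natLeq =o |N| ^c (natLeq *c natLeq)"
    unfolding WNc by (rule cexp_cprod) (rule card_of_Card_order)
  moreover have "|N| ^c (natLeq *c natLeq) =o |W|" unfolding WNc
    by (rule cexp_cong2[OF cprod_infinite[OF natLeq_Cinfinite] card_of_Card_order Card_order_cprod])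
  ultimately have "|Func (UNIV::nat set) D| =o |W|"
    by (auto elim: ordIso_transitive)
  then have "|Func (UNIV::nat set) D| =o |D|"
    using DW ordIso_symmetric ordIso_transitive by blast
  then have "|Func (UNIV::nat set) D| \<le>o |D|" using ordIso_iff_ordLeq by blast
  then obtain e where e: "inj_on e (Func (UNIV::nat set) D)" "e ` Func (UNIV::nat set) D \<subseteq> D"
    unfolding card_of_ordLeq[symmetric] by blast
  have F: "Func (UNIV::nat set) D = {\<phi>. range \<phi> \<subseteq> D}" unfolding Func_def by auto
  have "D \<subseteq> Field \<kappa>" using g D_def by simp
  then show thesis
  proof (rule that[OF _ SD D\<kappa> infD])
    show "inj_on e {\<phi>. range \<phi> \<subseteq> D}" using e(1) unfolding F .
    show "e ` {\<phi>. range \<phi> \<subseteq> D} \<subseteq> D" using e(2) unfolding F .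
  qed
qed

section \<open>A class of bundles\<close>

definition proj_label :: "'v::zfc" where
  "proj_label = (SOME y. elts y = {})"

definition link_label :: "'v::zfc" where
  "link_label = (SOME y. elts y = {proj_label})"

lemma labels_distinct: "(proj_label :: 'v::zfc) \<noteq> link_label"
proof -
  obtain w e :: 'v where e: "elts e = {}" and
    w: "\<forall>x \<in> elts w. \<exists>y \<in> elts w. elts y = insert x (elts x)" "e \<in> elts w"
    using infinity extensionality by metis
  have p: "elts (proj_label :: 'v) = {}" unfolding proj_label_def using e by (rule someI)
  then have "e = proj_label" using e extensionality by metis
  then obtain y :: 'v where "elts y = {proj_label}" using w p by fastforce
  then have "elts (link_label :: 'v) = {proj_label}" unfolding link_label_def by (rule someI)
  then show ?thesis using p by auto
qed

text \<open>
  One sort and two binary relations: \<open>proj u y\<close> says that \<open>u\<close> lies in the fibre over the index \<open>y\<close>, and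
  \<open>link\<close> relates points of different fibres. Both labels are elements of the universe, and the
  label of the projection also serves as the name of the sort.
\<close>

definition bundle_lang :: "'v::zfc lang" where
  "bundle_lang = \<lparr>Sorts = {proj_label}, Funs = {}, Rels = {proj_label, link_label},
     fun_args = \<lambda>_. [], fun_res = \<lambda>_. proj_label, rel_args = \<lambda>_. [proj_label, proj_label]\<rparr>"

definition edge :: "'v \<Rightarrow> 'v struc \<Rightarrow> 'v rel" where
  "edge R M = {(x, y). [x, y] \<in> rel_int M R}"

abbreviation proj :: "'v::zfc struc \<Rightarrow> 'v rel" where "proj \<equiv> edge proj_label"
abbreviation link :: "'v::zfc struc \<Rightarrow> 'v rel" where "link \<equiv> edge link_label"

definition make_bundle :: "'v::zfc set \<Rightarrow> 'v rel \<Rightarrow> 'v rel \<Rightarrow> 'v struc" where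
  "make_bundle A p l = \<lparr>univ = (\<lambda>s. if s = proj_label then A else {}),
     fun_int = (\<lambda>_ _. undefined),
     rel_int = (\<lambda>R. {[x, y] | x y. x \<in> A \<and> y \<in> A \<and>
       (R = proj_label \<and> (x, y) \<in> p \<or> R = link_label \<and> (x, y) \<in> l)})\<rparr>"

lemma listset_pair: "listset [A, B] = {[x, y] | x y. x \<in> A \<and> y \<in> B}"
  by (auto simp: set_Cons_def)

lemma bundle_lang_simps [simp]:
  "Sorts bundle_lang = {proj_label}" "Funs bundle_lang = {}"
  "Rels bundle_lang = {proj_label, link_label}"
  "rel_args bundle_lang R = [proj_label, proj_label]"
  by (simp_all add: bundle_lang_def)

lemma structure_of_bundle:
  assumes "structure_of bundle_lang M"
  shows "small (univ M proj_label)"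
    and "s \<noteq> proj_label \<Longrightarrow> univ M s = {}"
    and "fun_int M f xs = undefined"
    and "rel_int M R \<subseteq> {[x, y] | x y. x \<in> univ M proj_label \<and> y \<in> univ M proj_label}"
    and "R \<notin> Rels bundle_lang \<Longrightarrow> rel_int M R = {}"
proof -
  note s = assms[unfolded structure_of_def bundle_lang_simps list.map listset_pair]
  show "small (univ M proj_label)" using s by blast
  show "s \<noteq> proj_label \<Longrightarrow> univ M s = {}" using s by blast
  show "fun_int M f xs = undefined" using s by blast
  show "R \<notin> Rels bundle_lang \<Longrightarrow> rel_int M R = {}" using s unfolding bundle_lang_simps by blast
  then show "rel_int M R \<subseteq> {[x, y] | x y. x \<in> univ M proj_label \<and> y \<in> univ M proj_label}"
    using s unfolding bundle_lang_simps by blast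
qed

lemma elems_bundle:
  assumes "structure_of bundle_lang M"
  shows "elems M = univ M proj_label"
proof -
  have "univ M s \<subseteq> univ M proj_label" for s
    using structure_of_bundle(2)[OF assms] by (cases "s = proj_label") auto
  then show ?thesis unfolding elems_def by blast
qed

lemma tuples_bundle:
  "structure_of bundle_lang M \<Longrightarrow>
     tuples M [proj_label, proj_label] = {[x, y] | x y. x \<in> elems M \<and> y \<in> elems M}"
  by (simp only: list.map listset_pair elems_bundle)

lemma rel_int_bundle:
  "structure_of bundle_lang M \<Longrightarrow> xs \<in> rel_int M R \<Longrightarrow>
     \<exists>x y. xs = [x, y] \<and> x \<in> elems M \<and> y \<in> elems M"
  using structure_of_bundle(4) elems_bundle by fastforce

lemma edge_elems:
  assumes "structure_of bundle_lang M" "(x, y) \<in> edge R M"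
  shows "x \<in> elems M" "y \<in> elems M"
  using rel_int_bundle[OF assms(1), of "[x, y]" R] assms(2) unfolding edge_def by auto

lemma small_elems: "structure_of bundle_lang M \<Longrightarrow> small (elems M)"
  using structure_of_bundle(1) elems_bundle by metis

lemma bundle_eqI:
  assumes M: "structure_of bundle_lang M" and N: "structure_of bundle_lang N"
    and el: "elems M = elems N" and ed: "\<And>R. R \<in> Rels bundle_lang \<Longrightarrow> edge R M = edge R N"
  shows "M = N"
proof (rule struc.equality)
  show "univ M = univ N"
    using el structure_of_bundle(2)[OF M] structure_of_bundle(2)[OF N]
    unfolding elems_bundle[OF M] elems_bundle[OF N] by (intro ext) metis
  show "fun_int M = fun_int N"
    using structure_of_bundle(3)[OF M] structure_of_bundle(3)[OF N] by (intro ext) metis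
  have "xs \<in> rel_int M R \<longleftrightarrow> xs \<in> rel_int N R" for xs R
  proof (cases "R \<in> Rels bundle_lang")
    case True
    show ?thesis
    proof (cases "\<exists>x y. xs = [x, y]")
      case two: True
      then show ?thesis using ed[OF True] unfolding edge_def by blast
    next
      case False
      then show ?thesis using rel_int_bundle[OF M] rel_int_bundle[OF N] by blast
    qed
  next
    case False
    then show ?thesis using structure_of_bundle(5)[OF M] structure_of_bundle(5)[OF N] by blast
  qed
  then show "rel_int M = rel_int N" by (intro ext) blast
qed simp

lemma make_bundle:
  assumes "small A"
  shows "structure_of bundle_lang (make_bundle A p l)"
    and "elems (make_bundle A p l) = A"
    and "proj (make_bundle A p l) = p \<inter> A \<times> A"
    and "link (make_bundle A p l) = l \<inter> A \<times> A"
proof -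
  show "structure_of bundle_lang (make_bundle A p l)"
    unfolding structure_of_def bundle_lang_simps list.map listset_pair
    using assms by (auto simp: make_bundle_def)
  show "elems (make_bundle A p l) = A" by (auto simp: make_bundle_def elems_def)
  show "proj (make_bundle A p l) = p \<inter> A \<times> A" "link (make_bundle A p l) = l \<inter> A \<times> A"
    using labels_distinct[where 'v='a] by (auto simp: make_bundle_def edge_def)
qed

lemma substructure_bundle:
  assumes M: "structure_of bundle_lang M" and N: "structure_of bundle_lang N"
  shows "substructure bundle_lang M N \<longleftrightarrow>
    elems M \<subseteq> elems N \<and> (\<forall>R \<in> Rels bundle_lang. edge R M = edge R N \<inter> elems M \<times> elems M)"
proof -
  have rel: "rel_int M R = rel_int N R \<inter> tuples M [proj_label, proj_label] \<longleftrightarrow>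
      edge R M = edge R N \<inter> elems M \<times> elems M" for R
  proof
    assume "rel_int M R = rel_int N R \<inter> tuples M [proj_label, proj_label]"
    then show "edge R M = edge R N \<inter> elems M \<times> elems M"
      unfolding edge_def tuples_bundle[OF M] by auto
  next
    assume e: "edge R M = edge R N \<inter> elems M \<times> elems M"
    have sub: "rel_int M R \<subseteq> tuples M [proj_label, proj_label]"
      using rel_int_bundle[OF M] unfolding tuples_bundle[OF M] by blast
    have "xs \<in> rel_int M R \<longleftrightarrow> xs \<in> rel_int N R" if xs: "xs \<in> tuples M [proj_label, proj_label]" for xs
    proof -
      obtain x y where "xs = [x, y]" "x \<in> elems M" "y \<in> elems M"
        using xs tuples_bundle[OF M] by blast
      then show ?thesis using e unfolding edge_def by auto
    qed
    then show "rel_int M R = rel_int N R \<inter> tuples M [proj_label, proj_label]"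
      using sub by blast
  qed
  have "substructure bundle_lang M N \<longleftrightarrow> elems M \<subseteq> elems N \<and>
      (\<forall>R \<in> Rels bundle_lang. rel_int M R = rel_int N R \<inter> tuples M [proj_label, proj_label])"
    unfolding substructure_def elems_bundle[OF M] elems_bundle[OF N] bundle_lang_simps by simp
  then show ?thesis unfolding rel .
qed

lemma iso_bundle:
  assumes M: "structure_of bundle_lang M" and N: "structure_of bundle_lang N"
  shows "iso_struc bundle_lang h M N \<longleftrightarrow> bij_betw h (elems M) (elems N) \<and>
    (\<forall>R \<in> Rels bundle_lang. \<forall>x \<in> elems M. \<forall>y \<in> elems M.
       (x, y) \<in> edge R M \<longleftrightarrow> (h x, h y) \<in> edge R N)"
proof -
  have rel: "(\<forall>xs \<in> tuples M [proj_label, proj_label]. xs \<in> rel_int M R \<longleftrightarrow> map h xs \<in> rel_int N R) \<longleftrightarrow>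
     (\<forall>x \<in> elems M. \<forall>y \<in> elems M. (x, y) \<in> edge R M \<longleftrightarrow> (h x, h y) \<in> edge R N)" (is "?l R \<longleftrightarrow> _") for R
  proof -
    have "?l R \<longleftrightarrow> (\<forall>x \<in> elems M. \<forall>y \<in> elems M. [x, y] \<in> rel_int M R \<longleftrightarrow> map h [x, y] \<in> rel_int N R)"
      unfolding tuples_bundle[OF M] by blast
    then show ?thesis by (simp add: edge_def)
  qed
  have "iso_struc bundle_lang h M N \<longleftrightarrow> bij_betw h (elems M) (elems N) \<and>
      (\<forall>R \<in> Rels bundle_lang. \<forall>xs \<in> tuples M [proj_label, proj_label].
         xs \<in> rel_int M R \<longleftrightarrow> map h xs \<in> rel_int N R)"
    unfolding iso_struc_def elems_bundle[OF M] elems_bundle[OF N] bundle_lang_simps by simp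
  then show ?thesis unfolding rel .
qed

text \<open>
  A point of a fibre is never itself an index. Together with the bound on the fibres this lets
  a set be closed under fibres in one step, at the cost of \<open>|D|\<close> many elements, which gives the
  Loewenheim-Skolem property.
\<close>

definition bundles :: "'v::zfc set \<Rightarrow> 'v struc set" where
  "bundles D = {M. structure_of bundle_lang M \<and>
     (\<forall>x y w. (x, y) \<in> proj M \<longrightarrow> (w, x) \<notin> proj M) \<and>
     (\<forall>y. |{u. (u, y) \<in> proj M}| \<le>o |D| )}"

text \<open>
  A strong extension does not enlarge a fibre, except that a structure without any fibre point may
  acquire fibres. The exception makes a bare set of indices a strong substructure of a bundle over
  it. The rule makes strong embeddings that fix the indices surjective on fibres, so that
  an amalgam of two bundles identifies their fibres.
\<close>

definition bundle_ext :: "'v::zfc set \<Rightarrow> 'v struc rel" where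
  "bundle_ext D = {(M, N). M \<in> bundles D \<and> N \<in> bundles D \<and> substructure bundle_lang M N \<and>
     (proj M \<noteq> {} \<longrightarrow> (\<forall>u y. (u, y) \<in> proj N \<and> y \<in> elems M \<longrightarrow> u \<in> elems M))}"

definition bundle_class :: "'v::zfc set \<Rightarrow> 'v aec" where
  "bundle_class D = \<lparr>lang_of = bundle_lang, models = bundles D, strong = bundle_ext D\<rparr>"

lemma bundle_class_simps [simp]:
  "lang_of (bundle_class D) = bundle_lang" "models (bundle_class D) = bundles D"
  "strong (bundle_class D) = bundle_ext D"
  by (simp_all add: bundle_class_def)

lemma bundles_structure: "M \<in> bundles D \<Longrightarrow> structure_of bundle_lang M"
  by (simp add: bundles_def)

lemma bundle_ext_iff:
  "(M, N) \<in> bundle_ext D \<longleftrightarrow> M \<in> bundles D \<and> N \<in> bundles D \<and> elems M \<subseteq> elems N \<and>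
     (\<forall>R \<in> Rels bundle_lang. edge R M = edge R N \<inter> elems M \<times> elems M) \<and>
     (proj M \<noteq> {} \<longrightarrow> (\<forall>u y. (u, y) \<in> proj N \<and> y \<in> elems M \<longrightarrow> u \<in> elems M))"
  unfolding bundle_ext_def using substructure_bundle[of M N] bundles_structure by blast

lemma bundle_extI:
  assumes "M \<in> bundles D" "N \<in> bundles D" "elems M \<subseteq> elems N"
    and "\<And>R. R \<in> Rels bundle_lang \<Longrightarrow> edge R M = edge R N \<inter> elems M \<times> elems M"
    and "\<And>u y. proj M \<noteq> {} \<Longrightarrow> (u, y) \<in> proj N \<Longrightarrow> y \<in> elems M \<Longrightarrow> u \<in> elems M"
  shows "(M, N) \<in> bundle_ext D"
  unfolding bundle_ext_iff using assms by blast

lemma bundle_extD: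
  assumes "(M, N) \<in> bundle_ext D"
  shows "M \<in> bundles D" "N \<in> bundles D" "elems M \<subseteq> elems N"
    and "R \<in> Rels bundle_lang \<Longrightarrow> edge R M = edge R N \<inter> elems M \<times> elems M"
    and "proj M = proj N \<inter> elems M \<times> elems M"
    and "proj M \<noteq> {} \<Longrightarrow> (u, y) \<in> proj N \<Longrightarrow> y \<in> elems M \<Longrightarrow> u \<in> elems M"
proof -
  note a = assms[unfolded bundle_ext_iff]
  show "M \<in> bundles D" using a by blast
  show "N \<in> bundles D" using a by blast
  show "elems M \<subseteq> elems N" using a by blast
  show "edge R M = edge R N \<inter> elems M \<times> elems M" if "R \<in> Rels bundle_lang" for R
    using a that by blast
  then show "proj M = proj N \<inter> elems M \<times> elems M" by simp
  show "u \<in> elems M" if "proj M \<noteq> {}" "(u, y) \<in> proj N" "y \<in> elems M"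
    using a that by blast
qed

lemma bundle_ext_trans:
  assumes LM: "(L, M) \<in> bundle_ext D" and MN: "(M, N) \<in> bundle_ext D"
  shows "(L, N) \<in> bundle_ext D"
proof (rule bundle_extI)
  note LM = bundle_extD[OF LM] and MN = bundle_extD[OF MN]
  show "L \<in> bundles D" "N \<in> bundles D" using LM(1) MN(2) .
  show "elems L \<subseteq> elems N" using LM(3) MN(3) by (rule subset_trans)
  show "edge R L = edge R N \<inter> elems L \<times> elems L" if "R \<in> Rels bundle_lang" for R
    using LM(4)[OF that] MN(4)[OF that] LM(3) by auto
  show "u \<in> elems L" if L: "proj L \<noteq> {}" and u: "(u, y) \<in> proj N" "y \<in> elems L" for u y
  proof -
    have "proj L \<subseteq> proj M" using LM(5) by blast
    then have "proj M \<noteq> {}" using L by blast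
    then have "u \<in> elems M" using MN(6) u LM(3) by blast
    then have "(u, y) \<in> proj M" using MN(5) u LM(3) by blast
    then show ?thesis using LM(6)[OF L] u by blast
  qed
qed

lemma bundle_ext_refl:
  assumes "M \<in> bundles D"
  shows "(M, M) \<in> bundle_ext D"
proof (rule bundle_extI[OF assms assms])
  show "edge R M = edge R M \<inter> elems M \<times> elems M" for R
    using edge_elems[OF bundles_structure[OF assms]] by auto
  show "u \<in> elems M" if "(u, y) \<in> proj M" for u y
    using edge_elems(1)[OF bundles_structure[OF assms] that] .
qed simp

lemma bundle_ext_partial_order: "partial_order_on (bundles D) (bundle_ext D)"
proof -
  have "refl_on (bundles D) (bundle_ext D)" using bundle_ext_refl by (rule refl_onI)
  moreover have "trans (bundle_ext D)" using bundle_ext_trans by (rule transI)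
  moreover have "antisym (bundle_ext D)"
  proof (rule antisymI)
    fix M N assume MN: "(M, N) \<in> bundle_ext D" and NM: "(N, M) \<in> bundle_ext D"
    show "M = N"
    proof (rule bundle_eqI)
      show "structure_of bundle_lang M" "structure_of bundle_lang N"
        using bundle_extD(1)[OF MN] bundle_extD(1)[OF NM] by (simp_all add: bundles_structure)
      show "elems M = elems N" using bundle_extD(3)[OF MN] bundle_extD(3)[OF NM] by blast
      show "edge R M = edge R N" if "R \<in> Rels bundle_lang" for R
        using bundle_extD(4)[OF MN that] bundle_extD(4)[OF NM that] by blast
    qed
  qed
  moreover have "bundle_ext D \<subseteq> bundles D \<times> bundles D" unfolding bundle_ext_def by auto
  ultimately show ?thesis unfolding partial_order_on_def preorder_on_def by simp
qed

lemma bundle_iso: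
  assumes "structure_of bundle_lang M" "structure_of bundle_lang N" "iso_struc bundle_lang h M N"
  shows "h ` elems M = elems N"
    and "R \<in> Rels bundle_lang \<Longrightarrow> x \<in> elems M \<Longrightarrow> y \<in> elems M \<Longrightarrow>
       (x, y) \<in> edge R M \<longleftrightarrow> (h x, h y) \<in> edge R N"
    and "x \<in> elems M \<Longrightarrow> y \<in> elems M \<Longrightarrow> (x, y) \<in> proj M \<longleftrightarrow> (h x, h y) \<in> proj N"
proof -
  note a = assms(3)[unfolded iso_bundle[OF assms(1,2)]]
  show "h ` elems M = elems N" using a unfolding bij_betw_def by blast
  show "(x, y) \<in> edge R M \<longleftrightarrow> (h x, h y) \<in> edge R N"
    if "R \<in> Rels bundle_lang" "x \<in> elems M" "y \<in> elems M" for R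
    using a that by blast
  from this[of proj_label] show "(x, y) \<in> proj M \<longleftrightarrow> (h x, h y) \<in> proj N"
    if "x \<in> elems M" "y \<in> elems M"
    using that unfolding bundle_lang_simps by blast
qed

lemma bundles_iso:
  assumes M: "M \<in> bundles D" and N: "structure_of bundle_lang N" and iso: "iso_struc bundle_lang h M N"
  shows "N \<in> bundles D"
proof -
  note iN = bundle_iso(1)[OF bundles_structure[OF M] N iso]
  note ed = bundle_iso(3)[OF bundles_structure[OF M] N iso]
  have img: "\<exists>x \<in> elems M. h x = x'" if "x' \<in> elems N" for x'
    using that unfolding iN[symmetric] by blast
  have nopath: "(w', x') \<notin> proj N" if xy: "(x', y') \<in> proj N" for x' y' w'
  proof
    assume wx: "(w', x') \<in> proj N"
    obtain w where w: "w \<in> elems M" "h w = w'" using img[OF edge_elems(1)[OF N wx]] by blast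
    obtain x where x: "x \<in> elems M" "h x = x'" using img[OF edge_elems(2)[OF N wx]] by blast
    obtain y where y: "y \<in> elems M" "h y = y'" using img[OF edge_elems(2)[OF N xy]] by blast
    have "(x, y) \<in> proj M" "(w, x) \<in> proj M" using ed xy wx w x y by auto
    then show False using M unfolding bundles_def by blast
  qed
  have "|{u. (u, y') \<in> proj N}| \<le>o |D|" for y'
  proof (cases "y' \<in> elems N")
    case True
    then obtain y where y: "y \<in> elems M" "h y = y'" using img by blast
    have "{u. (u, y') \<in> proj N} \<subseteq> h ` {u. (u, y) \<in> proj M}"
    proof
      fix u' assume "u' \<in> {u. (u, y') \<in> proj N}"
      then have u': "(u', y') \<in> proj N" by blast
      obtain u where u: "u \<in> elems M" "h u = u'" using img[OF edge_elems(1)[OF N u']] by blast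
      have "(u, y) \<in> proj M" using ed[OF u(1) y(1)] u(2) y(2) u' by simp
      then show "u' \<in> h ` {u. (u, y) \<in> proj M}" using u(2) by blast
    qed
    then have "|{u. (u, y') \<in> proj N}| \<le>o |{u. (u, y) \<in> proj M}|"
      using card_of_image card_of_mono1 ordLeq_transitive by blast
    then show ?thesis using M ordLeq_transitive unfolding bundles_def by blast
  next
    case False
    then have "{u. (u, y') \<in> proj N} = {}" using edge_elems[OF N] by blast
    then show ?thesis by (metis card_of_empty)
  qed
  then show ?thesis unfolding bundles_def using N nopath by blast
qed

lemma bundle_ext_iso:
  assumes MN: "(M, N) \<in> bundle_ext D"
    and M': "structure_of bundle_lang M'" and N': "structure_of bundle_lang N'"
    and hN: "iso_struc bundle_lang h N N'" and hM: "iso_struc bundle_lang h M M'"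
  shows "(M', N') \<in> bundle_ext D"
proof (rule bundle_extI)
  note MNs = bundle_extD[OF MN]
  note M = bundles_structure[OF MNs(1)] and N = bundles_structure[OF MNs(2)]
  note iM = bundle_iso(1)[OF M M' hM] and iN = bundle_iso(1)[OF N N' hN]
  show "M' \<in> bundles D" "N' \<in> bundles D"
    using bundles_iso[OF MNs(1) M' hM] bundles_iso[OF MNs(2) N' hN] .
  show "elems M' \<subseteq> elems N'" using MNs(3) unfolding iM[symmetric] iN[symmetric] by (rule image_mono)
  show "edge R M' = edge R N' \<inter> elems M' \<times> elems M'" if R: "R \<in> Rels bundle_lang" for R
  proof -
    have "(x', y') \<in> edge R M' \<longleftrightarrow> (x', y') \<in> edge R N'" if xy': "x' \<in> elems M'" "y' \<in> elems M'" for x' y'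
    proof -
      obtain x y where xy: "x \<in> elems M" "y \<in> elems M" "h x = x'" "h y = y'"
        using xy' unfolding iM[symmetric] by blast
      have "(x', y') \<in> edge R M' \<longleftrightarrow> (x, y) \<in> edge R M"
        using bundle_iso(2)[OF M M' hM R xy(1,2)] unfolding xy(3,4) by blast
      also have "\<dots> \<longleftrightarrow> (x, y) \<in> edge R N" using MNs(4)[OF R] xy by blast
      also have "\<dots> \<longleftrightarrow> (x', y') \<in> edge R N'" 
        using bundle_iso(2)[OF N N' hN R, of x y] xy MNs(3) by blast
      finally show ?thesis .
    qed
    moreover have "edge R M' \<subseteq> elems M' \<times> elems M'" using edge_elems[OF M'] by auto
    ultimately show ?thesis by blast
  qed
  show "u' \<in> elems M'" if ne: "proj M' \<noteq> {}" and u': "(u', y') \<in> proj N'" "y' \<in> elems M'" for u' y'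
  proof -
    obtain a' b' where ab: "(a', b') \<in> proj M'" using ne by auto
    then obtain a b where ab': "a \<in> elems M" "b \<in> elems M" "h a = a'" "h b = b'"
      using edge_elems[OF M' ab] unfolding iM[symmetric] by blast
    then have ne: "proj M \<noteq> {}" using ab bundle_iso(3)[OF M M' hM ab'(1,2)] by auto
    obtain y where y: "y \<in> elems M" "h y = y'" using u'(2) unfolding iM[symmetric] by blast
    obtain u where u: "u \<in> elems N" "h u = u'"
      using edge_elems(1)[OF N' u'(1)] unfolding iN[symmetric] by blast
    have "(u, y) \<in> proj N" using bundle_iso(3)[OF N N' hN u(1), of y] u y u' MNs(3) by auto
    then have "u \<in> elems M" using MNs(6)[OF ne _ y(1)] by blast
    then show ?thesis using u(2) iM by blast
  qed
qed

text \<open>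
  Once a member of the chain has a fibre point, later members do not enlarge its fibres, and so
  neither does the union.
\<close>

lemma bundle_union:
  assumes dir: "\<And>i j. i \<in> I \<Longrightarrow> j \<in> I \<Longrightarrow> (M i, M j) \<in> bundle_ext D \<or> (M j, M i) \<in> bundle_ext D"
    and U: "is_union bundle_lang I M U"
  shows "U \<in> bundles D"
    and "i \<in> I \<Longrightarrow> (M i, U) \<in> bundle_ext D"
    and "(\<And>i. i \<in> I \<Longrightarrow> (M i, N) \<in> bundle_ext D) \<Longrightarrow> I \<noteq> {} \<Longrightarrow> (U, N) \<in> bundle_ext D"
proof -
  have Mi: "M i \<in> bundles D" if "i \<in> I" for i
    using dir[OF that that] bundle_extD(1) by blast
  have Ms: "structure_of bundle_lang (M i)" if "i \<in> I" for i
    using bundles_structure[OF Mi[OF that]] .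
  have Us: "structure_of bundle_lang U" using U unfolding is_union_def by blast
  have elU: "elems U = (\<Union>i\<in>I. elems (M i))"
    using U elems_bundle[OF Us] elems_bundle[OF Ms] unfolding is_union_def bundle_lang_simps by simp
  have edU: "edge R (M i) = edge R U \<inter> elems (M i) \<times> elems (M i)"
    if "i \<in> I" "R \<in> Rels bundle_lang" for i R
  proof -
    have "substructure bundle_lang (M i) U" using U that(1) unfolding is_union_def by blast
    then show ?thesis using that(2) unfolding substructure_bundle[OF Ms[OF that(1)] Us] by blast
  qed
  have pU: "proj (M i) = proj U \<inter> elems (M i) \<times> elems (M i)" if "i \<in> I" for i
    using edU[OF that, of proj_label] by simp
  have above: "\<exists>k \<in> I. (k = i \<or> k = j) \<and> (M i, M k) \<in> bundle_ext D \<and> (M j, M k) \<in> bundle_ext D"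
    if "i \<in> I" "j \<in> I" for i j
    using dir[OF that] bundle_ext_refl Mi that by blast
  have two: "\<exists>k \<in> I. x \<in> elems (M k) \<and> y \<in> elems (M k)" if xy: "x \<in> elems U" "y \<in> elems U" for x y
  proof -
    obtain i j where ij: "i \<in> I" "j \<in> I" "x \<in> elems (M i)" "y \<in> elems (M j)" using xy elU by blast
    obtain k where "k \<in> I" "(M i, M k) \<in> bundle_ext D" "(M j, M k) \<in> bundle_ext D"
      using above[OF ij(1,2)] by blast
    then show ?thesis using bundle_extD(3) ij(3,4) by blast
  qed
  have projk: "\<exists>k \<in> I. (x, y) \<in> proj (M k)" if xy: "(x, y) \<in> proj U" for x y
    using two[OF edge_elems[OF Us xy]] pU xy by blast
  have fib: "u \<in> elems (M i)"
    if i: "i \<in> I" "proj (M i) \<noteq> {}" and u: "(u, y) \<in> proj U" "y \<in> elems (M i)" for u y i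
  proof -
    obtain k where k: "k \<in> I" "(u, y) \<in> proj (M k)" using projk[OF u(1)] by blast
    from dir[OF i(1) k(1)] show ?thesis
    proof
      assume "(M i, M k) \<in> bundle_ext D"
      from bundle_extD(6)[OF this i(2) k(2) u(2)] show ?thesis .
    next
      assume "(M k, M i) \<in> bundle_ext D"
      then have "elems (M k) \<subseteq> elems (M i)" by (rule bundle_extD)
      then show ?thesis using edge_elems(1)[OF Ms[OF k(1)] k(2)] by blast
    qed
  qed
  have nopath: "(w, x) \<notin> proj U" if xy: "(x, y) \<in> proj U" for x y w
  proof
    assume wx: "(w, x) \<in> proj U"
    obtain i where i: "i \<in> I" "(x, y) \<in> proj (M i)" using projk[OF xy] by blast
    obtain j where j: "j \<in> I" "(w, x) \<in> proj (M j)" using projk[OF wx] by blast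
    obtain k where k: "k \<in> I" "(M i, M k) \<in> bundle_ext D" "(M j, M k) \<in> bundle_ext D"
      using above[OF i(1) j(1)] by blast
    have "(x, y) \<in> proj (M k)" "(w, x) \<in> proj (M k)"
      using bundle_extD(5)[OF k(2)] bundle_extD(5)[OF k(3)] i j by blast+
    then show False using Mi[OF k(1)] unfolding bundles_def by blast
  qed
  have size: "|{u. (u, y) \<in> proj U}| \<le>o |D|" for y
  proof (cases "{u. (u, y) \<in> proj U} = {}")
    case True
    then show ?thesis by (metis card_of_empty)
  next
    case False
    then obtain u where "(u, y) \<in> proj U" by blast
    then obtain i where i: "i \<in> I" "(u, y) \<in> proj (M i)" using projk by blast
    then have ne: "proj (M i) \<noteq> {}" by blast
    have y: "y \<in> elems (M i)" using edge_elems(2)[OF Ms[OF i(1)] i(2)] .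
    have "{u. (u, y) \<in> proj U} \<subseteq> {u. (u, y) \<in> proj (M i)}"
      using fib[OF i(1) ne _ y] pU[OF i(1)] y by blast
    then have "|{u. (u, y) \<in> proj U}| \<le>o |{u. (u, y) \<in> proj (M i)}|" by (rule card_of_mono1)
    moreover have "|{u. (u, y) \<in> proj (M i)}| \<le>o |D|"
      using Mi[OF i(1)] unfolding bundles_def by blast
    ultimately show ?thesis by (rule ordLeq_transitive)
  qed
  show Ub: "U \<in> bundles D" unfolding bundles_def using Us nopath size by blast
  show "(M i, U) \<in> bundle_ext D" if i: "i \<in> I" for i
    using Mi[OF i] Ub
  proof (rule bundle_extI)
    show "elems (M i) \<subseteq> elems U" using elU i by blast
  qed (use edU[OF i] fib[OF i] in blast)+
  show "(U, N) \<in> bundle_ext D"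
    if N: "\<And>i. i \<in> I \<Longrightarrow> (M i, N) \<in> bundle_ext D" and "I \<noteq> {}"
  proof (rule bundle_extI)
    show "U \<in> bundles D" by (rule Ub)
    show "N \<in> bundles D" using bundle_extD(2)[OF N] \<open>I \<noteq> {}\<close> by blast
    show "elems U \<subseteq> elems N" using bundle_extD(3)[OF N] unfolding elU by blast
    show "edge R U = edge R N \<inter> elems U \<times> elems U" if R: "R \<in> Rels bundle_lang" for R
    proof -
      have "(x, y) \<in> edge R U \<longleftrightarrow> (x, y) \<in> edge R N" if xy: "x \<in> elems U" "y \<in> elems U" for x y
      proof -
        obtain k where k: "k \<in> I" "x \<in> elems (M k)" "y \<in> elems (M k)" using two[OF xy] by blast
        show ?thesis using bundle_extD(4)[OF N[OF k(1)] R] edU[OF k(1) R] k(2,3) by blast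
      qed
      moreover have "edge R U \<subseteq> elems U \<times> elems U" using edge_elems[OF Us] by auto
      ultimately show ?thesis by blast
    qed
    show "u \<in> elems U" if ne: "proj U \<noteq> {}" and u: "(u, y) \<in> proj N" "y \<in> elems U" for u y
    proof -
      obtain a b where "(a, b) \<in> proj U" using ne by auto
      then obtain i where i: "i \<in> I" "(a, b) \<in> proj (M i)" using projk by blast
      obtain j where j: "j \<in> I" "y \<in> elems (M j)" using u elU by blast
      obtain k where k: "k \<in> I" "(M i, M k) \<in> bundle_ext D" "(M j, M k) \<in> bundle_ext D"
        using above[OF i(1) j(1)] by blast
      have "proj (M k) \<noteq> {}" using bundle_extD(5)[OF k(2)] i(2) by blast
      moreover have "y \<in> elems (M k)" using bundle_extD(3)[OF k(3)] j(2) by blast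
      ultimately have "u \<in> elems (M k)" using bundle_extD(6)[OF N[OF k(1)] _ u(1)] by blast
      then show ?thesis using k(1) elU by blast
    qed
  qed
qed

lemma LS_property_bundle_class:
  assumes D: "small D" "infinite D"
  shows "LS_property (bundle_class D) |D|"
proof -
  have "lang_card (lang_of (bundle_class D)) +c natLeq \<le>o |D|"
  proof (rule csum_cinfinite_bound)
    show "lang_card (lang_of (bundle_class D)) \<le>o |D|"
      unfolding lang_card_def
      by (rule ordLess_imp_ordLeq[OF finite_ordLess_infinite])
        (use D in \<open>simp_all add: card_of_well_order_on Field_card_of\<close>)
    show inf: "Cinfinite |D|" using D(2) by (simp add: cinfinite_def card_of_card_order_on Field_card_of)
    show "natLeq \<le>o |D|" using inf by (rule natLeq_ordLeq_cinfinite)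
  qed (simp_all add: lang_card_def card_of_card_order_on Field_card_of natLeq_Card_order)
  moreover have "\<exists>M. (M, N) \<in> bundle_ext D \<and> X \<subseteq> elems M \<and> |elems M| \<le>o |X| +c |D|"
    if N: "N \<in> bundles D" and X: "X \<subseteq> elems N" for N X
  proof -
    have Ns: "structure_of bundle_lang N" using N by (rule bundles_structure)
    define A where "A = X \<union> (\<Union>y\<in>X. {u. (u, y) \<in> proj N})"
    define M where "M = make_bundle A (proj N) (link N)"
    have AN: "A \<subseteq> elems N" unfolding A_def using X edge_elems[OF Ns] by blast
    have sA: "small A" using small_subset[OF small_elems[OF Ns] AN] .
    note M = make_bundle[OF sA, of "proj N" "link N", folded M_def]
    have "|{u. (u, y) \<in> proj M}| \<le>o |D|" for y
    proof -
      have "{u. (u, y) \<in> proj M} \<subseteq> {u. (u, y) \<in> proj N}" using M(3) by auto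
      then show ?thesis using card_of_mono1 ordLeq_transitive N unfolding bundles_def by blast
    qed
    moreover have "(w, x) \<notin> proj M" if "(x, y) \<in> proj M" for x y w
      using that N unfolding M(3) bundles_def by blast
    ultimately have Mb: "M \<in> bundles D" unfolding bundles_def using M(1) by blast
    have closed: "u \<in> A" if u: "(u, y) \<in> proj N" "y \<in> A" for u y
    proof -
      have "y \<in> X" using N u unfolding A_def bundles_def by blast
      then show ?thesis using u unfolding A_def by blast
    qed
    have "(M, N) \<in> bundle_ext D"
    proof (rule bundle_extI[OF Mb N])
      show "elems M \<subseteq> elems N" using M(2) AN by simp
      show "edge R M = edge R N \<inter> elems M \<times> elems M" if "R \<in> Rels bundle_lang" for R
        using M(2-4) that by auto
      show "u \<in> elems M" if "(u, y) \<in> proj N" "y \<in> elems M" for u y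
        using closed that M(2) by simp
    qed
    moreover have "|elems M| \<le>o |X| +c |D|"
    proof -
      have inf: "infinite (X <+> D)" using D(2) by simp
      have X: "|X| \<le>o |X <+> D|" by (rule card_of_Plus1)
      have "|{u. (u, y) \<in> proj N}| \<le>o |X <+> D|" for y
        using N card_of_Plus2 ordLeq_transitive unfolding bundles_def by blast
      then have "|\<Union>y\<in>X. {u. (u, y) \<in> proj N}| \<le>o |X <+> D|"
        by (intro card_of_UNION_ordLeq_infinite[OF inf X]) blast
      then have "|A| \<le>o |X <+> D|"
        unfolding A_def using inf X
        by (intro card_of_Un_ordLeq_infinite_Field) (simp_all add: Field_card_of card_of_card_order_on)
      then show ?thesis using M(2) by (simp add: csum_def Field_card_of)
    qed
    ultimately show ?thesis using M(2) unfolding A_def by blast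
  qed
  ultimately show ?thesis unfolding LS_property_def using cardinal_card_of[OF D(1)] by simp
qed

text \<open>
  The least number with the Loewenheim-Skolem property exists because cardinals are well-ordered.
\<close>

lemma LS_number_bundle_class:
  assumes D: "small D" "infinite D"
  obtains \<mu> where "LS_number (bundle_class D) \<mu>" "\<mu> \<le>o |D|"
proof -
  obtain \<mu> where \<mu>: "LS_property (bundle_class D) \<mu>"
    and min: "\<And>\<nu>. \<nu> <o \<mu> \<Longrightarrow> \<not> LS_property (bundle_class D) \<nu>"
    using wfE_min[OF wf_ordLess, of "|D|" "{\<nu>. LS_property (bundle_class D) \<nu>}"]
      LS_property_bundle_class[OF D] unfolding mem_Collect_eq by blast
  have \<mu>_le: "\<mu> \<le>o \<nu>" if "LS_property (bundle_class D) \<nu>" for \<nu>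
  proof -
    have "Card_order \<mu>" "Card_order \<nu>"
      using \<mu> that unfolding LS_property_def cardinal_def by blast+
    then have "Well_order \<mu>" "Well_order \<nu>" by (simp_all add: card_order_on_well_order_on)
    then show ?thesis using min[of \<nu>] that not_ordLess_iff_ordLeq[of \<mu> \<nu>] by blast
  qed
  then have "LS_number (bundle_class D) \<mu>" unfolding LS_number_def using \<mu> \<mu>_le by blast
  then show thesis
  proof (rule that)
    show "\<mu> \<le>o |D|" by (fact \<mu>_le[OF LS_property_bundle_class[OF D]])
  qed
qed

lemma AEC_bundle_class:
  assumes D: "small D" "infinite D"
  shows "AEC (bundle_class D)"
  unfolding AEC_def bundle_class_simps
proof (intro conjI)
  let ?K = "bundle_class D"
  have sing: "small {x}" for x :: 'a
  proof -
    obtain w e :: 'a where "e \<in> elts w" using infinity by blast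
    then have "small {e}" using small_subset[of "elts w" "{e}"] unfolding small_def by blast
    then show ?thesis using small_image[of "{e}" "\<lambda>_. x"] by simp
  qed
  show "language (bundle_lang :: 'a lang)"
    unfolding language_def
    using sing small_Un[OF sing[of proj_label] sing[of link_label]] small_subset[OF sing, of "{}"]
    by (simp add: insert_commute)
  show "\<forall>M \<in> bundles D. structure_of bundle_lang M" using bundles_structure by blast
  show "partial_order_on (bundles D) (bundle_ext D)" by (rule bundle_ext_partial_order)
  show "\<forall>M N h. M \<in> bundles D \<and> structure_of bundle_lang N \<and> iso_struc bundle_lang h M N \<longrightarrow>
      N \<in> bundles D"
    by (intro allI impI, elim conjE, rule bundles_iso)
  show "\<forall>M N M' N' h. (M, N) \<in> bundle_ext D \<and> structure_of bundle_lang M' \<and>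
      structure_of bundle_lang N' \<and> iso_struc bundle_lang h N N' \<and> iso_struc bundle_lang h M M' \<longrightarrow>
      (M', N') \<in> bundle_ext D"
    by (intro allI impI, elim conjE, rule bundle_ext_iso)
  show "\<forall>M N. (M, N) \<in> bundle_ext D \<longrightarrow> substructure bundle_lang M N"
    unfolding bundle_ext_def by blast
  show "\<forall>M0 M1 M2. substructure bundle_lang M0 M1 \<and> (M0, M2) \<in> bundle_ext D \<and>
      (M1, M2) \<in> bundle_ext D \<longrightarrow> (M0, M1) \<in> bundle_ext D"
  proof (intro allI impI, elim conjE)
    fix M0 M1 M2
    assume sub: "substructure bundle_lang M0 M1"
      and 02: "(M0, M2) \<in> bundle_ext D" and 12: "(M1, M2) \<in> bundle_ext D"
    have "u \<in> elems M0" if "proj M0 \<noteq> {}" "(u, y) \<in> proj M1" "y \<in> elems M0" for u y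
      using bundle_extD(6)[OF 02 that(1) _ that(3)] that(2) bundle_extD(5)[OF 12] by blast
    then show "(M0, M1) \<in> bundle_ext D"
      using sub bundle_extD(1)[OF 02] bundle_extD(1)[OF 12] unfolding bundle_ext_def by blast
  qed
  show "\<forall>r M U. Well_order r \<and> small (Field r) \<and> Field r \<noteq> {} \<and>
      continuous_chain ?K r M \<and> is_union bundle_lang (Field r) M U \<longrightarrow>
      U \<in> bundles D \<and> (\<forall>i \<in> Field r. (M i, U) \<in> bundle_ext D) \<and>
      (\<forall>N. (\<forall>i \<in> Field r. (M i, N) \<in> bundle_ext D) \<longrightarrow> (U, N) \<in> bundle_ext D)"
  proof (intro allI impI, elim conjE)
    fix r :: "'a rel" and M U
    assume r: "Well_order r" "Field r \<noteq> {}" and ch: "continuous_chain ?K r M"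
      and U: "is_union bundle_lang (Field r) M U"
    have dir: "(M i, M j) \<in> bundle_ext D \<or> (M j, M i) \<in> bundle_ext D"
      if "i \<in> Field r" "j \<in> Field r" for i j
    proof -
      have "(i, j) \<in> r \<or> (j, i) \<in> r" using wo_rel.TOTALS[of r] r(1) that unfolding wo_rel_def by blast
      then show ?thesis using ch unfolding continuous_chain_def bundle_class_simps by blast
    qed
    show "U \<in> bundles D \<and> (\<forall>i \<in> Field r. (M i, U) \<in> bundle_ext D) \<and>
      (\<forall>N. (\<forall>i \<in> Field r. (M i, N) \<in> bundle_ext D) \<longrightarrow> (U, N) \<in> bundle_ext D)"
      using bundle_union(1)[OF dir U] bundle_union(2)[OF dir U] bundle_union(3)[OF dir U _ r(2)] by blast
  qed
  show "\<exists>\<mu>. LS_number ?K \<mu>" using LS_number_bundle_class[OF D] by blast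
qed

section \<open>Galois types in the class of bundles\<close>

lemma gal_relD:
  assumes "((a, M, N1), (b, M', N2)) \<in> gal_rel (bundle_class D)"
  shows "M' = M" "(M, N1) \<in> bundle_ext D" "a \<in> elems N1" "(M, N2) \<in> bundle_ext D" "b \<in> elems N2"
    and "\<exists>N f1 f2. K_embedding (bundle_class D) f1 N1 N \<and> K_embedding (bundle_class D) f2 N2 N \<and>
      (\<forall>m \<in> elems M. f1 m = m \<and> f2 m = m) \<and> f1 a = f2 b"
  using assms unfolding gal_rel_def bundle_class_simps by blast+

lemma gal_relI:
  assumes "(M, N1) \<in> bundle_ext D" "a \<in> elems N1" "(M, N2) \<in> bundle_ext D" "b \<in> elems N2"
    and "K_embedding (bundle_class D) f1 N1 N" "K_embedding (bundle_class D) f2 N2 N"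
    and "\<And>m. m \<in> elems M \<Longrightarrow> f1 m = m" "\<And>m. m \<in> elems M \<Longrightarrow> f2 m = m" "f1 a = f2 b"
  shows "((a, M, N1), (b, M, N2)) \<in> gal_rel (bundle_class D)"
proof -
  have "N \<in> bundles D" using assms(5) bundle_extD(2) unfolding K_embedding_def bundle_class_simps by blast
  then show ?thesis unfolding gal_rel_def bundle_class_simps using assms by blast
qed

lemma gal_rel_triple:
  assumes "(s, t) \<in> gal_rel K"
  obtains a M N b N' where "s = (a, M, N)" "t = (b, M, N')"
  using assms unfolding gal_rel_def by blast

lemma iso_struc_refl: "structure_of bundle_lang M \<Longrightarrow> iso_struc bundle_lang id M M"
  by (simp add: iso_bundle)

lemma K_embedding_incl: "(M, N) \<in> bundle_ext D \<Longrightarrow> K_embedding (bundle_class D) id M N"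
  unfolding K_embedding_def bundle_class_simps
  using iso_struc_refl bundles_structure bundle_extD(1) by blast

lemma gal_rel_refl:
  assumes "(M, N) \<in> bundle_ext D" "a \<in> elems N"
  shows "((a, M, N), (a, M, N)) \<in> gal_rel (bundle_class D)"
proof -
  have e: "K_embedding (bundle_class D) id N N"
    using K_embedding_incl[OF bundle_ext_refl[OF bundle_extD(2)[OF assms(1)]]] .
  show ?thesis by (rule gal_relI[OF assms assms e e]) simp_all
qed

lemma gal_rel_sym: "sym (gal_rel (bundle_class D))"
proof (rule symI)
  fix s t assume st: "(s, t) \<in> gal_rel (bundle_class D)"
  then obtain a M N b N' where eq: "s = (a, M, N)" "t = (b, M, N')" by (rule gal_rel_triple)
  note d = gal_relD[OF st[unfolded eq]]
  obtain N'' f1 f2 where f: "K_embedding (bundle_class D) f1 N N''"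
    "K_embedding (bundle_class D) f2 N' N''" "\<forall>m \<in> elems M. f1 m = m \<and> f2 m = m" "f1 a = f2 b"
    using d(6) by blast
  show "(t, s) \<in> gal_rel (bundle_class D)"
    unfolding eq using d(4,5,2,3) f(2,1) by (rule gal_relI) (use f(3,4) in simp_all)
qed

lemma gtp_eqI:
  assumes "((a, M, N), (b, M, N')) \<in> (gal_rel (bundle_class D))\<^sup>+"
  shows "gtp (bundle_class D) a M N = gtp (bundle_class D) b M N'"
proof -
  have "((b, M, N'), (a, M, N)) \<in> (gal_rel (bundle_class D))\<^sup>+"
    using assms sym_trancl[OF gal_rel_sym] by (meson symD)
  then show ?thesis unfolding gtp_def using assms by (blast intro: trancl_trans)
qed

lemma gtp_self:
  "(M, N) \<in> bundle_ext D \<Longrightarrow> a \<in> elems N \<Longrightarrow> (a, M, N) \<in> gtp (bundle_class D) a M N"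
  unfolding gtp_def using gal_rel_refl by blast

text \<open>
  An amalgam over \<open>M\<close> is also an amalgam over any strong substructure of \<open>M\<close>. Hence the restriction of
  a type does not depend on the triple that represents it.
\<close>

lemma gal_rel_trancl_restrict:
  assumes "((a, M, N), t) \<in> (gal_rel (bundle_class D))\<^sup>+" "(M0, M) \<in> bundle_ext D"
  shows "\<exists>b N'. t = (b, M, N') \<and> ((a, M0, N), (b, M0, N')) \<in> (gal_rel (bundle_class D))\<^sup>+"
proof -
  have step: "((a, M0, N), (b, M0, N')) \<in> gal_rel (bundle_class D)"
    if st: "((a, M, N), (b, M, N')) \<in> gal_rel (bundle_class D)" for a N b N'
  proof -
    note d = gal_relD[OF st]
    obtain N'' f1 f2 where f: "K_embedding (bundle_class D) f1 N N''"
      "K_embedding (bundle_class D) f2 N' N''" "\<forall>m \<in> elems M. f1 m = m \<and> f2 m = m" "f1 a = f2 b"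
      using d(6) by blast
    show ?thesis
      using bundle_ext_trans[OF assms(2) d(2)] d(3) bundle_ext_trans[OF assms(2) d(4)] d(5) f(1,2)
      by (rule gal_relI) (use f(3,4) bundle_extD(3)[OF assms(2)] in blast)+
  qed
  show ?thesis using assms(1)
  proof (induction rule: trancl_induct)
    case (base t)
    then obtain b N' where t: "t = (b, M, N')" by (blast elim: gal_rel_triple)
    then show ?case using step base by blast
  next
    case (step t t')
    then obtain b N' where t: "t = (b, M, N')"
      "((a, M0, N), (b, M0, N')) \<in> (gal_rel (bundle_class D))\<^sup>+" by blast
    then obtain c N'' where t': "t' = (c, M, N'')" using step(2) by (blast elim: gal_rel_triple)
    then have "((b, M0, N'), (c, M0, N'')) \<in> gal_rel (bundle_class D)"
      using \<open>\<And>a N b N'. ((a, M, N), (b, M, N')) \<in> gal_rel (bundle_class D) \<Longrightarrow>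
        ((a, M0, N), (b, M0, N')) \<in> gal_rel (bundle_class D)\<close> step(2) t(1) by blast
    then show ?case using t t' by (blast intro: trancl_into_trancl)
  qed
qed

lemma gres_gtp:
  assumes "(M, N) \<in> bundle_ext D" "a \<in> elems N" "(M0, M) \<in> bundle_ext D"
  shows "gres (bundle_class D) (gtp (bundle_class D) a M N) M0 = gtp (bundle_class D) a M0 N"
  unfolding gres_def
proof (rule the_equality)
  show "\<exists>b M' N'. (b, M', N') \<in> gtp (bundle_class D) a M N \<and>
      gtp (bundle_class D) a M0 N = gtp (bundle_class D) b M0 N'"
    using gtp_self[OF assms(1,2)] by blast
  fix q assume "\<exists>b M' N'. (b, M', N') \<in> gtp (bundle_class D) a M N \<and> q = gtp (bundle_class D) b M0 N'"
  then obtain b M' N' where b: "((a, M, N), (b, M', N')) \<in> (gal_rel (bundle_class D))\<^sup>+"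
    and q: "q = gtp (bundle_class D) b M0 N'" unfolding gtp_def by blast
  have "((a, M0, N), (b, M0, N')) \<in> (gal_rel (bundle_class D))\<^sup>+"
    using gal_rel_trancl_restrict[OF b assms(3)] by blast
  then show "q = gtp (bundle_class D) a M0 N" using gtp_eqI q by metis
qed

text \<open>
  What survives of an amalgam when the amalgam itself is forgotten: a map between the fibres over the
  common index set. Unlike amalgams, such maps compose, so they follow the transitive closure that
  defines Galois types.
\<close>

definition fibre_hom :: "'v::zfc struc \<Rightarrow> 'v struc \<Rightarrow> 'v struc \<Rightarrow> ('v \<Rightarrow> 'v) \<Rightarrow> bool" where
  "fibre_hom M N N' g \<longleftrightarrow>
     (\<forall>u y. (u, y) \<in> proj N \<and> y \<in> elems M \<longrightarrow> (g u, y) \<in> proj N') \<and>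
     (\<forall>u v y z. (u, y) \<in> proj N \<and> y \<in> elems M \<and> (v, z) \<in> proj N \<and> z \<in> elems M \<and>
        (u, v) \<in> link N \<longrightarrow> (g u, g v) \<in> link N')"

text \<open>
  In the amalgam the images of both bundles contain the point \<open>f1 a = f2 b\<close>, so both contain the whole
  fibre over each index of \<open>M\<close>, and \<open>f1\<close> can be followed by the inverse of \<open>f2\<close>. The hypothesis that \<open>a\<close>
  lies over \<open>M\<close> is what provides a fibre point in the image of the second bundle.
\<close>

lemma gal_rel_fibre_hom:
  assumes rel: "((a, M, N1), (b, M, N2)) \<in> gal_rel (bundle_class D)"
    and a: "(a, y0) \<in> proj N1" "y0 \<in> elems M"
  shows "\<exists>g. fibre_hom M N1 N2 g \<and> g a = b"
proof -
  note d = gal_relD[OF rel]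
  obtain N f1 f2 where f1: "K_embedding (bundle_class D) f1 N1 N"
    and f2: "K_embedding (bundle_class D) f2 N2 N"
    and fix1: "\<And>m. m \<in> elems M \<Longrightarrow> f1 m = m" and fix2: "\<And>m. m \<in> elems M \<Longrightarrow> f2 m = m"
    and ab: "f1 a = f2 b" using d(6) by blast
  obtain M1 where M1: "(M1, N) \<in> bundle_ext D" and i1: "iso_struc bundle_lang f1 N1 M1"
    using f1 unfolding K_embedding_def bundle_class_simps by blast
  obtain M2 where M2: "(M2, N) \<in> bundle_ext D" and i2: "iso_struc bundle_lang f2 N2 M2"
    using f2 unfolding K_embedding_def bundle_class_simps by blast
  note sN1 = bundles_structure[OF bundle_extD(2)[OF d(2)]]
  note sN2 = bundles_structure[OF bundle_extD(2)[OF d(4)]]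
  note sM1 = bundles_structure[OF bundle_extD(1)[OF M1]]
  note sM2 = bundles_structure[OF bundle_extD(1)[OF M2]]
  note im1 = bundle_iso(1)[OF sN1 sM1 i1] and ed1 = bundle_iso(2)[OF sN1 sM1 i1]
  note im2 = bundle_iso(1)[OF sN2 sM2 i2] and ed2 = bundle_iso(2)[OF sN2 sM2 i2]
  have inj2: "inj_on f2 (elems N2)"
    using i2 unfolding iso_bundle[OF sN2 sM2] bij_betw_def by blast
  have MN1: "elems M \<subseteq> elems N1" and MN2: "elems M \<subseteq> elems N2"
    using bundle_extD(3)[OF d(2)] bundle_extD(3)[OF d(4)] .
  have push1: "(f1 u, f1 v) \<in> edge R N" if "R \<in> Rels bundle_lang" "(u, v) \<in> edge R N1" for R u v
  proof -
    have "(f1 u, f1 v) \<in> edge R M1" using ed1[OF that(1)] edge_elems[OF sN1 that(2)] that(2) by blast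
    then show ?thesis using bundle_extD(4)[OF M1 that(1)] by blast
  qed
  have pull2: "(u, v) \<in> edge R N2"
    if "R \<in> Rels bundle_lang" "u \<in> elems N2" "v \<in> elems N2" "(f2 u, f2 v) \<in> edge R N" for R u v
  proof -
    have "f2 u \<in> elems M2" "f2 v \<in> elems M2" using im2 that(2,3) by blast+
    then have "(f2 u, f2 v) \<in> edge R M2" using bundle_extD(4)[OF M2 that(1)] that(4) by blast
    then show ?thesis using ed2[OF that(1-3)] by blast
  qed
  have pl: "proj_label \<in> Rels bundle_lang" and ll: "link_label \<in> Rels bundle_lang" by simp_all
  have M_M2: "y \<in> elems M2" if "y \<in> elems M" for y
    using that fix2[OF that] MN2 im2 by (metis imageI subsetD)
  have "(f2 b, y0) \<in> proj N" using push1[OF pl a(1)] ab fix1[OF a(2)] by simp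
  then have "(f2 b, y0) \<in> proj M2"
    using bundle_extD(5)[OF M2] M_M2[OF a(2)] d(5) im2 by blast
  then have ne: "proj M2 \<noteq> {}" by blast
  define g where "g u = inv_into (elems N2) f2 (f1 u)" for u
  have g: "g u \<in> elems N2 \<and> f2 (g u) = f1 u" if "(u, y) \<in> proj N1" "y \<in> elems M" for u y
  proof -
    have "(f1 u, y) \<in> proj N" using push1[OF pl that(1)] fix1[OF that(2)] by simp
    then have "f1 u \<in> f2 ` elems N2"
      using bundle_extD(6)[OF M2 ne _ M_M2[OF that(2)]] im2 by blast
    then show ?thesis unfolding g_def by (simp add: inv_into_into f_inv_into_f)
  qed
  have "(g u, y) \<in> proj N2" if u: "(u, y) \<in> proj N1" "y \<in> elems M" for u y
  proof (rule pull2[OF pl])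
    show "(f2 (g u), f2 y) \<in> proj N"
      using push1[OF pl u(1)] g[OF u] fix1[OF u(2)] fix2[OF u(2)] by simp
  qed (use g[OF u] u(2) MN2 in auto)
  moreover have "(g u, g v) \<in> link N2"
    if u: "(u, y) \<in> proj N1" "y \<in> elems M" and v: "(v, z) \<in> proj N1" "z \<in> elems M"
      and uv: "(u, v) \<in> link N1" for u y v z
    by (rule pull2[OF ll]) (use g[OF u] g[OF v] push1[OF ll uv] in simp_all)
  moreover have "g a = b" using g[OF a] ab d(5) inj2 by (metis inj_onD)
  ultimately show ?thesis unfolding fibre_hom_def by blast
qed

lemma gal_rel_trancl_fibre_hom:
  assumes "((a, M, N), t) \<in> (gal_rel (bundle_class D))\<^sup>+"
    and a: "(a, y0) \<in> proj N" "y0 \<in> elems M"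
  shows "\<exists>b N' g. t = (b, M, N') \<and> fibre_hom M N N' g \<and> g a = b"
  using assms(1)
proof (induction rule: trancl_induct)
  case (base t)
  then obtain b N' where t: "t = (b, M, N')" by (blast elim: gal_rel_triple)
  then show ?case using gal_rel_fibre_hom[OF _ a] base by blast
next
  case (step t t')
  then obtain b N' g where t: "t = (b, M, N')" and g: "fibre_hom M N N' g" "g a = b" by blast
  then obtain c N'' where t': "t' = (c, M, N'')" using step(2) by (blast elim: gal_rel_triple)
  have b: "(b, y0) \<in> proj N'" using g a unfolding fibre_hom_def by blast
  obtain g' where g': "fibre_hom M N' N'' g'" "g' b = c"
    using gal_rel_fibre_hom[OF _ b a(2)] step(2) t t' by blast
  have "fibre_hom M N N'' (g' \<circ> g)"
    using g(1) g'(1) unfolding fibre_hom_def comp_apply by blast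
  then show ?case using t' g(2) g'(2) by auto
qed

section \<open>Finite sets as vectors over the field with two elements\<close>

text \<open>
  Finite subsets of a set \<open>D\<close> form the vector space over the field with two elements with basis \<open>D\<close>.
  Then \<open>toggle d\<close> is translation by the basis vector \<open>d\<close>, and \<open>push \<pi>\<close> is the linear map that \<open>\<pi>\<close> induces on
  the bases; so \<open>push \<pi>\<close> carries translations to translations.
\<close>

definition toggle :: "'a \<Rightarrow> 'a set \<Rightarrow> 'a set" where
  "toggle d u = (if d \<in> u then u - {d} else insert d u)"

definition push :: "('a \<Rightarrow> 'b) \<Rightarrow> 'a set \<Rightarrow> 'b set" where
  "push \<pi> u = {d. odd (card {e \<in> u. \<pi> e = d})}"

lemma toggle_toggle [simp]: "toggle d (toggle d u) = u"
  unfolding toggle_def by auto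

lemma toggle_empty [simp]: "toggle d {} = {d}"
  unfolding toggle_def by simp

lemma finite_toggle [simp]: "finite (toggle d u) \<longleftrightarrow> finite u"
  unfolding toggle_def by simp

lemma toggle_subset: "d \<in> A \<Longrightarrow> u \<subseteq> A \<Longrightarrow> toggle d u \<subseteq> A"
  unfolding toggle_def by auto

lemma odd_card_toggle: "finite u \<Longrightarrow> odd (card (toggle d u)) \<longleftrightarrow> even (card u)"
proof (cases "d \<in> u")
  case True
  assume "finite u"
  then have "card u = Suc (card (u - {d}))" using True by (rule card.remove)
  then have "even (card u) \<longleftrightarrow> odd (card (u - {d}))" by (simp only: even_Suc)
  then show ?thesis using True unfolding toggle_def by (simp only: if_True)
qed (simp add: toggle_def)

lemma push_empty [simp]: "push \<pi> {} = {}"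
  unfolding push_def by simp

lemma push_toggle:
  assumes "finite u"
  shows "push \<pi> (toggle d u) = toggle (\<pi> d) (push \<pi> u)"
proof -
  have "c \<in> push \<pi> (toggle d u) \<longleftrightarrow> c \<in> toggle (\<pi> d) (push \<pi> u)" for c
  proof (cases "\<pi> d = c")
    case True
    then have "{e \<in> toggle d u. \<pi> e = c} = toggle d {e \<in> u. \<pi> e = c}"
      unfolding toggle_def by auto
    then have "c \<in> push \<pi> (toggle d u) \<longleftrightarrow> c \<notin> push \<pi> u"
      unfolding push_def using assms by (simp add: odd_card_toggle)
    then show ?thesis using True unfolding toggle_def by auto
  next
    case False
    then have "{e \<in> toggle d u. \<pi> e = c} = {e \<in> u. \<pi> e = c}"
      unfolding toggle_def by auto
    then have "c \<in> push \<pi> (toggle d u) \<longleftrightarrow> c \<in> push \<pi> u" unfolding push_def by simp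
    then show ?thesis using False unfolding toggle_def by auto
  qed
  then show ?thesis by blast
qed

lemma push_cong: "(\<And>e. e \<in> u \<Longrightarrow> \<pi> e = \<rho> e) \<Longrightarrow> push \<pi> u = push \<rho> u"
proof -
  assume "\<And>e. e \<in> u \<Longrightarrow> \<pi> e = \<rho> e"
  then have "{e \<in> u. \<pi> e = d} = {e \<in> u. \<rho> e = d}" for d by auto
  then show ?thesis unfolding push_def by simp
qed

lemma push_id [simp]: "push id u = u"
proof -
  have "{e \<in> u. id e = d} = (if d \<in> u then {d} else {})" for d by auto
  then show ?thesis unfolding push_def by auto
qed

lemma push_subset_image: "push \<pi> u \<subseteq> \<pi> ` u"
proof
  fix d assume "d \<in> push \<pi> u"
  then have "{e \<in> u. \<pi> e = d} \<noteq> {}" unfolding push_def by (metis (no_types, lifting) card.empty even_zero mem_Collect_eq)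
  then show "d \<in> \<pi> ` u" by blast
qed

lemma card_of_Fpow_ordLeq:
  assumes D: "infinite D"
  shows "|Fpow D| \<le>o |D|"
proof -
  define P where "P n = {A. A \<subseteq> D \<and> finite A \<and> card A = n}" for n
  have "|P n| \<le>o |D|" for n
  proof (induction n)
    case 0
    have "P 0 = {{}}" unfolding P_def by auto
    moreover have "|{{}} :: 'a set set| \<le>o |D|"
      using D by (intro ordLess_imp_ordLeq[OF finite_ordLess_infinite])
        (simp_all add: card_of_well_order_on Field_card_of)
    ultimately show ?case by simp
  next
    case (Suc n)
    have "P (Suc n) \<subseteq> (\<lambda>(a, A). insert a A) ` (D \<times> P n)"
    proof
      fix A assume A: "A \<in> P (Suc n)"
      then obtain a where a: "a \<in> A" unfolding P_def by fastforce
      then have "A = insert a (A - {a})" "a \<in> D" "A - {a} \<in> P n"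
        using A unfolding P_def by auto
      then show "A \<in> (\<lambda>(a, A). insert a A) ` (D \<times> P n)"
        by (intro image_eqI[of _ _ "(a, A - {a})"]) simp_all
    qed
    then have "|P (Suc n)| \<le>o |D \<times> P n|"
      using card_of_mono1 card_of_image ordLeq_transitive by blast
    moreover have "|D \<times> P n| \<le>o |D|"
      using D ordLeq_refl[OF card_of_Card_order] Suc by (intro card_of_Times_ordLeq_infinite_Field)
        (simp_all add: Field_card_of card_of_card_order_on)
    ultimately show ?case by (rule ordLeq_transitive)
  qed
  moreover have "|UNIV :: nat set| \<le>o |D|" using D by (simp add: infinite_iff_card_of_nat)
  ultimately have "|\<Union>n. P n| \<le>o |D|" using D by (intro card_of_UNION_ordLeq_infinite) auto
  moreover have "Fpow D = (\<Union>n. P n)" unfolding P_def Fpow_def by auto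
  ultimately show ?thesis by simp
qed

section \<open>The bundle of a family of test functions\<close>

text \<open>
  An index is a pair of a test function \<open>f\<close> on \<open>X\<close> and a demand \<open>C z \<subseteq> X\<close>. A filter that contains all the
  demands and measures the test functions would choose one value in \<open>f ` C z\<close>, coherently. Finite sets of
  values replace single values, because they admit translations: the bundle over any set of
  indices whose demands have a common point has an automorphism that the full bundle may lack.
  Every function refines the constant \<open>f0\<close>, so the set chosen over \<open>f0\<close> determines the parity of all others.
\<close>

locale test_family =
  fixes X :: "'x set" and D :: "'v::zfc set" and F :: "('x \<Rightarrow> 'v) set"
    and Z :: "'z set" and C :: "'z \<Rightarrow> 'x set"
    and f0 :: "'x \<Rightarrow> 'v" and d0 :: 'v and z0 :: 'z
  assumes small_D: "small D" and infinite_D: "infinite D"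
    and F_Func: "F \<subseteq> Func X D"
    and C_sub: "\<And>z. z \<in> Z \<Longrightarrow> C z \<subseteq> X"
    and codable_F: "codable TYPE('v) F" and codable_Z: "codable TYPE('v) Z"
    and f0: "f0 \<in> F" "\<And>x. x \<in> X \<Longrightarrow> f0 x = d0" and z0: "z0 \<in> Z"
    and C_z0: "C z0 \<noteq> {}"
begin

abbreviation K :: "'v aec" where "K \<equiv> bundle_class D"

definition tests :: "(('x \<Rightarrow> 'v) \<times> 'z) set" where "tests = F \<times> Z"

lemma testsD: "t \<in> tests \<Longrightarrow> fst t \<in> F" "t \<in> tests \<Longrightarrow> snd t \<in> Z"
  unfolding tests_def by auto

lemma origin_test: "(f0, z0) \<in> tests"
  unfolding tests_def using f0(1) z0 by blast

definition fibre :: "('x \<Rightarrow> 'v) \<times> 'z \<Rightarrow> 'v set set" where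
  "fibre t = {u. finite u \<and> u \<subseteq> fst t ` C (snd t)}"

text \<open>
  Links look at the functions alone. In particular \<open>(f, z)\<close> and \<open>(f, z')\<close> are linked by the identity,
  so the finite set that is chosen for \<open>f\<close> has to lie in \<open>f ` C z\<close> for all \<open>z\<close> at once.
\<close>

definition factors :: "('v \<Rightarrow> 'v) \<Rightarrow> ('x \<Rightarrow> 'v) \<times> 'z \<Rightarrow> ('x \<Rightarrow> 'v) \<times> 'z \<Rightarrow> bool" where
  "factors \<pi> t t' \<longleftrightarrow> (\<forall>x \<in> X. fst t' x = \<pi> (fst t x))"

definition points :: "(('x \<Rightarrow> 'v) \<times> 'z) set \<Rightarrow> (('x \<Rightarrow> 'v) \<times> 'z + (('x \<Rightarrow> 'v) \<times> 'z) \<times> 'v set) set" where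
  "points T = Inl ` T \<union> Inr ` Sigma T fibre"

definition code :: "('x \<Rightarrow> 'v) \<times> 'z + (('x \<Rightarrow> 'v) \<times> 'z) \<times> 'v set \<Rightarrow> 'v" where
  "code = (SOME c. inj_on c (points tests) \<and> small (c ` points tests))"

definition proj_rel :: "'v rel" where
  "proj_rel = {(code (Inr (t, u)), code (Inl t)) | t u. t \<in> tests \<and> u \<in> fibre t}"

definition link_rel :: "'v rel" where
  "link_rel = {(code (Inr (t, u)), code (Inr (t', u'))) | t u t' u'.
     t \<in> tests \<and> u \<in> fibre t \<and> t' \<in> tests \<and> u' \<in> fibre t' \<and>
     (\<exists>\<pi>. factors \<pi> t t' \<and> u' = push \<pi> u)}"

definition base :: "(('x \<Rightarrow> 'v) \<times> 'z) set \<Rightarrow> 'v struc" where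
  "base T = make_bundle (code ` Inl ` T) proj_rel link_rel"

definition total :: "(('x \<Rightarrow> 'v) \<times> 'z) set \<Rightarrow> 'v struc" where
  "total T = make_bundle (code ` points T) proj_rel link_rel"

lemma fibre_Pow: "t \<in> tests \<Longrightarrow> fibre t \<subseteq> Fpow D"
proof -
  assume t: "t \<in> tests"
  have "fst t ` C (snd t) \<subseteq> D"
    using testsD[OF t] F_Func C_sub[of "snd t"] unfolding Func_def by fastforce
  then show ?thesis unfolding fibre_def Fpow_def by blast
qed

lemma code: "inj_on code (points tests)" "small (code ` points tests)"
proof -
  have "codable TYPE('v) (tests <+> tests \<times> Pow D)"
    unfolding tests_def
    by (intro codable_Plus codable_Times codable_Pow codable_F codable_Z codable_small small_D)
  moreover have "points tests \<subseteq> tests <+> tests \<times> Pow D"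
    using fibre_Pow unfolding points_def Fpow_def by blast
  ultimately have "codable TYPE('v) (points tests)"
    using codable_inj[of _ id] by (metis id_apply image_id inj_on_id)
  then have "\<exists>c :: _ \<Rightarrow> 'v. inj_on c (points tests) \<and> small (c ` points tests)"
    unfolding codable_def .
  then have "inj_on code (points tests) \<and> small (code ` points tests)"
    unfolding code_def by (rule someI_ex)
  then show "inj_on code (points tests)" "small (code ` points tests)" by blast+
qed

lemma points_Inl [simp]: "Inl t \<in> points T \<longleftrightarrow> t \<in> T"
  and points_Inr [simp]: "Inr (t, u) \<in> points T \<longleftrightarrow> t \<in> T \<and> u \<in> fibre t"
  unfolding points_def by auto

lemma points_mono: "T \<subseteq> T' \<Longrightarrow> points T \<subseteq> points T'"
  unfolding points_def by blast

lemma code_eq: "a \<in> points tests \<Longrightarrow> b \<in> points tests \<Longrightarrow> code a = code b \<longleftrightarrow> a = b"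
  by (rule inj_on_eq_iff[OF code(1)])

lemma code_mem: "a \<in> points tests \<Longrightarrow> B \<subseteq> points tests \<Longrightarrow> code a \<in> code ` B \<longleftrightarrow> a \<in> B"
  by (rule inj_on_image_mem_iff[OF code(1)])

lemma Inl_points: "T \<subseteq> tests \<Longrightarrow> Inl ` T \<subseteq> points tests"
  unfolding points_def by blast

lemma base:
  assumes T: "T \<subseteq> tests"
  shows "structure_of bundle_lang (base T)" "elems (base T) = code ` Inl ` T"
    and "edge R (base T) = {}"
proof -
  have "small (code ` Inl ` T)"
    using small_subset[OF code(2) image_mono[OF Inl_points[OF T]]] .
  note b = make_bundle[OF this, of proj_rel link_rel, folded base_def]
  show s: "structure_of bundle_lang (base T)" and e: "elems (base T) = code ` Inl ` T"
    using b(1,2) .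
  have no: "code (Inr (t, u)) \<notin> code ` Inl ` T" if "t \<in> tests" "u \<in> fibre t" for t u
    using that code_mem[OF _ Inl_points[OF T]] by auto
  have "proj (base T) = {}" unfolding b(3) proj_rel_def using no by blast
  moreover have "link (base T) = {}" unfolding b(4) link_rel_def using no by blast
  moreover have "edge R (base T) = {}" if "R \<notin> Rels bundle_lang"
    using structure_of_bundle(5)[OF s that] unfolding edge_def by simp
  ultimately show "edge R (base T) = {}" by fastforce
qed

lemma total:
  assumes T: "T \<subseteq> tests"
  shows "structure_of bundle_lang (total T)" "elems (total T) = code ` points T"
    and "proj (total T) = {(code (Inr (t, u)), code (Inl t)) | t u. t \<in> T \<and> u \<in> fibre t}"
    and "link (total T) = {(code (Inr (t, u)), code (Inr (t', u'))) | t u t' u'.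
     t \<in> T \<and> u \<in> fibre t \<and> t' \<in> T \<and> u' \<in> fibre t' \<and> (\<exists>\<pi>. factors \<pi> t t' \<and> u' = push \<pi> u)}"
proof -
  have "small (code ` points T)"
    using small_subset[OF code(2) image_mono[OF points_mono[OF T]]] .
  note b = make_bundle[OF this, of proj_rel link_rel, folded total_def]
  show "structure_of bundle_lang (total T)" and "elems (total T) = code ` points T"
    using b(1,2) .
  have mem: "code (Inr (t, u)) \<in> code ` points T \<longleftrightarrow> t \<in> T" "code (Inl t) \<in> code ` points T \<longleftrightarrow> t \<in> T"
    if "t \<in> tests" "u \<in> fibre t" for t u
    using that code_mem[OF _ points_mono[OF T]] by simp_all
  show "proj (total T) = {(code (Inr (t, u)), code (Inl t)) | t u. t \<in> T \<and> u \<in> fibre t}"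
    (is "_ = ?P")
  proof
    show "proj (total T) \<subseteq> ?P" unfolding b(3) proj_rel_def using mem by blast
    show "?P \<subseteq> proj (total T)" unfolding b(3) proj_rel_def using mem T by blast
  qed
  show "link (total T) = {(code (Inr (t, u)), code (Inr (t', u'))) | t u t' u'.
     t \<in> T \<and> u \<in> fibre t \<and> t' \<in> T \<and> u' \<in> fibre t' \<and> (\<exists>\<pi>. factors \<pi> t t' \<and> u' = push \<pi> u)}"
    (is "_ = ?L")
  proof
    show "link (total T) \<subseteq> ?L" unfolding b(4) link_rel_def using mem by blast
    show "?L \<subseteq> link (total T)" unfolding b(4) link_rel_def using mem T by blast
  qed
qed

lemma base_bundle:
  assumes T: "T \<subseteq> tests"
  shows "base T \<in> bundles D"
proof -
  have "|{u. (u, y) \<in> proj (base T)}| \<le>o |D|" for y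
    unfolding base(3)[OF T] empty_iff empty_def[symmetric] by (rule card_of_empty)
  then show ?thesis
    unfolding bundles_def using base(1)[OF T] base(3)[OF T, of proj_label] by blast
qed

lemma total_bundle:
  assumes T: "T \<subseteq> tests"
  shows "total T \<in> bundles D"
proof -
  note TT = subsetD[OF T]
  have "(w, x) \<notin> proj (total T)" if xy: "(x, y) \<in> proj (total T)" for x y w
  proof
    assume "(w, x) \<in> proj (total T)"
    then obtain t where t: "x = code (Inl t)" "t \<in> T" unfolding total(3)[OF T] by blast
    obtain t' u where t': "x = code (Inr (t', u))" "t' \<in> T" "u \<in> fibre t'"
      using xy unfolding total(3)[OF T] by blast
    show False using code_eq[of "Inl t" "Inr (t', u)"] t t' TT by simp
  qed
  moreover have "|{u. (u, y) \<in> proj (total T)}| \<le>o |D|" for y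
  proof (cases "\<exists>t \<in> T. y = code (Inl t)")
    case True
    then obtain t where t: "t \<in> T" "y = code (Inl t)" by blast
    have "{u. (u, y) \<in> proj (total T)} \<subseteq> (\<lambda>u. code (Inr (t, u))) ` Fpow D"
    proof
      fix v assume "v \<in> {u. (u, y) \<in> proj (total T)}"
      then obtain t' u where v: "v = code (Inr (t', u))" "y = code (Inl t')" "t' \<in> T" "u \<in> fibre t'"
        unfolding total(3)[OF T] by blast
      then have "t' = t" using t code_eq[of "Inl t" "Inl t'"] TT by simp
      then show "v \<in> (\<lambda>u. code (Inr (t, u))) ` Fpow D" using v fibre_Pow TT t by blast
    qed
    then have "|{u. (u, y) \<in> proj (total T)}| \<le>o |Fpow D|"
      using card_of_mono1 card_of_image ordLeq_transitive by blast
    moreover have "|Fpow D| \<le>o |D|" using infinite_D by (rule card_of_Fpow_ordLeq)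
    ultimately show ?thesis by (rule ordLeq_transitive)
  next
    case False
    then have "{u. (u, y) \<in> proj (total T)} = {}" unfolding total(3)[OF T] by blast
    then show ?thesis by (metis card_of_empty)
  qed
  ultimately show ?thesis unfolding bundles_def using total(1)[OF T] by blast
qed

lemma base_base:
  assumes "T \<subseteq> T'" "T' \<subseteq> tests"
  shows "(base T, base T') \<in> bundle_ext D"
proof -
  have T: "T \<subseteq> tests" using assms by blast
  show ?thesis
    using base_bundle[OF T] base_bundle[OF assms(2)]
  proof (rule bundle_extI)
    show "elems (base T) \<subseteq> elems (base T')"
      unfolding base(2)[OF T] base(2)[OF assms(2)] using assms(1) by blast
  qed (simp_all add: base(3)[OF T] base(3)[OF assms(2)])
qed

lemma base_total:
  assumes "T \<subseteq> T'" "T' \<subseteq> tests"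
  shows "(base T, total T') \<in> bundle_ext D"
proof -
  have T: "T \<subseteq> tests" using assms by blast
  show ?thesis
    using base_bundle[OF T] total_bundle[OF assms(2)]
  proof (rule bundle_extI)
    show "elems (base T) \<subseteq> elems (total T')"
      unfolding base(2)[OF T] total(2)[OF assms(2)] points_def using assms(1) by blast
    have no: "code (Inr (t, u)) \<notin> elems (base T)" if "t \<in> T'" "u \<in> fibre t" for t u
      using that assms code_mem[OF _ Inl_points[OF T], of "Inr (t, u)"] unfolding base(2)[OF T] by auto
    have "proj (total T') \<inter> elems (base T) \<times> elems (base T) = {}"
      unfolding total(3)[OF assms(2)] using no by auto
    moreover have "link (total T') \<inter> elems (base T) \<times> elems (base T) = {}"
      unfolding total(4)[OF assms(2)] using no by auto
    ultimately show "edge R (base T) = edge R (total T') \<inter> elems (base T) \<times> elems (base T)"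
      if "R \<in> Rels bundle_lang" for R
      using that unfolding base(3)[OF T] bundle_lang_simps by blast
  qed (simp add: base(3)[OF T])
qed

lemma total_total:
  assumes "T \<subseteq> T'" "T' \<subseteq> tests"
  shows "(total T, total T') \<in> bundle_ext D"
proof -
  have T: "T \<subseteq> tests" using assms by blast
  have mem: "code (Inl t) \<in> elems (total T) \<longleftrightarrow> t \<in> T"
    "u \<in> fibre t \<Longrightarrow> code (Inr (t, u)) \<in> elems (total T) \<longleftrightarrow> t \<in> T" if "t \<in> T'" for t u
    unfolding total(2)[OF T]
    using subsetD[OF assms(2) that] code_mem[OF _ points_mono[OF T], of "Inl t"]
      code_mem[OF _ points_mono[OF T], of "Inr (t, u)"] by simp_all
  show ?thesis
    using total_bundle[OF T] total_bundle[OF assms(2)]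
  proof (rule bundle_extI)
    show "elems (total T) \<subseteq> elems (total T')"
      unfolding total(2)[OF T] total(2)[OF assms(2)] using points_mono[OF assms(1)] by blast
    have "proj (total T) = proj (total T') \<inter> elems (total T) \<times> elems (total T)" (is "?P = ?Q")
    proof
      show "?P \<subseteq> ?Q" unfolding total(3)[OF T] total(3)[OF assms(2)] using mem assms(1) by blast
      show "?Q \<subseteq> ?P" unfolding total(3)[OF T] total(3)[OF assms(2)] using mem by blast
    qed
    moreover have "link (total T) = link (total T') \<inter> elems (total T) \<times> elems (total T)" (is "?P = ?Q")
    proof
      show "?P \<subseteq> ?Q" unfolding total(4)[OF T] total(4)[OF assms(2)] using mem assms(1) by blast
      show "?Q \<subseteq> ?P" unfolding total(4)[OF T] total(4)[OF assms(2)] using mem by blast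
    qed
    ultimately show "edge R (total T) = edge R (total T') \<inter> elems (total T) \<times> elems (total T)"
      if "R \<in> Rels bundle_lang" for R
      using that unfolding bundle_lang_simps by blast
    show "u \<in> elems (total T)" if "(u, y) \<in> proj (total T')" "y \<in> elems (total T)" for u y
      using that mem unfolding total(3)[OF assms(2)] by blast
  qed
qed

lemma sub_base:
  assumes T: "T \<subseteq> tests" and M: "(M, base T) \<in> bundle_ext D"
  obtains T0 where "T0 \<subseteq> T" "M = base T0"
proof -
  define T0 where "T0 = {t \<in> T. code (Inl t) \<in> elems M}"
  have T0: "T0 \<subseteq> tests" unfolding T0_def using T by blast
  have "M = base T0"
  proof (rule bundle_eqI)
    show "structure_of bundle_lang M" using bundles_structure[OF bundle_extD(1)[OF M]] .
    show "structure_of bundle_lang (base T0)" using base(1)[OF T0] .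
    have "elems M \<subseteq> code ` Inl ` T" using bundle_extD(3)[OF M] unfolding base(2)[OF T] .
    then show "elems M = elems (base T0)" unfolding base(2)[OF T0] by (auto simp: T0_def)
    show "edge R M = edge R (base T0)" if "R \<in> Rels bundle_lang" for R
      using bundle_extD(4)[OF M that] unfolding base(3)[OF T] base(3)[OF T0] by blast
  qed
  then show thesis using that[of T0] unfolding T0_def by blast
qed

lemma card_base: "T \<subseteq> tests \<Longrightarrow> |elems (base T)| =o |T|"
proof -
  assume T: "T \<subseteq> tests"
  have "inj_on (code \<circ> Inl) T"
  proof (rule inj_onI)
    fix t t' assume "t \<in> T" "t' \<in> T" "(code \<circ> Inl) t = (code \<circ> Inl) t'"
    then show "t = t'" using code_eq[of "Inl t" "Inl t'"] T by auto
  qed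
  then have "bij_betw (code \<circ> Inl) T (elems (base T))"
    unfolding base(2)[OF T] by (simp add: bij_betw_def image_comp)
  then show ?thesis using card_of_ordIsoI ordIso_symmetric by blast
qed

text \<open>
  Translation of each fibre by the value of its test function at \<open>x\<close>. It preserves the links since
  \<open>f' = \<pi> \<circ> f\<close> implies \<open>push \<pi> {f x} = {f' x}\<close>, and it stays inside the fibre over \<open>(f, z)\<close> iff \<open>f x \<in> f ` C z\<close>, which
  \<open>x \<in> C z\<close> ensures.
\<close>

definition shift :: "'x \<Rightarrow> ('x \<Rightarrow> 'v) \<times> 'z + (('x \<Rightarrow> 'v) \<times> 'z) \<times> 'v set \<Rightarrow>
    ('x \<Rightarrow> 'v) \<times> 'z + (('x \<Rightarrow> 'v) \<times> 'z) \<times> 'v set" where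
  "shift x a = (case a of Inl t \<Rightarrow> Inl t | Inr (t, u) \<Rightarrow> Inr (t, toggle (fst t x) u))"

definition coded_shift :: "'x \<Rightarrow> 'v \<Rightarrow> 'v" where
  "coded_shift x v = code (shift x (inv_into (points tests) code v))"

lemma coded_shift: "a \<in> points tests \<Longrightarrow> coded_shift x (code a) = code (shift x a)"
  unfolding coded_shift_def by (simp only: inv_into_f_f[OF code(1)])

lemma shift_simps [simp]: "shift x (Inl t) = Inl t" "shift x (Inr (t, u)) = Inr (t, toggle (fst t x) u)"
  unfolding shift_def by simp_all

lemma shift_embedding:
  assumes T: "T \<subseteq> tests" and x: "x \<in> X" "\<And>t. t \<in> T \<Longrightarrow> x \<in> C (snd t)"
  shows "K_embedding K (coded_shift x) (total T) (total T)"
proof -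
  have PT: "points T \<subseteq> points tests" using points_mono[OF T] .
  have fib: "toggle (fst t x) u \<in> fibre t" if "t \<in> T" "u \<in> fibre t" for t u
    using that x(2)[OF that(1)] toggle_subset[of "fst t x" "fst t ` C (snd t)" u]
    unfolding fibre_def by simp
  have sh: "shift x a \<in> points T" if "a \<in> points T" for a
    using that fib by (cases a) (auto simp del: split_paired_All split_paired_Ex)
  have invol: "shift x (shift x a) = a" for a by (cases a) auto
  have cs: "coded_shift x v \<in> code ` points T \<and> coded_shift x (coded_shift x v) = v"
    if v: "v \<in> code ` points T" for v
  proof -
    obtain a where a: "a \<in> points T" "v = code a" using v by blast
    then have "coded_shift x v = code (shift x a)" "coded_shift x (code (shift x a)) = v"
      using coded_shift[of a x] coded_shift[of "shift x a" x] sh[of a] PT invol[of a] by auto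
    then show ?thesis using sh[OF a(1)] by simp
  qed
  have bij: "bij_betw (coded_shift x) (elems (total T)) (elems (total T))"
    unfolding total(2)[OF T]
    by (rule bij_betw_byWitness[where f' = "coded_shift x"]) (use cs in blast)+
  have P: "(coded_shift x v, coded_shift x w) \<in> proj (total T)" if "(v, w) \<in> proj (total T)" for v w
  proof -
    obtain t u where tu: "v = code (Inr (t, u))" "w = code (Inl t)" "t \<in> T" "u \<in> fibre t"
      using \<open>(v, w) \<in> proj (total T)\<close> unfolding total(3)[OF T] by blast
    then have "coded_shift x v = code (Inr (t, toggle (fst t x) u))" "coded_shift x w = code (Inl t)"
      using coded_shift T by auto
    then show ?thesis using tu fib unfolding total(3)[OF T] by blast
  qed
  have L: "(coded_shift x v, coded_shift x w) \<in> link (total T)" if "(v, w) \<in> link (total T)" for v w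
  proof -
    obtain t u t' u' \<pi> where tu: "v = code (Inr (t, u))" "w = code (Inr (t', u'))"
      "t \<in> T" "u \<in> fibre t" "t' \<in> T" "u' \<in> fibre t'" and \<pi>: "factors \<pi> t t'" "u' = push \<pi> u"
      using \<open>(v, w) \<in> link (total T)\<close> unfolding total(4)[OF T] by blast
    have c: "coded_shift x v = code (Inr (t, toggle (fst t x) u))"
        "coded_shift x w = code (Inr (t', toggle (fst t' x) u'))"
      using coded_shift T tu by auto
    have "finite u" using tu(4) unfolding fibre_def by blast
    then have "toggle (fst t' x) u' = push \<pi> (toggle (fst t x) u)"
      using \<pi> x(1) unfolding factors_def by (simp add: push_toggle)
    then show ?thesis unfolding c total(4)[OF T] using tu fib \<pi>(1) by blast
  qed
  have edges: "(v, w) \<in> edge R (total T) \<longleftrightarrow> (coded_shift x v, coded_shift x w) \<in> edge R (total T)"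
    if R: "R \<in> Rels bundle_lang" and v: "v \<in> elems (total T)" and w: "w \<in> elems (total T)" for R v w
  proof -
    have imp: "(coded_shift x v, coded_shift x w) \<in> edge R (total T)" if "(v, w) \<in> edge R (total T)" for v w
      using that R P L by auto
    show ?thesis
      using imp[of v w] imp[of "coded_shift x v" "coded_shift x w"] cs v w unfolding total(2)[OF T] by auto
  qed
  have "iso_struc bundle_lang (coded_shift x) (total T) (total T)"
    unfolding iso_bundle[OF total(1)[OF T] total(1)[OF T]] using bij edges by blast
  then show ?thesis
    unfolding K_embedding_def bundle_class_simps using bundle_ext_refl[OF total_bundle[OF T]] by blast
qed

definition point0 :: 'v where "point0 = code (Inr ((f0, z0), {}))"
definition point1 :: 'v where "point1 = code (Inr ((f0, z0), {d0}))"

lemma origin_points: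
  assumes "(f0, z0) \<in> T"
  shows "Inr ((f0, z0), {}) \<in> points T" "Inr ((f0, z0), {d0}) \<in> points T"
proof -
  obtain x where "x \<in> C z0" using C_z0 by blast
  then have "d0 \<in> f0 ` C z0" using f0(2)[of x] C_sub[OF z0] by (metis imageI subsetD)
  then show "Inr ((f0, z0), {}) \<in> points T" "Inr ((f0, z0), {d0}) \<in> points T"
    using assms by (simp_all add: fibre_def)
qed

lemma origin_elems:
  assumes "(f0, z0) \<in> T" "T \<subseteq> tests"
  shows "point0 \<in> elems (total T)" "point1 \<in> elems (total T)"
proof -
  show "point0 \<in> elems (total T)"
    unfolding point0_def total(2)[OF assms(2)] by (rule imageI, rule origin_points(1)[OF assms(1)])
  show "point1 \<in> elems (total T)"
    unfolding point1_def total(2)[OF assms(2)] by (rule imageI, rule origin_points(2)[OF assms(1)])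
qed

text \<open>
  The translation by \<open>x\<close> moves \<open>point0\<close> to \<open>point1\<close>. The bundle has to be restricted to indices whose demands
  contain \<open>x\<close>, and to the index of the two points, before it is applied.
\<close>

lemma local_gtp_eq:
  assumes T: "T \<subseteq> tests" and x: "x \<in> C z0" "\<And>t. t \<in> T \<Longrightarrow> x \<in> C (snd t)"
  shows "gtp K point0 (base T) (total tests) = gtp K point1 (base T) (total tests)"
proof -
  define T1 where "T1 = insert (f0, z0) T"
  have o: "(f0, z0) \<in> T1" "(f0, z0) \<in> tests" using origin_test unfolding T1_def by auto
  have T1: "T \<subseteq> T1" "T1 \<subseteq> tests" unfolding T1_def using T origin_test by auto
  have xX: "x \<in> X" using C_sub[OF z0] x(1) by blast
  note bt = base_total[OF T subset_refl] and bt1 = base_total[OF T1]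
  note in0 = origin_elems(1)[OF o(2) subset_refl] and in0' = origin_elems(1)[OF o(1) T1(2)]
  note in1 = origin_elems(2)[OF o(2) subset_refl] and in1' = origin_elems(2)[OF o(1) T1(2)]
  note incl = K_embedding_incl[OF total_total[OF T1(2) subset_refl]]
  note idt = K_embedding_incl[OF bundle_ext_refl[OF total_bundle[OF subset_refl]]]
  note id1 = K_embedding_incl[OF bundle_ext_refl[OF total_bundle[OF T1(2)]]]
  have restrict: "((p, base T, total tests), (p, base T, total T1)) \<in> gal_rel K"
    "((p, base T, total T1), (p, base T, total tests)) \<in> gal_rel K"
    if "p \<in> elems (total tests)" "p \<in> elems (total T1)" for p
    using gal_relI[OF bt that(1) bt1 that(2) idt incl] gal_relI[OF bt1 that(2) bt that(1) incl idt]
    by simp_all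
  have sh: "K_embedding K (coded_shift x) (total T1) (total T1)"
    using T1(2) xX by (rule shift_embedding) (use x in \<open>auto simp: T1_def\<close>)
  have mid: "((point0, base T, total T1), (point1, base T, total T1)) \<in> gal_rel K"
    using bt1 in0' bt1 in1' sh id1
  proof (rule gal_relI)
    show "coded_shift x m = m" if m: "m \<in> elems (base T)" for m
    proof -
      obtain t where "t \<in> T" "m = code (Inl t)" using m unfolding base(2)[OF T] by blast
      then show ?thesis using coded_shift[of "Inl t" x] T by auto
    qed
    show "coded_shift x point0 = id point1"
      using coded_shift[OF origin_points(1)[OF o(2)]] f0(2)[OF xX]
      unfolding point0_def point1_def by simp
  qed simp
  have "((point0, base T, total tests), (point1, base T, total tests)) \<in> (gal_rel K)\<^sup>+"
    by (rule trancl_into_trancl[OF trancl_into_trancl[OF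
        r_into_trancl[OF restrict(1)[OF in0 in0']] mid] restrict(2)[OF in1 in1']])
  then show ?thesis by (rule gtp_eqI)
qed

text \<open>
  A map of the full bundle into itself that moves \<open>point0\<close> to \<open>point1\<close> is read off on the zero section
  \<open>{}\<close>: the links between its zeros become the coherence of \<open>h\<close>.
\<close>

lemma gtp_eq_imp_section:
  assumes "gtp K point0 (base tests) (total tests) = gtp K point1 (base tests) (total tests)"
  obtains h where "\<And>t. t \<in> tests \<Longrightarrow> h t \<in> fibre t" "h (f0, z0) = {d0}"
    "\<And>t t' \<pi>. t \<in> tests \<Longrightarrow> t' \<in> tests \<Longrightarrow> factors \<pi> t t' \<Longrightarrow> h t' = push \<pi> (h t)"
proof -
  note o = origin_test
  have bt: "(base tests, total tests) \<in> bundle_ext D" using base_total by simp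
  have "(point1, base tests, total tests) \<in> gtp K point0 (base tests) (total tests)"
    unfolding assms using gtp_self[OF bt origin_elems(2)[OF o subset_refl]] .
  then have "((point0, base tests, total tests), (point1, base tests, total tests)) \<in> (gal_rel K)\<^sup>+"
    unfolding gtp_def mem_Collect_eq .
  note rel = this
  have zero: "{} \<in> fibre t" for t unfolding fibre_def by simp
  have in_base: "code (Inl t) \<in> elems (base tests)" if "t \<in> tests" for t
    unfolding base(2)[OF subset_refl] using that by blast
  have zero_proj: "(code (Inr (t, {})), code (Inl t)) \<in> proj (total tests)" if "t \<in> tests" for t
    unfolding total(3)[OF subset_refl] using that zero by blast
  obtain g where g: "fibre_hom (base tests) (total tests) (total tests) g" "g point0 = point1"
    using gal_rel_trancl_fibre_hom[OF rel zero_proj[OF o, folded point0_def] in_base[OF o]] by auto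
  have "\<exists>u. u \<in> fibre t \<and> g (code (Inr (t, {}))) = code (Inr (t, u))" if t: "t \<in> tests" for t
  proof -
    have "(g (code (Inr (t, {}))), code (Inl t)) \<in> proj (total tests)"
      using g(1) zero_proj[OF t] in_base[OF t] unfolding fibre_hom_def by blast
    then obtain t' u where tu: "g (code (Inr (t, {}))) = code (Inr (t', u))" "code (Inl t) = code (Inl t')"
      "t' \<in> tests" "u \<in> fibre t'" unfolding total(3)[OF subset_refl] by blast
    then have "t' = t" using code_eq[of "Inl t" "Inl t'"] t by simp
    then show ?thesis using tu by blast
  qed
  then obtain h where h: "\<And>t. t \<in> tests \<Longrightarrow> h t \<in> fibre t"
    "\<And>t. t \<in> tests \<Longrightarrow> g (code (Inr (t, {}))) = code (Inr (t, h t))"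
    using bchoice[of tests "\<lambda>t u. u \<in> fibre t \<and> g (code (Inr (t, {}))) = code (Inr (t, u))"] by blast
  show thesis
  proof (rule that[of h])
    show "h t \<in> fibre t" if "t \<in> tests" for t using h(1)[OF that] .
    have "code (Inr ((f0, z0), h (f0, z0))) = code (Inr ((f0, z0), {d0}))"
      using h(2)[OF o] g(2) unfolding point0_def point1_def by simp
    then show "h (f0, z0) = {d0}"
      using code_eq[of "Inr ((f0, z0), h (f0, z0))", OF _ origin_points(2)[OF o]] h(1)[OF o] o
      unfolding points_Inr by blast
    show "h t' = push \<pi> (h t)" if t: "t \<in> tests" "t' \<in> tests" and \<pi>: "factors \<pi> t t'" for t t' \<pi>
    proof -
      have "(code (Inr (t, {})), code (Inr (t', {}))) \<in> link (total tests)"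
        unfolding total(4)[OF subset_refl] using t \<pi> zero[of t] zero[of t'] push_empty[of \<pi>] by blast
      then have "(g (code (Inr (t, {}))), g (code (Inr (t', {})))) \<in> link (total tests)"
        using g(1) zero_proj[OF t(1)] zero_proj[OF t(2)] in_base[OF t(1)] in_base[OF t(2)]
        unfolding fibre_hom_def by blast
      then have "(code (Inr (t, h t)), code (Inr (t', h t'))) \<in> link (total tests)"
        unfolding h(2)[OF t(1)] h(2)[OF t(2)] .
      then obtain s u s' u' \<rho> where su: "code (Inr (t, h t)) = code (Inr (s, u))"
        "code (Inr (t', h t')) = code (Inr (s', u'))" "s \<in> tests" "u \<in> fibre s" "s' \<in> tests" "u' \<in> fibre s'"
        and \<rho>: "factors \<rho> s s'" "u' = push \<rho> u" unfolding total(4)[OF subset_refl] by blast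
      have st: "(t, h t) = (s, u)"
        using su(1) code_eq[of "Inr (t, h t)" "Inr (s, u)"] h(1)[OF t(1)] t(1) su(3,4)
        unfolding points_Inr by blast
      have st': "(t', h t') = (s', u')"
        using su(2) code_eq[of "Inr (t', h t')" "Inr (s', u')"] h(1)[OF t(2)] t(2) su(5,6)
        unfolding points_Inr by blast
      have "s = t" "u = h t" "s' = t'" "u' = h t'" using st st' unfolding prod.inject by blast+
      with \<rho> have eq: "h t' = push \<rho> (h t)" "factors \<rho> t t'" by blast+
      have hX: "h t \<subseteq> fst t ` X"
        using h(1)[OF t(1)] C_sub[OF testsD(2)[OF t(1)]] unfolding fibre_def by blast
      have "\<rho> e = \<pi> e" if e: "e \<in> h t" for e
      proof -
        obtain x where "x \<in> X" "e = fst t x" using e hX by blast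
        then show ?thesis using eq(2) \<pi> unfolding factors_def by metis
      qed
      then show ?thesis using eq(1) push_cong[of "h t" \<rho> \<pi>] by blast
    qed
  qed
qed

end

section \<open>From coherent finite sets to filters\<close>

text \<open>
  Coherent finite sets come from finitely many coherent single values. Passing to a finer function
  cannot decrease the number of values, and this number is bounded: functions with more and
  more values would have a common refinement, with infinitely many values. A function \<open>f\<^sub>0\<close> with
  the maximal number of values therefore determines the values of all finer functions, and one value
  \<open>i\<close> of \<open>f\<^sub>0\<close> selects one value of each function. Refinements of infinitely many functions,
  and hence countable powers, are essential for the bound.
\<close>

lemma coherent_choice:
  fixes F :: "('x \<Rightarrow> 'v) set" and h :: "('x \<Rightarrow> 'v) \<Rightarrow> 'v set"
  assumes f1: "f1 \<in> F"
    and fin: "\<And>f. f \<in> F \<Longrightarrow> finite (h f)"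
    and ne: "\<And>f. f \<in> F \<Longrightarrow> h f \<noteq> {}"
    and sub: "\<And>f. f \<in> F \<Longrightarrow> h f \<subseteq> f ` X"
    and img: "\<And>f g \<pi>. f \<in> F \<Longrightarrow> g \<in> F \<Longrightarrow> \<forall>x \<in> X. g x = \<pi> (f x) \<Longrightarrow> h g \<subseteq> \<pi> ` h f"
    and join: "\<And>G :: nat \<Rightarrow> _. range G \<subseteq> F \<Longrightarrow> \<exists>j \<in> F. \<forall>n. \<exists>\<pi>. \<forall>x \<in> X. G n x = \<pi> (j x)"
  obtains s where "\<And>G :: nat \<Rightarrow> _. range G \<subseteq> F \<Longrightarrow>
    \<exists>j \<in> F. \<exists>e \<in> h j. \<forall>n. \<exists>\<pi>. (\<forall>x \<in> X. G n x = \<pi> (j x)) \<and> s (G n) = \<pi> e"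
proof -
  have card_mono: "card (h g) \<le> card (h f)"
    if "f \<in> F" "g \<in> F" "\<forall>x \<in> X. g x = \<pi> (f x)" for f g \<pi>
    using surj_card_le[OF fin[OF that(1)] img[OF that]] .
  have "\<exists>N. \<forall>f \<in> F. card (h f) \<le> N"
  proof (rule ccontr)
    assume "\<nexists>N. \<forall>f \<in> F. card (h f) \<le> N"
    then have "\<forall>n. \<exists>f \<in> F. n < card (h f)" using not_le_imp_less by blast
    then obtain G where G: "\<And>n. G n \<in> F" "\<And>n. n < card (h (G n))" by metis
    then obtain j where j: "j \<in> F" "\<And>n. \<exists>\<pi>. \<forall>x \<in> X. G n x = \<pi> (j x)"
      using join[of G] by blast
    obtain \<pi> where "\<forall>x \<in> X. G (card (h j)) x = \<pi> (j x)" using j(2) by blast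
    from card_mono[OF j(1) G(1) this] show False using G(2)[of "card (h j)"] by simp
  qed
  then obtain N where "\<forall>f. f \<in> F \<longrightarrow> card (h f) < Suc N" using le_imp_less_Suc by blast
  from ex_has_greatest_nat[of "\<lambda>f. f \<in> F" f1 "\<lambda>f. card (h f)", OF f1 this]
  obtain f\<^sub>0 where f\<^sub>0: "f\<^sub>0 \<in> F" and max: "\<And>f. f \<in> F \<Longrightarrow> card (h f) \<le> card (h f\<^sub>0)"
    by blast
  obtain i where i: "i \<in> h f\<^sub>0" using ne[OF f\<^sub>0] by blast
  \<comment> \<open>Above \<open>f\<^sub>0\<close> the number of values is constant, so the values of \<open>j\<close> and of \<open>f\<^sub>0\<close> correspond one to one.\<close>
  have inj: "inj_on \<sigma> (h j)" if j: "j \<in> F" "\<forall>x \<in> X. f\<^sub>0 x = \<sigma> (j x)" for j \<sigma>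
  proof -
    have "card (h f\<^sub>0) \<le> card (\<sigma> ` h j)"
      using img[OF j(1) f\<^sub>0 j(2)] fin[OF j(1)] by (intro Finite_Set.card_mono finite_imageI)
    then have "card (\<sigma> ` h j) = card (h j)"
      using max[OF j(1)] card_image_le[OF fin[OF j(1)], of \<sigma>] by linarith
    then show ?thesis using fin[OF j(1)] by (simp add: eq_card_imp_inj_on)
  qed
  define Sel where "Sel f d \<longleftrightarrow> (\<exists>j \<in> F. \<exists>\<sigma> \<rho>. (\<forall>x \<in> X. f\<^sub>0 x = \<sigma> (j x)) \<and>
    (\<forall>x \<in> X. f x = \<rho> (j x)) \<and> (\<exists>e \<in> h j. \<sigma> e = i \<and> \<rho> e = d))" for f :: "'x \<Rightarrow> 'v" and d
  have unique: "d = d'" if Sel: "Sel f d" "Sel f d'" for f d d'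
  proof -
    obtain j \<sigma> \<rho> e where j: "j \<in> F" "\<forall>x \<in> X. f\<^sub>0 x = \<sigma> (j x)" "\<forall>x \<in> X. f x = \<rho> (j x)"
      "e \<in> h j" "\<sigma> e = i" "\<rho> e = d" using Sel(1) unfolding Sel_def by blast
    obtain j' \<sigma>' \<rho>' e' where j': "j' \<in> F" "\<forall>x \<in> X. f\<^sub>0 x = \<sigma>' (j' x)" "\<forall>x \<in> X. f x = \<rho>' (j' x)"
      "e' \<in> h j'" "\<sigma>' e' = i" "\<rho>' e' = d'" using Sel(2) unfolding Sel_def by blast
    define G where "G n = (if n = (0::nat) then j else j')" for n
    have "range G \<subseteq> F" unfolding G_def using j(1) j'(1) by auto
    then obtain k where k: "k \<in> F" "\<And>n. \<exists>\<pi>. \<forall>x \<in> X. G n x = \<pi> (k x)" using join by blast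
    obtain \<alpha> where \<alpha>: "\<forall>x \<in> X. j x = \<alpha> (k x)" using k(2)[of 0] unfolding G_def by auto
    obtain \<beta> where \<beta>: "\<forall>x \<in> X. j' x = \<beta> (k x)" using k(2)[of 1] unfolding G_def by auto
    obtain e1 where e1: "e1 \<in> h k" "e = \<alpha> e1" using img[OF k(1) j(1) \<alpha>] j(4) by blast
    obtain e2 where e2: "e2 \<in> h k" "e' = \<beta> e2" using img[OF k(1) j'(1) \<beta>] j'(4) by blast
    obtain x1 where x1: "x1 \<in> X" "e1 = k x1" using sub[OF k(1)] e1(1) by blast
    obtain x2 where x2: "x2 \<in> X" "e2 = k x2" using sub[OF k(1)] e2(1) by blast
    have inj_k: "inj_on (\<lambda>v. \<sigma> (\<alpha> v)) (h k)"
      by (rule inj[OF k(1)]) (use j(2) \<alpha> in simp)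
    have "\<sigma> (\<alpha> e2) = f\<^sub>0 x2" using x2 j(2) \<alpha> by simp
    also have "\<dots> = \<sigma>' (\<beta> e2)" using x2 j'(2) \<beta> by simp
    also have "\<dots> = \<sigma> (\<alpha> e1)" using e1(2) e2(2) j(5) j'(5) by simp
    finally have "e2 = e1" using inj_onD[OF inj_k _ e2(1) e1(1)] by blast
    then have "d' = \<rho>' (\<beta> e1)" using e2(2) j'(6) by simp
    also have "\<dots> = f x1" using x1 \<beta> j'(3) by simp
    also have "\<dots> = d" using x1 \<alpha> j(3,6) e1(2) by simp
    finally show ?thesis by (rule sym)
  qed
  define s where "s f = (THE d. Sel f d)" for f
  have s: "s f = d" if "Sel f d" for f d
    unfolding s_def using that unique by (blast intro: the_equality)
  have "\<exists>j \<in> F. \<exists>e \<in> h j. \<forall>n. \<exists>\<pi>. (\<forall>x \<in> X. G n x = \<pi> (j x)) \<and> s (G n) = \<pi> e"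
    if G: "range G \<subseteq> F" for G :: "nat \<Rightarrow> _"
  proof -
    define G' where "G' = case_nat f\<^sub>0 G"
    have "G' n \<in> F" for n
      by (cases n) (simp_all add: G'_def f\<^sub>0 range_subsetD[OF G])
    then have "range G' \<subseteq> F" by blast
    then obtain j where j: "j \<in> F" "\<And>n. \<exists>\<pi>. \<forall>x \<in> X. G' n x = \<pi> (j x)" using join by blast
    obtain \<sigma> where \<sigma>: "\<forall>x \<in> X. f\<^sub>0 x = \<sigma> (j x)" using j(2)[of 0] unfolding G'_def by auto
    obtain e where e: "e \<in> h j" "\<sigma> e = i" using img[OF j(1) f\<^sub>0 \<sigma>] i by blast
    have "\<exists>\<pi>. (\<forall>x \<in> X. G n x = \<pi> (j x)) \<and> s (G n) = \<pi> e" for n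
    proof -
      obtain \<pi> where \<pi>: "\<forall>x \<in> X. G n x = \<pi> (j x)" using j(2)[of "Suc n"] unfolding G'_def by auto
      then have "Sel (G n) (\<pi> e)" unfolding Sel_def using j(1) \<sigma> e by blast
      then show ?thesis using \<pi> s by blast
    qed
    then show ?thesis using j(1) e(1) by blast
  qed
  then show thesis using that by blast
qed

text \<open>
  The task of finding a filter on \<open>X\<close>, closed under intersections of \<open>|D|\<close> members, that measures \<open>\<A>\<close> and is compatible with all the demands
  \<open>C z\<close>. The injection \<open>e\<close> codes countable sequences in \<open>D\<close>, so that countably many functions into \<open>D\<close> can be
  refined by a single one.
\<close>

locale filter_problem =
  fixes X :: "'x set" and D :: "'v::zfc set" and e :: "(nat \<Rightarrow> 'v) \<Rightarrow> 'v"
    and \<A> :: "'x set set" and Z :: "'z set" and C :: "'z \<Rightarrow> 'x set"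
    and d0 d1 :: 'v and z0 :: 'z
  assumes small_D: "small D" and infinite_D: "infinite D"
    and inj_e: "inj_on e {\<phi>. range \<phi> \<subseteq> D}" and e_D: "e ` {\<phi>. range \<phi> \<subseteq> D} \<subseteq> D"
    and d01: "d0 \<in> D" "d1 \<in> D" "d0 \<noteq> d1"
    and \<A>: "\<A> \<subseteq> Pow X" "X \<in> \<A>" "\<And>A. A \<in> \<A> \<Longrightarrow> X - A \<in> \<A>"
    and C_sub: "\<And>z. z \<in> Z \<Longrightarrow> C z \<subseteq> X"
    and codable_X: "codable TYPE('v) X" and codable_Z: "codable TYPE('v) Z"
    and z0: "z0 \<in> Z" and C_z0: "C z0 \<noteq> {}"
begin

text \<open>
  The function that belongs to a \<open>D\<close>-indexed family of subsets of \<open>X\<close>: at \<open>x\<close> it names a member of the family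
  that omits \<open>x\<close>. With the convention \<open>A d0 = X\<close> the value \<open>d0\<close> is free to say that \<open>x\<close> lies in the intersection.
  If all members of the family are large, a coherent value other than \<open>d0\<close> would contradict the largeness of the
  member that it names; this is how completeness is obtained.
\<close>

definition selector :: "('v \<Rightarrow> 'x set) \<Rightarrow> 'x \<Rightarrow> 'v" where
  "selector A x = (if \<exists>d \<in> D. x \<notin> A d then SOME d. d \<in> D \<and> x \<notin> A d else d0)"

definition families :: "('v \<Rightarrow> 'x set) set" where
  "families = {A \<in> Func D \<A>. A d0 = X}"

text \<open>
  Countable sequences of families, which give the joint functions below. These are few: there are
  at most \<open>|\<A>|\<close> to the power \<open>|D|\<close> of them, whereas the number of all functions from \<open>X\<close> to \<open>D\<close> could exceed
  \<open>\<kappa>\<close> when \<open>X\<close> has size \<open>\<kappa>\<close>.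
\<close>

definition family_seqs :: "(nat \<times> 'v \<Rightarrow> 'x set) set" where
  "family_seqs = {B \<in> Func (UNIV \<times> D) \<A>. \<forall>n. B (n, d0) = X}"

definition joint :: "(nat \<times> 'v \<Rightarrow> 'x set) \<Rightarrow> 'x \<Rightarrow> 'v" where
  "joint B x = (if x \<in> X then e (\<lambda>n. selector (\<lambda>d. B (n, d)) x) else undefined)"

definition test_funs :: "('x \<Rightarrow> 'v) set" where
  "test_funs = joint ` family_seqs"

definition decode :: "'v \<Rightarrow> nat \<Rightarrow> 'v" where
  "decode = inv_into {\<phi>. range \<phi> \<subseteq> D} e"

definition trivial_family :: "nat \<times> 'v \<Rightarrow> 'x set" where
  "trivial_family p = (if snd p \<in> D then X else undefined)"

lemma selector_D: "selector A x \<in> D"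
proof (cases "\<exists>d \<in> D. x \<notin> A d")
  case True
  then have "\<exists>d. d \<in> D \<and> x \<notin> A d" by blast
  from someI_ex[OF this] show ?thesis unfolding selector_def using True by simp
qed (simp add: selector_def d01)

lemma selector_eq_d0:
  assumes "A d0 = X" "x \<in> X" "selector A x = d0" "d \<in> D"
  shows "x \<in> A d"
proof (rule ccontr)
  assume "x \<notin> A d"
  then have ex: "\<exists>d. d \<in> D \<and> x \<notin> A d" using assms(4) by blast
  then have "selector A x = (SOME d. d \<in> D \<and> x \<notin> A d)" unfolding selector_def by auto
  then have "x \<notin> A d0" using someI_ex[OF ex] assms(3) by simp
  then show False using assms by simp
qed

lemma selector_neq_d0:
  assumes "selector A x \<noteq> d0"
  shows "x \<notin> A (selector A x)"
proof -
  have ex: "\<exists>d. d \<in> D \<and> x \<notin> A d" using assms unfolding selector_def by (auto split: if_splits)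
  then have "selector A x = (SOME d. d \<in> D \<and> x \<notin> A d)" unfolding selector_def by auto
  then show ?thesis using someI_ex[OF ex] by simp
qed

lemma decode_e: "range \<phi> \<subseteq> D \<Longrightarrow> decode (e \<phi>) = \<phi>"
  unfolding decode_def by (rule inv_into_f_f[OF inj_e]) simp

lemma decode_joint: "x \<in> X \<Longrightarrow> decode (joint B x) n = selector (\<lambda>d. B (n, d)) x"
proof -
  assume "x \<in> X"
  moreover have "range (\<lambda>n. selector (\<lambda>d. B (n, d)) x) \<subseteq> D" using selector_D by blast
  ultimately show ?thesis unfolding joint_def using decode_e by simp
qed

lemma test_funs_Func: "test_funs \<subseteq> Func X D"
proof
  fix f assume "f \<in> test_funs"
  then obtain B where f: "f = joint B" unfolding test_funs_def by blast
  have "e (\<lambda>n. selector (\<lambda>d. B (n, d)) x) \<in> D" for x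
  proof -
    have "(\<lambda>n. selector (\<lambda>d. B (n, d)) x) \<in> {\<phi>. range \<phi> \<subseteq> D}" using selector_D by blast
    from subsetD[OF e_D imageI[OF this]] show ?thesis .
  qed
  then show "f \<in> Func X D" unfolding f joint_def Func_def by simp
qed

lemma test_funs_join:
  fixes G :: "nat \<Rightarrow> 'x \<Rightarrow> 'v"
  assumes "range G \<subseteq> test_funs"
  shows "\<exists>j \<in> test_funs. \<forall>n. \<exists>\<pi>. \<forall>x \<in> X. G n x = \<pi> (j x)"
proof -
  have "\<forall>k. \<exists>B. B \<in> family_seqs \<and> G k = joint B" using assms unfolding test_funs_def by blast
  then obtain B where B: "\<And>k. B k \<in> family_seqs" "\<And>k. G k = joint (B k)" by metis
  define J where "J p = (case prod_decode (fst p) of (k, m) \<Rightarrow> B k (m, snd p))" for p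
  have J: "J (prod_encode (k, m), d) = B k (m, d)" for k m d unfolding J_def by simp
  have "J \<in> Func (UNIV \<times> D) \<A>"
    using B(1) unfolding Func_def J_def family_seqs_def by (auto split: prod.splits)
  moreover have "J (n, d0) = X" for n
    using B(1) unfolding J_def family_seqs_def by (auto split: prod.splits)
  ultimately have "joint J \<in> test_funs" unfolding test_funs_def family_seqs_def by blast
  moreover have "\<exists>\<pi>. \<forall>x \<in> X. G k x = \<pi> (joint J x)" for k
  proof (intro exI ballI)
    fix x assume x: "x \<in> X"
    have "G k x = e (\<lambda>m. selector (\<lambda>d. B k (m, d)) x)" unfolding B(2) joint_def using x by simp
    also have "\<dots> = e (\<lambda>m. decode (joint J x) (prod_encode (k, m)))"
      unfolding decode_joint[OF x] J ..
    finally show "G k x = (\<lambda>v. e (\<lambda>m. decode v (prod_encode (k, m)))) (joint J x)" .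
  qed
  ultimately show ?thesis by blast
qed

lemma trivial_family: "trivial_family \<in> family_seqs"
  unfolding trivial_family_def family_seqs_def Func_def using \<A>(2) d01(1) by auto

lemma joint_trivial: "x \<in> X \<Longrightarrow> joint trivial_family x = e (\<lambda>_. d0)"
proof -
  assume "x \<in> X"
  then have "selector (\<lambda>d. trivial_family (n, d)) x = d0" for n
    unfolding selector_def trivial_family_def by auto
  then show ?thesis using \<open>x \<in> X\<close> unfolding joint_def by simp
qed

sublocale test_family X D test_funs Z C "joint trivial_family" "e (\<lambda>_. d0)" z0
proof unfold_locales
  show "codable TYPE('v) test_funs"
    by (rule codable_inj[OF codable_Func[OF codable_X codable_small[OF small_D]], of id])
      (use test_funs_Func in auto)
  show "joint trivial_family \<in> test_funs" unfolding test_funs_def using trivial_family by blast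
qed (fact small_D infinite_D test_funs_Func C_sub codable_Z joint_trivial z0 C_z0)+

text \<open>
  The finite set that belongs to the constant function is nonempty, and every function refines the
  constant one, so none of the finite sets is empty.
\<close>

lemma section_imp_choice:
  assumes h: "\<And>t. t \<in> tests \<Longrightarrow> h t \<in> fibre t" "h (joint trivial_family, z0) = {e (\<lambda>_. d0)}"
    and coh: "\<And>t t' \<pi>. t \<in> tests \<Longrightarrow> t' \<in> tests \<Longrightarrow> factors \<pi> t t' \<Longrightarrow> h t' = push \<pi> (h t)"
  obtains s where "\<And>A z. range A \<subseteq> families \<Longrightarrow> z \<in> Z \<Longrightarrow>
    \<exists>x \<in> C z. \<forall>n::nat. s (A n) = selector (A n) x"
proof -
  have tst: "(f, z) \<in> tests" if "f \<in> test_funs" "z \<in> Z" for f z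
    using that unfolding tests_def by blast
  note triv = f0(1)
  define H where "H f = h (f, z0)" for f
  have hz: "h (f, z) = H f" if "f \<in> test_funs" "z \<in> Z" for f z
    using coh[OF tst[OF that(1) z0] tst[OF that], of id] unfolding H_def factors_def by simp
  have HC: "finite (H f)" "z \<in> Z \<Longrightarrow> H f \<subseteq> f ` C z" if f: "f \<in> test_funs" for f z
    using h(1)[OF tst[OF f z0]] h(1)[OF tst[OF f, of z]] hz[OF f]
    unfolding H_def fibre_def by auto
  have img: "H g = push \<pi> (H f)" if "f \<in> test_funs" "g \<in> test_funs" "\<forall>x \<in> X. g x = \<pi> (f x)" for f g \<pi>
    using coh[OF tst[OF that(1) z0] tst[OF that(2) z0], of \<pi>] that(3)
    unfolding H_def factors_def by simp
  have ne: "H f \<noteq> {}" if f: "f \<in> test_funs" for f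
  proof
    assume "H f = {}"
    then have "H (joint trivial_family) = {}"
      using img[OF f triv, of "\<lambda>_. e (\<lambda>_. d0)"] joint_trivial by simp
    then show False using h(2) unfolding H_def by simp
  qed
  have HX: "H f \<subseteq> f ` X" if "f \<in> test_funs" for f
    using HC(2)[OF that z0] C_sub[OF z0] by blast
  have Himg: "H g \<subseteq> \<pi> ` H f" if "f \<in> test_funs" "g \<in> test_funs" "\<forall>x \<in> X. g x = \<pi> (f x)" for f g \<pi>
    unfolding img[OF that] by (rule push_subset_image)
  obtain s where s: "\<And>G :: nat \<Rightarrow> _. range G \<subseteq> test_funs \<Longrightarrow>
    \<exists>j \<in> test_funs. \<exists>v \<in> H j. \<forall>n. \<exists>\<pi>. (\<forall>x \<in> X. G n x = \<pi> (j x)) \<and> s (G n) = \<pi> v"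
    using coherent_choice[where F = test_funs and h = H and X = X,
        OF triv HC(1) ne HX Himg test_funs_join] by blast
  define const where "const A = (\<lambda>(n::nat, d). A d)" for A :: "'v \<Rightarrow> 'x set"
  define S where "S A = decode (s (joint (const A))) 0" for A
  have "\<exists>x \<in> C z. \<forall>n. S (A n) = selector (A n) x"
    if A: "range A \<subseteq> families" and z: "z \<in> Z" for A :: "nat \<Rightarrow> _" and z
  proof -
    have "const B \<in> family_seqs" if "B \<in> families" for B
      using that unfolding families_def family_seqs_def const_def Func_def by auto
    then have "range (\<lambda>n. joint (const (A n))) \<subseteq> test_funs" using A unfolding test_funs_def by blast
    from s[OF this] obtain j v where j: "j \<in> test_funs" "v \<in> H j"
      "\<And>n. \<exists>\<pi>. (\<forall>x \<in> X. joint (const (A n)) x = \<pi> (j x)) \<and> s (joint (const (A n))) = \<pi> v"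
      by blast
    obtain x where x: "x \<in> C z" "v = j x" using HC(2)[OF j(1) z] j(2) by blast
    have xX: "x \<in> X" using C_sub[OF z] x(1) by blast
    have "S (A n) = selector (A n) x" for n
    proof -
      have "s (joint (const (A n))) = joint (const (A n)) x" using j(3)[of n] x(2) xX by auto
      then show ?thesis unfolding S_def using decode_joint[OF xX] unfolding const_def by simp
    qed
    then show ?thesis using x(1) by blast
  qed
  then show thesis using that by blast
qed

text \<open>
  The sets in \<open>\<A>\<close> that the choice \<open>s\<close> declares large generate the filter. Any two families are answered at
  a common point of each demand, which yields the measuring and the intersection properties.
\<close>

lemma gtp_eq_imp_filter:
  assumes "gtp K point0 (base tests) (total tests) = gtp K point1 (base tests) (total tests)"
  obtains U where "filter_on X U" "\<And>S. S \<subseteq> U \<Longrightarrow> S \<noteq> {} \<Longrightarrow> |S| \<le>o |D| \<Longrightarrow> \<Inter> S \<in> U"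
    "\<And>A. A \<in> \<A> \<Longrightarrow> A \<in> U \<or> X - A \<in> U" "\<And>B z. B \<in> U \<Longrightarrow> z \<in> Z \<Longrightarrow> B \<inter> C z \<noteq> {}"
proof -
  obtain h where "\<And>t. t \<in> tests \<Longrightarrow> h t \<in> fibre t" "h (joint trivial_family, z0) = {e (\<lambda>_. d0)}"
    "\<And>t t' \<pi>. t \<in> tests \<Longrightarrow> t' \<in> tests \<Longrightarrow> factors \<pi> t t' \<Longrightarrow> h t' = push \<pi> (h t)"
    using gtp_eq_imp_section[OF assms] by blast
  from section_imp_choice[OF this] obtain s where
    s: "\<And>A z. range A \<subseteq> families \<Longrightarrow> z \<in> Z \<Longrightarrow> \<exists>x \<in> C z. \<forall>n::nat. s (A n) = selector (A n) x"
    by blast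
  have s2: "\<exists>x \<in> C z. x \<in> X \<and> s A = selector A x \<and> s B = selector B x"
    if AB: "A \<in> families" "B \<in> families" and z: "z \<in> Z" for A B z
  proof -
    have "range (\<lambda>n::nat. if n = 0 then A else B) \<subseteq> families" using AB by auto
    from s[OF this z] obtain x where x: "x \<in> C z"
      "\<And>n::nat. s (if n = 0 then A else B) = selector (if n = 0 then A else B) x" by blast
    show ?thesis using x(1) x(2)[of 0] x(2)[of 1] C_sub[OF z] by auto
  qed
  define single where "single A d = (if d \<in> D then if d = d1 then A else X else undefined)" for A d
  have single: "single A \<in> families" if "A \<in> \<A>" for A
    using that \<A>(2) d01 unfolding families_def Func_def single_def by auto
  have sel_single: "selector (single A) x = d0 \<longleftrightarrow> x \<in> A" if "x \<in> X" for A x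
  proof
    assume "selector (single A) x = d0"
    then show "x \<in> A" using selector_eq_d0[of "single A" x d1] that d01 unfolding single_def by simp
  next
    assume "x \<in> A"
    then show "selector (single A) x = d0" using that unfolding selector_def single_def by auto
  qed
  define V where "V = {A \<in> \<A>. s (single A) = d0}"
  have V_measure: "A \<in> V \<or> X - A \<in> V" if A: "A \<in> \<A>" for A
  proof -
    obtain x where x: "x \<in> X" "s (single A) = selector (single A) x"
      "s (single (X - A)) = selector (single (X - A)) x"
      using s2[OF single[OF A] single[OF \<A>(3)[OF A]] z0] by blast
    then show ?thesis
      using sel_single[OF x(1), of A] sel_single[OF x(1), of "X - A"] A \<A>(3)[OF A]
      unfolding V_def by auto
  qed
  have meet: "\<exists>x \<in> C z. \<forall>A \<in> S. x \<in> A" if S: "S \<subseteq> V" "|S| \<le>o |D|" and z: "z \<in> Z" for S z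
  proof (cases "S = {}")
    case True
    then show ?thesis using s2[OF single[OF \<A>(2)] single[OF \<A>(2)] z] by blast
  next
    case False
    have "D - {d0} \<noteq> {}" using d01 by blast
    then have "|{d0}| \<le>o |D - {d0}|" "|D - {d0}| \<le>o |D - {d0}|"
      by (rule card_of_singl_ordLeq, intro ordLeq_refl card_of_Card_order)
    then have "|{d0} \<union> (D - {d0})| \<le>o |D - {d0}|"
      using infinite_D
      by (intro card_of_Un_ordLeq_infinite_Field) (simp_all add: Field_card_of card_of_card_order_on)
    then have "|D| \<le>o |D - {d0}|" using d01(1) by (simp add: insert_absorb)
    then have "|S| \<le>o |D - {d0}|" using S(2) ordLeq_transitive by blast
    from iffD2[OF card_of_ordLeq2[OF False] this] obtain g where g: "g ` (D - {d0}) = S" ..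
    define A where "A d = (if d \<in> D then if d = d0 then X else g d else undefined)" for d
    have gS: "g d \<in> S" if "d \<in> D" "d \<noteq> d0" for d using g that by blast
    have A: "A \<in> families"
      using gS S(1) \<A>(2) d01 unfolding families_def Func_def A_def V_def by auto
    obtain x where x: "x \<in> C z" "x \<in> X" "s A = selector A x" using s2[OF A A z] by blast
    \<comment> \<open>A value \<open>j \<noteq> d0\<close> names a large set \<open>A j\<close>; a point that answers for both \<open>A\<close> and \<open>A j\<close> lies in \<open>A j\<close> and is omitted by it.\<close>
    have "selector A x = d0"
    proof (rule ccontr)
      assume ne: "selector A x \<noteq> d0"
      define j where "j = selector A x"
      have j: "j \<in> D" "j \<noteq> d0" unfolding j_def using selector_D ne by auto
      then have Aj: "A j \<in> V" using gS S(1) unfolding A_def by auto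
      then have "A j \<in> \<A>" unfolding V_def by blast
      from s2[OF A single[OF this] z] obtain y where y: "y \<in> X" "s A = selector A y"
        "s (single (A j)) = selector (single (A j)) y" by blast
      have "y \<in> A j" using Aj y(3) sel_single[OF y(1)] unfolding V_def by simp
      moreover have "selector A y = j" using y(2) x(3) j_def by simp
      ultimately show False using selector_neq_d0[of A y] j(2) by simp
    qed
    then have all: "x \<in> A d" if "d \<in> D" for d
      using selector_eq_d0[of A x d] x(2) that d01 unfolding A_def by simp
    have "x \<in> B" if "B \<in> S" for B
    proof -
      obtain d where "d \<in> D" "d \<noteq> d0" "B = g d" using g \<open>B \<in> S\<close> by blast
      then show ?thesis using all[of d] unfolding A_def by simp
    qed
    then show ?thesis using x(1) by blast
  qed
  define U where "U = {B. B \<subseteq> X \<and> (\<exists>S \<subseteq> V. |S| \<le>o |D| \<and> X \<inter> \<Inter> S \<subseteq> B)}"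
  have UI: "B \<in> U" if "B \<subseteq> X" "S \<subseteq> V" "|S| \<le>o |D|" "X \<inter> \<Inter> S \<subseteq> B" for B S
    unfolding U_def using that by blast
  have U_meets: "B \<inter> C z \<noteq> {}" if B: "B \<in> U" and z: "z \<in> Z" for B z
  proof -
    obtain S where S: "S \<subseteq> V" "|S| \<le>o |D|" "X \<inter> \<Inter> S \<subseteq> B" using B unfolding U_def by blast
    obtain x where "x \<in> C z" "\<forall>A \<in> S. x \<in> A" using meet[OF S(1,2) z] by blast
    then show ?thesis using S(3) C_sub[OF z] by blast
  qed
  have U_Inter: "\<Inter> W \<in> U" if W: "W \<subseteq> U" "W \<noteq> {}" "|W| \<le>o |D|" for W
  proof -
    have "\<forall>B \<in> W. \<exists>S. S \<subseteq> V \<and> |S| \<le>o |D| \<and> X \<inter> \<Inter> S \<subseteq> B" using W(1) unfolding U_def by blast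
    from bchoice[OF this] obtain f where
      f: "\<forall>B \<in> W. f B \<subseteq> V \<and> |f B| \<le>o |D| \<and> X \<inter> \<Inter> (f B) \<subseteq> B" by blast
    show ?thesis
    proof (rule UI)
      show "\<Inter> W \<subseteq> X" using W(1,2) unfolding U_def by blast
      show "(\<Union>B\<in>W. f B) \<subseteq> V" using f by blast
      show "|\<Union>B\<in>W. f B| \<le>o |D|"
        using infinite_D W(3) f by (intro card_of_UNION_ordLeq_infinite) blast+
      show "X \<inter> \<Inter> (\<Union>B\<in>W. f B) \<subseteq> \<Inter> W"
      proof (intro subsetI InterI)
        fix x B assume x: "x \<in> X \<inter> \<Inter> (\<Union>B\<in>W. f B)" and B: "B \<in> W"
        then have "x \<in> X \<inter> \<Inter> (f B)" by blast
        then show "x \<in> B" using f B by blast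
      qed
    qed
  qed
  have fin: "|S| \<le>o |D|" if "finite S" for S :: "'x set set"
    using that infinite_D by (intro ordLess_imp_ordLeq[OF finite_ordLess_infinite])
        (simp_all add: card_of_well_order_on Field_card_of)
  have measure: "A \<in> U \<or> X - A \<in> U" if A: "A \<in> \<A>" for A
  proof -
    have "B \<in> U" if "B \<in> V" for B
      by (rule UI[of B "{B}"]) (use that \<A>(1) fin[of "{B}"] in \<open>auto simp: V_def\<close>)
    then show ?thesis using V_measure[OF A] by blast
  qed
  have filt: "filter_on X U"
    unfolding filter_on_def
  proof (intro conjI ballI allI impI)
    show "U \<subseteq> Pow X" unfolding U_def by blast
    show "X \<in> U" by (rule UI[of X "{}"]) (use fin in auto)
    show "{} \<notin> U" using U_meets[OF _ z0] by blast
    show "A \<inter> B \<in> U" if "A \<in> U" "B \<in> U" for A B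
      using U_Inter[of "{A, B}"] fin[of "{A, B}"] that by simp
    show "B \<in> U" if "A \<in> U" "A \<subseteq> B \<and> B \<subseteq> X" for A B
      using that unfolding U_def by blast
  qed
  show thesis by (rule that[OF filt U_Inter measure U_meets])
qed

end

section \<open>Initial ordinals\<close>

lemma Card_order_order:
  assumes "Card_order r"
  shows "a \<in> Field r \<Longrightarrow> (a, a) \<in> r"
    and "(a, b) \<in> r \<Longrightarrow> (b, c) \<in> r \<Longrightarrow> (a, c) \<in> r"
    and "(a, b) \<in> r \<Longrightarrow> (b, a) \<in> r \<Longrightarrow> a = b"
    and "a \<in> Field r \<Longrightarrow> b \<in> Field r \<Longrightarrow> (a, b) \<in> r \<or> (b, a) \<in> r"
proof -
  have "Well_order r" using assms by (rule card_order_on_well_order_on)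
  then have "refl_on (Field r) r" "trans r" "antisym r" "total_on (Field r) r"
    unfolding well_order_on_def linear_order_on_def partial_order_on_def preorder_on_def by auto
  note o = this
  show refl: "(a, a) \<in> r" if "a \<in> Field r" for a using o(1) that by (rule refl_onD)
  show "(a, b) \<in> r \<or> (b, a) \<in> r" if "a \<in> Field r" "b \<in> Field r"
    using refl[OF that(1)] o(4) that unfolding total_on_def by (cases "a = b") auto
  show "(a, c) \<in> r" if "(a, b) \<in> r" "(b, c) \<in> r" using o(2) that by (rule transD)
  show "a = b" if "(a, b) \<in> r" "(b, a) \<in> r" using o(3) that by (rule antisymD)
qed

lemma ordLeq_card_of_Field: "Card_order \<kappa> \<Longrightarrow> |A| \<le>o \<kappa> \<Longrightarrow> |A| \<le>o |Field \<kappa>|"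
  by (erule ordLeq_ordIso_trans) (rule ordIso_symmetric[OF card_of_Field_ordIso])

lemma infinite_Field:
  assumes "natLeq <o \<kappa>"
  shows "infinite (Field \<kappa>)"
proof -
  have "natLeq \<le>o \<kappa>" using assms by (rule ordLess_imp_ordLeq)
  then have "|Field natLeq| \<le>o |Field \<kappa>|" by (rule card_of_mono2)
  then show ?thesis unfolding Field_natLeq using card_of_ordLeq_infinite infinite_UNIV_nat by blast
qed

lemma embed_in_Field:
  assumes \<kappa>: "Card_order \<kappa>" and \<delta>: "Card_order \<delta>" "\<delta> <o \<kappa>"
  obtains S where "S \<subseteq> Field \<kappa>" "\<delta> \<le>o |S|" "|S| <o \<kappa>"
proof -
  have F: "|Field \<delta>| =o \<delta>" using \<delta>(1) by (rule card_of_Field_ordIso)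
  then have lt: "|Field \<delta>| <o \<kappa>" using \<delta>(2) by (rule ordIso_ordLess_trans)
  have "|Field \<delta>| \<le>o |Field \<kappa>|"
    by (rule ordLeq_card_of_Field[OF \<kappa> ordLess_imp_ordLeq[OF lt]])
  then obtain g where g: "inj_on g (Field \<delta>)" "g ` Field \<delta> \<subseteq> Field \<kappa>"
    unfolding card_of_ordLeq[symmetric] by blast
  have "bij_betw g (Field \<delta>) (g ` Field \<delta>)" using g(1) by (rule inj_on_imp_bij_betw)
  then have "|Field \<delta>| =o |g ` Field \<delta>|" by (rule card_of_ordIsoI)
  then have i: "\<delta> =o |g ` Field \<delta>|" using F ordIso_symmetric ordIso_transitive by blast
  show thesis
  proof (rule that[OF g(2)])
    show "\<delta> \<le>o |g ` Field \<delta>|" using i by (rule ordIso_imp_ordLeq)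
    show "|g ` Field \<delta>| <o \<kappa>" using ordIso_symmetric[OF i] \<delta>(2) by (rule ordIso_ordLess_trans)
  qed
qed

lemma cofinalI:
  assumes \<kappa>: "Card_order \<kappa>" "infinite (Field \<kappa>)"
    and B: "\<And>z. z \<in> Field \<kappa> \<Longrightarrow> \<exists>b \<in> B. (z, b) \<in> \<kappa>"
  shows "cofinal B \<kappa>"
  unfolding cofinal_def
proof
  fix a assume "a \<in> Field \<kappa>"
  then obtain a' where a': "a' \<in> Field \<kappa>" "a \<noteq> a'" "(a, a') \<in> \<kappa>"
    using infinite_Card_order_limit[OF \<kappa>] by blast
  obtain b where b: "b \<in> B" "(a', b) \<in> \<kappa>" using B[OF a'(1)] by blast
  have "(a, b) \<in> \<kappa>" using Card_order_order(2)[OF \<kappa>(1) a'(3) b(2)] .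
  moreover have "a \<noteq> b" using Card_order_order(3)[OF \<kappa>(1) a'(3)] a'(2) b(2) by blast
  ultimately show "\<exists>b \<in> B. a \<noteq> b \<and> (a, b) \<in> \<kappa>" using b(1) by blast
qed

lemma not_cofinal_bound:
  assumes \<kappa>: "Card_order \<kappa>" and B: "B \<subseteq> Field \<kappa>" "\<not> cofinal B \<kappa>"
  shows "\<exists>a \<in> Field \<kappa>. \<forall>b \<in> B. (b, a) \<in> \<kappa>"
proof -
  obtain a where a: "a \<in> Field \<kappa>" "\<And>b. b \<in> B \<Longrightarrow> a = b \<or> (a, b) \<notin> \<kappa>"
    using B(2) unfolding cofinal_def by blast
  have "(b, a) \<in> \<kappa>" if "b \<in> B" for b
    using a(2)[OF that] Card_order_order(1)[OF \<kappa> a(1)] Card_order_order(4)[OF \<kappa> a(1), of b] that B(1)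
    by blast
  then show ?thesis using a(1) by blast
qed

lemma card_of_Func_weak_power:
  assumes \<kappa>: "Card_order \<kappa>" and wp: "weak_power \<kappa> =o \<kappa>" and A: "|A| <o \<kappa>"
  shows "|Func A (Field \<kappa>)| \<le>o \<kappa>"
proof -
  have W: "Well_order \<kappa>" using \<kappa> by (rule card_order_on_well_order_on)
  obtain a where a: "a \<in> Field \<kappa>" "|A| =o Restr \<kappa> (underS \<kappa> a)"
    using A ordLess_iff_ordIso_Restr[OF W card_of_Well_order] by blast
  have "Field (Restr \<kappa> (underS \<kappa> a)) = underS \<kappa> a"
    using W by (intro Field_Restr_ofilter wo_rel.underS_ofilter) (simp_all add: wo_rel_def)
  then have "|A| =o |underS \<kappa> a|"
    using card_of_cong[OF a(2)] unfolding Field_card_of by simp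
  then have "|Field \<kappa>| ^c |A| =o |Field \<kappa>| ^c |underS \<kappa> a|"
    by (intro cexp_cong2 card_of_Card_order)
  then have "|Func A (Field \<kappa>)| =o |Func (underS \<kappa> a) (Field \<kappa>)|"
    unfolding cexp_def Field_card_of .
  moreover have "|Func (underS \<kappa> a) (Field \<kappa>)| \<le>o weak_power \<kappa>"
    unfolding weak_power_def card_of_ordLeq[symmetric]
    by (rule exI[of _ "Pair a"]) (use a(1) in \<open>auto simp: inj_on_def\<close>)
  ultimately show ?thesis using wp ordIso_ordLeq_trans ordLeq_ordIso_trans by blast
qed

text \<open>
  Koenig's diagonal argument: if \<open>B\<close> is cofinal and small, then an enumeration of the functions from \<open>B\<close>
  to \<open>\<kappa>\<close> in order type \<open>\<kappa>\<close> misses the function that at \<open>c \<in> B\<close> avoids all values at \<open>c\<close> listed before \<open>c\<close>.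
\<close>

lemma weak_power_regularCard:
  assumes \<kappa>: "Card_order \<kappa>" "infinite (Field \<kappa>)" and wp: "weak_power \<kappa> =o \<kappa>"
  shows "regularCard \<kappa>"
  unfolding regularCard_def
proof (intro allI impI, elim conjE, rule ccontr)
  fix B assume B: "B \<subseteq> Field \<kappa>" "cofinal B \<kappa>" "\<not> |B| =o \<kappa>"
  have "|B| \<le>o \<kappa>"
    using card_of_mono1[OF B(1)] card_of_Field_ordIso[OF \<kappa>(1)] ordLeq_ordIso_trans by blast
  then have "|B| <o \<kappa>" using B(3) ordLeq_iff_ordLess_or_ordIso by blast
  then have "|Func B (Field \<kappa>)| \<le>o |Field \<kappa>|"
    by (intro ordLeq_card_of_Field[OF \<kappa>(1)] card_of_Func_weak_power[OF \<kappa>(1) wp])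
  moreover have "Func B (Field \<kappa>) \<noteq> {}" using \<kappa>(2) by (auto simp: Func_is_emp)
  ultimately obtain g where g: "g ` Field \<kappa> = Func B (Field \<kappa>)"
    by (meson card_of_ordLeq2)
  have "\<exists>y. y \<in> Field \<kappa> - (\<lambda>\<xi>. g \<xi> c) ` underS \<kappa> c" if "c \<in> B" for c
  proof -
    have "|(\<lambda>\<xi>. g \<xi> c) ` underS \<kappa> c| <o \<kappa>"
      using card_of_underS[OF \<kappa>(1), of c] that B(1) card_of_image ordLeq_ordLess_trans by blast
    then have "(\<lambda>\<xi>. g \<xi> c) ` underS \<kappa> c \<noteq> Field \<kappa>"
      using card_of_Field_ordIso[OF \<kappa>(1)] not_ordLess_ordIso by metis
    moreover have "(\<lambda>\<xi>. g \<xi> c) ` underS \<kappa> c \<subseteq> Field \<kappa>"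
    proof clarify
      fix \<xi> assume "\<xi> \<in> underS \<kappa> c"
      then have "\<xi> \<in> Field \<kappa>" unfolding underS_def Field_def by auto
      then have "g \<xi> \<in> Func B (Field \<kappa>)" using g by blast
      then show "g \<xi> c \<in> Field \<kappa>" using that unfolding Func_def by auto
    qed
    ultimately show ?thesis by blast
  qed
  then have "\<forall>c \<in> B. \<exists>y. y \<in> Field \<kappa> - (\<lambda>\<xi>. g \<xi> c) ` underS \<kappa> c" by blast
  from bchoice[OF this] obtain h where
    h: "\<forall>c \<in> B. h c \<in> Field \<kappa> - (\<lambda>\<xi>. g \<xi> c) ` underS \<kappa> c" by blast
  define h' where "h' c = (if c \<in> B then h c else undefined)" for c
  have "h' \<in> Func B (Field \<kappa>)" unfolding Func_def h'_def using h by auto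
  then have "h' \<in> g ` Field \<kappa>" unfolding g .
  then obtain \<xi> where \<xi>: "\<xi> \<in> Field \<kappa>" "g \<xi> = h'" by blast
  then obtain c where c: "c \<in> B" "\<xi> \<noteq> c" "(\<xi>, c) \<in> \<kappa>" using B(2) unfolding cofinal_def by blast
  then have "g \<xi> c \<in> (\<lambda>\<xi>. g \<xi> c) ` underS \<kappa> c" unfolding underS_def by blast
  then show False using h c(1) \<xi>(2) unfolding h'_def by auto
qed

section \<open>Tameness and locality force the two types to be equal\<close>

context test_family
begin

lemma base_strong: "(base tests, total tests) \<in> bundle_ext D"
  using base_total[of tests tests] by blast

lemma gres_base:
  assumes "T \<subseteq> tests"
  shows "gres K (gtp K point0 (base tests) (total tests)) (base T) = gtp K point0 (base T) (total tests)"
    and "gres K (gtp K point1 (base tests) (total tests)) (base T) = gtp K point1 (base T) (total tests)"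
  using gres_gtp[OF base_strong _ base_base[OF assms subset_refl]] origin_elems[OF origin_test subset_refl]
  by simp_all

lemma gtp_in_gS:
  "gtp K point0 (base tests) (total tests) \<in> gS K (base tests)"
  "gtp K point1 (base tests) (total tests) \<in> gS K (base tests)"
  unfolding gS_def bundle_class_simps
  using base_strong origin_elems[OF origin_test subset_refl] by blast+

text \<open>
  A strong substructure of the bare index set is a set of indices. If it is small, its demands have a
  common point, so it does not tell the two types apart.
\<close>

lemma tame_at_imp_gtp_eq:
  assumes tame: "tame_at K \<kappa> \<theta>" and card: "|tests| =o \<theta>"
    and loc: "\<And>T. T \<subseteq> tests \<Longrightarrow> |T| <o \<kappa> \<Longrightarrow> \<exists>x \<in> C z0. \<forall>t \<in> T. x \<in> C (snd t)"
  shows "gtp K point0 (base tests) (total tests) = gtp K point1 (base tests) (total tests)"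
    (is "?p = ?q")
proof (rule ccontr)
  assume ne: "?p \<noteq> ?q"
  have "base tests \<in> models K" using base_bundle[OF subset_refl] by simp
  moreover have "|elems (base tests)| =o \<theta>"
    using card_base[OF subset_refl] card by (rule ordIso_transitive)
  ultimately obtain M0 where M0: "(M0, base tests) \<in> bundle_ext D" "|elems M0| <o \<kappa>"
    and diff: "gres K ?p M0 \<noteq> gres K ?q M0"
    using tame ne gtp_in_gS unfolding tame_at_def bundle_class_simps by blast
  obtain T where T: "T \<subseteq> tests" "M0 = base T" using sub_base[OF subset_refl M0(1)] by blast
  have "|T| <o \<kappa>"
    using M0(2) card_base[OF T(1)] unfolding T(2) by (meson ordIso_ordLess_trans ordIso_symmetric)
  then obtain x where "x \<in> C z0" "\<forall>t \<in> T. x \<in> C (snd t)" using loc[OF T(1)] by blast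
  then have "gtp K point0 (base T) (total tests) = gtp K point1 (base T) (total tests)"
    using local_gtp_eq[OF T(1)] by blast
  then show False using diff gres_base[OF T(1)] unfolding T(2) by simp
qed

lemma base_is_union:
  assumes T: "\<And>i. i \<in> I \<Longrightarrow> T i \<subseteq> tests"
  shows "is_union bundle_lang I (\<lambda>i. base (T i)) (base (\<Union>i\<in>I. T i))"
proof -
  have U: "(\<Union>i\<in>I. T i) \<subseteq> tests" using T by blast
  have univ: "univ (base S) proj_label = code ` Inl ` S" if "S \<subseteq> tests" for S
    using elems_bundle[OF base(1)[OF that]] base(2)[OF that] by simp
  have "univ (base (\<Union>i\<in>I. T i)) proj_label = (\<Union>i\<in>I. univ (base (T i)) proj_label)"
    unfolding univ[OF U] image_UN using univ[OF T] by simp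
  moreover have "substructure bundle_lang (base (T i)) (base (\<Union>i\<in>I. T i))" if "i \<in> I" for i
    using base_base[of "T i" "\<Union>i\<in>I. T i"] U that unfolding bundle_ext_def by blast
  ultimately show ?thesis unfolding is_union_def bundle_lang_simps using base(1)[OF U] by blast
qed

lemma local_at_imp_gtp_eq:
  assumes loc: "local_at K \<kappa>"
    and mono: "\<And>i j. (i, j) \<in> \<kappa> \<Longrightarrow> T i \<subseteq> T j" and T: "\<And>i. i \<in> Field \<kappa> \<Longrightarrow> T i \<subseteq> tests"
    and cont: "\<And>i. limit_elem \<kappa> i \<Longrightarrow> T i = (\<Union>j\<in>underS \<kappa> i. T j)"
    and union: "(\<Union>i\<in>Field \<kappa>. T i) = tests"
    and x: "\<And>i. i \<in> Field \<kappa> \<Longrightarrow> \<exists>x \<in> C z0. \<forall>t \<in> T i. x \<in> C (snd t)"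
  shows "gtp K point0 (base tests) (total tests) = gtp K point1 (base tests) (total tests)"
    (is "?p = ?q")
proof (rule ccontr)
  assume ne: "?p \<noteq> ?q"
  have "continuous_chain K \<kappa> (\<lambda>i. base (T i))"
    unfolding continuous_chain_def bundle_class_simps
  proof (intro conjI allI ballI impI)
    show "base (T i) \<in> bundles D" if "i \<in> Field \<kappa>" for i using base_bundle[OF T[OF that]] .
    show "(base (T i), base (T j)) \<in> bundle_ext D" if "(i, j) \<in> \<kappa>" for i j
      using base_base[OF mono[OF that] T] that unfolding Field_def by blast
    show "is_union bundle_lang (underS \<kappa> i) (\<lambda>i. base (T i)) (base (T i))" if "limit_elem \<kappa> i" for i
    proof -
      have "underS \<kappa> i \<subseteq> Field \<kappa>" unfolding underS_def Field_def by auto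
      then show ?thesis using base_is_union[of "underS \<kappa> i" T] T cont[OF that] by auto
    qed
  qed
  moreover have "is_union bundle_lang (Field \<kappa>) (\<lambda>i. base (T i)) (base tests)"
    using base_is_union[of "Field \<kappa>" T, OF T] unfolding union .
  ultimately have "resolution K \<kappa> (\<lambda>i. base (T i)) (base tests)"
    unfolding resolution_def bundle_class_simps by blast
  moreover have "base tests \<in> models K" using base_bundle[OF subset_refl] by simp
  ultimately obtain i where i: "i \<in> Field \<kappa>" and diff: "gres K ?p (base (T i)) \<noteq> gres K ?q (base (T i))"
    using loc ne gtp_in_gS unfolding local_at_def by blast
  obtain y where "y \<in> C z0" "\<forall>t \<in> T i. y \<in> C (snd t)" using x[OF i] by blast
  then have "gtp K point0 (base (T i)) (total tests) = gtp K point1 (base (T i)) (total tests)"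
    using local_gtp_eq[OF T[OF i]] by blast
  then show False using diff gres_base[OF T[OF i]] by simp
qed

end

section \<open>The three large cardinal properties\<close>

lemma (in filter_problem) measured_meeting:
  assumes "\<And>B z. B \<in> U \<Longrightarrow> z \<in> Z \<Longrightarrow> B \<inter> C z \<noteq> {}" "\<And>A. A \<in> \<A> \<Longrightarrow> A \<in> U \<or> X - A \<in> U"
    and "z \<in> Z" "C z \<in> \<A>"
  shows "C z \<in> U"
  using assms(1)[of "X - C z" z] assms(2)[of "C z"] assms(3,4) by blast

locale power_closed_cardinal =
  fixes \<kappa> :: "'v::zfc rel"
  assumes cardinal_\<kappa>: "cardinal \<kappa>" and uncountable: "natLeq <o \<kappa>"
    and power: "\<forall>\<mu>::'v rel. cardinal \<mu> \<and> \<mu> <o \<kappa> \<longrightarrow> \<mu> ^c natLeq <o \<kappa>"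
begin

lemma Card: "Card_order \<kappa>" and small_Field: "small (Field \<kappa>)"
  using cardinal_\<kappa> unfolding cardinal_def by auto

lemma inf_Field: "infinite (Field \<kappa>)"
  using uncountable by (rule infinite_Field)

definition above :: "'v \<Rightarrow> 'v set" where
  "above z = {x. (z, x) \<in> \<kappa>}"

lemma above_sub: "above z \<subseteq> Field \<kappa>"
  unfolding above_def Field_def by auto

lemma coding_set:
  assumes S: "S \<subseteq> Field \<kappa>" "|S| <o \<kappa>"
  obtains D and e :: "(nat \<Rightarrow> 'v) \<Rightarrow> 'v" and d0 d1 \<mu> where
    "small D" "infinite D" "|S| \<le>o |D|" "|D| <o \<kappa>"
    "inj_on e {\<phi>. range \<phi> \<subseteq> D}" "e ` {\<phi>. range \<phi> \<subseteq> D} \<subseteq> D"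
    "d0 \<in> D" "d1 \<in> D" "d0 \<noteq> d1"
    "AEC (bundle_class D)" "LS_number (bundle_class D) \<mu>" "\<mu> <o \<kappa>"
proof -
  obtain D and e :: "(nat \<Rightarrow> 'v) \<Rightarrow> 'v" where D: "D \<subseteq> Field \<kappa>" "|S| \<le>o |D|" "|D| <o \<kappa>" "infinite D"
    and e: "inj_on e {\<phi>. range \<phi> \<subseteq> D}" "e ` {\<phi>. range \<phi> \<subseteq> D} \<subseteq> D"
    using countable_power_closed_subset[OF cardinal_\<kappa> uncountable power S] .
  have sD: "small D" using small_subset[OF small_Field D(1)] .
  obtain d0 where d0: "d0 \<in> D" using D(4) by (metis finite.emptyI ex_in_conv)
  have "infinite (D - {d0})" using D(4) by simp
  then obtain d1 where "d1 \<in> D - {d0}" by (metis finite.emptyI ex_in_conv)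
  then have d1: "d1 \<in> D" "d0 \<noteq> d1" by auto
  obtain \<mu> where \<mu>: "LS_number (bundle_class D) \<mu>" "\<mu> \<le>o |D|"
    using LS_number_bundle_class[OF sD D(4)] .
  show thesis
    by (rule that[OF sD D(4,2,3) e d0 d1 AEC_bundle_class[OF sD D(4)] \<mu>(1) ordLeq_ordLess_trans[OF \<mu>(2) D(3)]])
qed

text \<open>
  The points are the elements of \<open>\<kappa>\<close> and the demands are its final segments. Fewer than \<open>\<kappa>\<close> of them have
  a common element because \<open>\<kappa>\<close> is regular. Only the sets of the given field, singletons
  and their complements are tested, which keeps the number of indices equal to \<open>\<kappa>\<close>. The singletons
  make the filter nonprincipal.
\<close>

lemma almost_weakly_compactI:
  assumes wp: "weak_power \<kappa> =o \<kappa>"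
    and tame: "\<And>(K::'v aec) \<mu>. AEC K \<Longrightarrow> LS_number K \<mu> \<Longrightarrow> \<mu> <o \<kappa> \<Longrightarrow> tame_at K \<kappa> \<kappa>"
  shows "almost_weakly_compact \<kappa>"
  unfolding almost_weakly_compact_def delta_weakly_compact_def
proof (intro allI impI, elim conjE)
  fix \<delta> :: "'v rel" and \<A>0
  assume \<delta>: "cardinal \<delta>" "\<delta> <o \<kappa>" and \<A>0: "algebra (Field \<kappa>) \<A>0" "|\<A>0| =o \<kappa>"
  have reg: "regularCard \<kappa>" using weak_power_regularCard[OF Card inf_Field wp] .
  obtain S where S: "S \<subseteq> Field \<kappa>" "\<delta> \<le>o |S|" "|S| <o \<kappa>"
    using embed_in_Field[OF Card] \<delta> unfolding cardinal_def by blast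
  obtain D and e :: "(nat \<Rightarrow> 'v) \<Rightarrow> 'v" and d0 d1 \<mu> where D: "small D" "infinite D" "|S| \<le>o |D|" "|D| <o \<kappa>"
    and e: "inj_on e {\<phi>. range \<phi> \<subseteq> D}" "e ` {\<phi>. range \<phi> \<subseteq> D} \<subseteq> D"
    and d: "d0 \<in> D" "d1 \<in> D" "d0 \<noteq> d1"
    and K: "AEC (bundle_class D)" "LS_number (bundle_class D) \<mu>" "\<mu> <o \<kappa>"
    using coding_set[OF S(1,3)] .
  let ?X = "Field \<kappa>"
  define \<A> where "\<A> = \<A>0 \<union> ((\<lambda>x. {x}) ` ?X \<union> (\<lambda>x. ?X - {x}) ` ?X)"
  have A0: "\<A>0 \<subseteq> Pow ?X" "?X \<in> \<A>0" "\<And>A. A \<in> \<A>0 \<Longrightarrow> ?X - A \<in> \<A>0"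
    using subset_class.space_closed algebra.top[OF \<A>0(1)] algebra.compl_sets[OF \<A>0(1)] \<A>0(1)
    unfolding algebra_def ring_of_sets_def semiring_of_sets_def by blast+
  have A: "\<A> \<subseteq> Pow ?X" "?X \<in> \<A>" "\<And>A. A \<in> \<A> \<Longrightarrow> ?X - A \<in> \<A>"
  proof -
    show "\<A> \<subseteq> Pow ?X" "?X \<in> \<A>" using A0(1,2) unfolding \<A>_def by blast+
    have "?X - (?X - {x}) = {x}" if "x \<in> ?X" for x using that by blast
    then show "?X - A \<in> \<A>" if "A \<in> \<A>" for A using that A0(3) unfolding \<A>_def by auto
  qed
  obtain z0 where z0: "z0 \<in> ?X" using inf_Field by (metis finite.emptyI ex_in_conv)
  have cod: "codable TYPE('v) ?X" using codable_small[OF small_Field] .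
  have sub: "\<And>z. z \<in> ?X \<Longrightarrow> above z \<subseteq> ?X" by (rule above_sub)
  have az0: "above z0 \<noteq> {}" using Card_order_order(1)[OF Card z0] unfolding above_def by blast
  interpret filter_problem ?X D e \<A> ?X above d0 d1 z0
    by unfold_locales (fact D(1,2) e d A sub cod z0 az0)+
  have X\<kappa>: "|?X| =o \<kappa>" using Card by (rule card_of_Field_ordIso)
  have Xle: "|?X| \<le>o \<kappa>" using X\<kappa> by (rule ordIso_imp_ordLeq)
  have "|\<A>| \<le>o \<kappa>"
    unfolding \<A>_def
  proof (intro card_of_Un_ordLeq_infinite_Field[OF inf_Field])
    show "|\<A>0| \<le>o \<kappa>" using \<A>0(2) by (rule ordIso_imp_ordLeq)
    show "|(\<lambda>x. {x}) ` ?X| \<le>o \<kappa>" "|(\<lambda>x. ?X - {x}) ` ?X| \<le>o \<kappa>"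
      using card_of_image Xle ordLeq_transitive by blast+
  qed (fact Card)+
  then have "|\<A>| \<le>o |?X|" by (rule ordLeq_card_of_Field[OF Card])
  then have "|\<A>| ^c |UNIV \<times> D :: (nat \<times> 'v) set| \<le>o |?X| ^c |UNIV \<times> D :: (nat \<times> 'v) set|"
    by (rule cexp_mono1) (rule card_of_Card_order)
  then have le1: "|Func (UNIV \<times> D :: (nat \<times> 'v) set) \<A>| \<le>o |Func (UNIV \<times> D :: (nat \<times> 'v) set) ?X|"
    unfolding cexp_def Field_card_of .
  have le2: "|Func (UNIV \<times> D :: (nat \<times> 'v) set) ?X| \<le>o \<kappa>"
  proof (rule card_of_Func_weak_power[OF Card wp])
    have "|UNIV :: nat set| \<le>o |D|" using D(2) by (simp add: infinite_iff_card_of_nat)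
    then have "|UNIV \<times> D :: (nat \<times> 'v) set| \<le>o |D|"
      using D(2) ordLeq_refl[OF card_of_Card_order]
      by (intro card_of_Times_ordLeq_infinite_Field) (simp_all add: Field_card_of card_of_card_order_on)
    then show "|UNIV \<times> D :: (nat \<times> 'v) set| <o \<kappa>" using D(4) by (rule ordLeq_ordLess_trans)
  qed
  have le3: "|family_seqs| \<le>o |Func (UNIV \<times> D :: (nat \<times> 'v) set) \<A>|"
    by (rule card_of_mono1) (auto simp: family_seqs_def)
  have "|test_funs| \<le>o |family_seqs|" unfolding test_funs_def by (rule card_of_image)
  then have tf: "|test_funs| \<le>o \<kappa>"
    by (rule ordLeq_transitive[OF _ ordLeq_transitive[OF le3 ordLeq_transitive[OF le1 le2]]])
  have "|tests| \<le>o \<kappa>"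
    unfolding tests_def using card_of_Times_ordLeq_infinite_Field[OF inf_Field tf Xle Card] .
  moreover have "\<kappa> \<le>o |tests|"
  proof -
    have "|?X| \<le>o |tests|" unfolding tests_def using f0(1) by (intro card_of_Times2) blast
    then show ?thesis by (rule ordIso_ordLeq_trans[OF ordIso_symmetric[OF X\<kappa>]])
  qed
  ultimately have card_tests: "|tests| =o \<kappa>" by (simp add: ordIso_iff_ordLeq)
  have loc: "\<exists>x \<in> above z0. \<forall>t \<in> T. x \<in> above (snd t)" if T: "T \<subseteq> tests" "|T| <o \<kappa>" for T
  proof -
    define B where "B = insert z0 (snd ` T)"
    have BX: "B \<subseteq> ?X" unfolding B_def using z0 testsD(2) T(1) by blast
    have "|snd ` T| <o \<kappa>" using card_of_image T(2) by (rule ordLeq_ordLess_trans)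
    moreover have "|{z0}| <o \<kappa>"
      using inf_Field card_order_on_well_order_on[OF Card]
      by (intro finite_ordLess_infinite) (simp_all add: card_of_well_order_on Field_card_of)
    ultimately have "|B| <o \<kappa>"
      unfolding B_def using inf_Field Card card_of_Un_ordLess_infinite_Field[of \<kappa> "{z0}" "snd ` T"] by simp
    then have "\<not> cofinal B \<kappa>" using reg BX not_ordLess_ordIso unfolding regularCard_def by blast
    then obtain x where "\<forall>b \<in> B. (b, x) \<in> \<kappa>" using not_cofinal_bound[OF Card BX] by blast
    then show ?thesis unfolding B_def above_def by auto
  qed
  obtain U where U: "filter_on ?X U" "\<And>S. S \<subseteq> U \<Longrightarrow> S \<noteq> {} \<Longrightarrow> |S| \<le>o |D| \<Longrightarrow> \<Inter> S \<in> U"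
    "\<And>A. A \<in> \<A> \<Longrightarrow> A \<in> U \<or> ?X - A \<in> U" "\<And>B z. B \<in> U \<Longrightarrow> z \<in> ?X \<Longrightarrow> B \<inter> above z \<noteq> {}"
    using gtp_eq_imp_filter[OF tame_at_imp_gtp_eq[OF tame[OF K] card_tests loc]] by blast
  have "complete_filter \<delta> U"
    unfolding complete_filter_def
  proof (intro allI impI, elim conjE)
    fix W assume W: "W \<subseteq> U" "W \<noteq> {}" "|W| <o \<delta>"
    show "\<Inter> W \<in> U"
      using W(1,2) ordLeq_transitive[OF ordLess_imp_ordLeq[OF W(3)] ordLeq_transitive[OF S(2) D(3)]]
      by (rule U(2))
  qed
  moreover have unif: "uniform_filter \<kappa> U"
    unfolding uniform_filter_def
  proof
    fix B assume B: "B \<in> U"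
    then have "cofinal B \<kappa>"
      using U(4) unfolding above_def by (intro cofinalI[OF Card inf_Field]) blast
    moreover have "B \<subseteq> ?X" using B U(1) unfolding filter_on_def by blast
    ultimately show "|B| =o \<kappa>" using reg unfolding regularCard_def by blast
  qed
  moreover have "\<not> principal_filter ?X U"
  proof
    assume "principal_filter ?X U"
    then obtain P where P: "P \<subseteq> ?X" "U = {B. P \<subseteq> B \<and> B \<subseteq> ?X}" unfolding principal_filter_def by blast
    have "{} \<notin> U" using U(1) unfolding filter_on_def by blast
    then obtain x where x: "x \<in> P" using P by blast
    have "{x} \<notin> U"
    proof
      assume "{x} \<in> U"
      then have "|{x}| =o \<kappa>" using unif unfolding uniform_filter_def by blast
      then have "|?X| \<le>o |{x}|" using X\<kappa> ordIso_symmetric ordIso_transitive ordIso_imp_ordLeq by blast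
      then show False using inf_Field card_of_ordLeq_infinite by blast
    qed
    moreover have "{x} \<in> \<A>" using x P(1) unfolding \<A>_def by blast
    ultimately have "?X - {x} \<in> U" using U(3) by blast
    then show False using P(2) x by blast
  qed
  moreover have "\<forall>A \<in> \<A>0. A \<in> U \<or> ?X - A \<in> U" using U(3) unfolding \<A>_def by blast
  ultimately show "\<exists>F. filter_on ?X F \<and> \<not> principal_filter ?X F \<and> complete_filter \<delta> F \<and>
      uniform_filter \<kappa> F \<and> (\<forall>A \<in> \<A>0. A \<in> F \<or> ?X - A \<in> F)"
    using U(1) by blast
qed

text \<open>
  Here the resolution adds the demands one after the other, so that each stage has a common point
  whatever the cofinality of \<open>\<kappa>\<close> is. If \<open>\<kappa>\<close> were singular, the completeness could be chosen
  at least its cofinality; the final segments given by a cofinal set would then have nonempty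
  intersection. So \<open>\<kappa>\<close> is regular, and a set that meets all final segments has size \<open>\<kappa>\<close>.
\<close>

lemma almost_measurableI:
  assumes loc: "\<And>(K::'v aec) \<mu>. AEC K \<Longrightarrow> LS_number K \<mu> \<Longrightarrow> \<mu> <o \<kappa> \<Longrightarrow> local_at K \<kappa>"
  shows "almost_measurable \<kappa>"
  unfolding almost_measurable_def delta_measurable_def
proof (intro allI impI, elim conjE)
  fix \<delta> :: "'v rel"
  assume \<delta>: "cardinal \<delta>" "\<delta> <o \<kappa>"
  let ?X = "Field \<kappa>"
  have X\<kappa>: "|?X| =o \<kappa>" using Card by (rule card_of_Field_ordIso)
  obtain S1 where S1: "S1 \<subseteq> ?X" "\<delta> \<le>o |S1|" "|S1| <o \<kappa>"
    using embed_in_Field[OF Card] \<delta> unfolding cardinal_def by blast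
  have "\<exists>S2 \<subseteq> ?X. |S2| <o \<kappa> \<and> (regularCard \<kappa> \<or> cofinal S2 \<kappa>)"
  proof (cases "regularCard \<kappa>")
    case True
    then show ?thesis using S1 by blast
  next
    case False
    then obtain B where B: "B \<subseteq> ?X" "cofinal B \<kappa>" "\<not> |B| =o \<kappa>" unfolding regularCard_def by blast
    have "|B| \<le>o \<kappa>" using card_of_mono1[OF B(1)] X\<kappa> by (rule ordLeq_ordIso_trans)
    then have "|B| <o \<kappa>" using B(3) ordLeq_iff_ordLess_or_ordIso by blast
    then show ?thesis using B by blast
  qed
  then obtain S2 where S2: "S2 \<subseteq> ?X" "|S2| <o \<kappa>" "regularCard \<kappa> \<or> cofinal S2 \<kappa>" by blast
  define S where "S = S1 \<union> S2"
  have S: "S \<subseteq> ?X" "|S| <o \<kappa>"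
    unfolding S_def using S1 S2 inf_Field Card by (auto intro: card_of_Un_ordLess_infinite_Field)
  obtain D and e :: "(nat \<Rightarrow> 'v) \<Rightarrow> 'v" and d0 d1 \<mu> where D: "small D" "infinite D" "|S| \<le>o |D|" "|D| <o \<kappa>"
    and e: "inj_on e {\<phi>. range \<phi> \<subseteq> D}" "e ` {\<phi>. range \<phi> \<subseteq> D} \<subseteq> D"
    and d: "d0 \<in> D" "d1 \<in> D" "d0 \<noteq> d1"
    and K: "AEC (bundle_class D)" "LS_number (bundle_class D) \<mu>" "\<mu> <o \<kappa>"
    using coding_set[OF S] .
  have S1D: "|S1| \<le>o |D|" and S2D: "|S2| \<le>o |D|"
    using card_of_mono1[of S1 S] card_of_mono1[of S2 S] D(3) ordLeq_transitive
    unfolding S_def by blast+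
  obtain z0 where z0: "z0 \<in> ?X" using inf_Field by (metis finite.emptyI ex_in_conv)
  have cod: "codable TYPE('v) ?X" using codable_small[OF small_Field] .
  have sub: "\<And>z. z \<in> ?X \<Longrightarrow> above z \<subseteq> ?X" by (rule above_sub)
  have az0: "above z0 \<noteq> {}" using Card_order_order(1)[OF Card z0] unfolding above_def by blast
  have P: "Pow ?X \<subseteq> Pow ?X" "?X \<in> Pow ?X" "\<And>A. A \<in> Pow ?X \<Longrightarrow> ?X - A \<in> Pow ?X" by blast+
  interpret filter_problem ?X D e "Pow ?X" ?X above d0 d1 z0
    by unfold_locales (fact D(1,2) e d P sub cod z0 az0)+
  define T where "T i = test_funs \<times> underS \<kappa> i" for i
  have S_sub: "underS \<kappa> i \<subseteq> ?X" for i unfolding underS_def Field_def by auto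
  have S_mono: "underS \<kappa> i \<subseteq> underS \<kappa> j" if "(i, j) \<in> \<kappa>" for i j
    using Card_order_order(2)[OF Card _ that] Card_order_order(3)[OF Card that]
    unfolding underS_def by blast
  have gtp: "gtp K point0 (base tests) (total tests) = gtp K point1 (base tests) (total tests)"
  proof (rule local_at_imp_gtp_eq[OF loc[OF K], where T = T])
    show "T i \<subseteq> T j" if "(i, j) \<in> \<kappa>" for i j unfolding T_def using S_mono[OF that] by blast
    show "T i \<subseteq> tests" for i unfolding T_def tests_def using S_sub by blast
    show "T i = (\<Union>j\<in>underS \<kappa> i. T j)" if "limit_elem \<kappa> i" for i
    proof -
      have "underS \<kappa> i = (\<Union>j\<in>underS \<kappa> i. underS \<kappa> j)"
      proof
        show "underS \<kappa> i \<subseteq> (\<Union>j\<in>underS \<kappa> i. underS \<kappa> j)" using that unfolding limit_elem_def by blast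
        have "underS \<kappa> j \<subseteq> underS \<kappa> i" if "j \<in> underS \<kappa> i" for j
          using S_mono[of j i] that unfolding underS_def by blast
        then show "(\<Union>j\<in>underS \<kappa> i. underS \<kappa> j) \<subseteq> underS \<kappa> i" by blast
      qed
      then show ?thesis unfolding T_def by blast
    qed
    have "?X \<subseteq> (\<Union>i\<in>?X. underS \<kappa> i)"
    proof
      fix a assume "a \<in> ?X"
      then obtain b where "b \<in> ?X" "a \<noteq> b" "(a, b) \<in> \<kappa>"
        using infinite_Card_order_limit[OF Card inf_Field] by blast
      then show "a \<in> (\<Union>i\<in>?X. underS \<kappa> i)" unfolding underS_def by blast
    qed
    then show "(\<Union>i\<in>?X. T i) = tests" unfolding T_def tests_def using S_sub by blast
    show "\<exists>x \<in> above z0. \<forall>t \<in> T i. x \<in> above (snd t)" if i: "i \<in> ?X" for i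
    proof -
      obtain x where x: "(z0, x) \<in> \<kappa>" "(i, x) \<in> \<kappa>"
        using Card_order_order(4)[OF Card z0 i] Card_order_order(1)[OF Card] z0 i by blast
      have "(j, x) \<in> \<kappa>" if "j \<in> underS \<kappa> i" for j
        using Card_order_order(2)[OF Card _ x(2)] that unfolding underS_def by blast
      then show ?thesis using x(1) unfolding above_def T_def by auto
    qed
  qed
  obtain U where U: "filter_on ?X U" "\<And>S. S \<subseteq> U \<Longrightarrow> S \<noteq> {} \<Longrightarrow> |S| \<le>o |D| \<Longrightarrow> \<Inter> S \<in> U"
    "\<And>A. A \<in> Pow ?X \<Longrightarrow> A \<in> U \<or> ?X - A \<in> U" "\<And>B z. B \<in> U \<Longrightarrow> z \<in> ?X \<Longrightarrow> B \<inter> above z \<noteq> {}"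
    using gtp_eq_imp_filter[OF gtp] by blast
  have ne: "{} \<notin> U" and UX: "U \<subseteq> Pow ?X" using U(1) unfolding filter_on_def by blast+
  have "ultrafilter_on ?X U" unfolding ultrafilter_on_def using U(1,3) by blast
  moreover have "complete_filter \<delta> U"
    unfolding complete_filter_def
  proof (intro allI impI, elim conjE)
    fix W assume W: "W \<subseteq> U" "W \<noteq> {}" "|W| <o \<delta>"
    show "\<Inter> W \<in> U"
      using W(1,2) ordLeq_transitive[OF ordLess_imp_ordLeq[OF W(3)] ordLeq_transitive[OF S1(2) S1D]]
      by (rule U(2))
  qed
  moreover have "regularCard \<kappa>"
  proof (rule ccontr)
    assume "\<not> regularCard \<kappa>"
    then have cof: "cofinal S2 \<kappa>" using S2(3) by blast
    have tail: "above k \<in> U" if "k \<in> S2" for k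
      using measured_meeting[of U k] U(3,4) that S2(1) above_sub[of k] by blast
    obtain k0 where k0: "k0 \<in> S2" using cof z0 unfolding cofinal_def by blast
    have "\<Inter> (above ` S2) \<in> U"
    proof (rule U(2))
      show "above ` S2 \<subseteq> U" using tail by blast
      show "above ` S2 \<noteq> {}" using k0 by blast
      show "|above ` S2| \<le>o |D|" by (rule ordLeq_transitive[OF card_of_image S2D])
    qed
    then have "\<Inter> (above ` S2) \<noteq> {}" using ne by metis
    then obtain x where "x \<in> \<Inter> (above ` S2)" by blast
    then have x: "(k, x) \<in> \<kappa>" if "k \<in> S2" for k using that unfolding above_def by blast
    have "x \<in> ?X" using x[OF k0] unfolding Field_def by blast
    then obtain k where k: "k \<in> S2" "x \<noteq> k" "(x, k) \<in> \<kappa>" using cof unfolding cofinal_def by blast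
    show False using Card_order_order(3)[OF Card x[OF k(1)] k(3)] k(2) by blast
  qed
  then have "uniform_filter \<kappa> U"
    unfolding uniform_filter_def
  proof (intro ballI)
    fix B assume reg: "regularCard \<kappa>" and B: "B \<in> U"
    then have "cofinal B \<kappa>"
      using U(4) unfolding above_def by (intro cofinalI[OF Card inf_Field]) blast
    then show "|B| =o \<kappa>" using reg B UX unfolding regularCard_def by blast
  qed
  ultimately show "\<exists>U. ultrafilter_on ?X U \<and> uniform_filter \<kappa> U \<and> complete_filter \<delta> U" by blast
qed

text \<open>
  The points are the small subsets \<open>x\<close> of \<open>\<theta>\<close>, and the demands are the sets \<open>{x. \<alpha> \<in> x}\<close> of the definition of
  fineness. Fewer than \<open>\<kappa>\<close> demands, given by a small set \<open>B\<close> of ordinals, share the point \<open>B\<close>.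
\<close>

lemma almost_strongly_compactI:
  assumes tame: "\<And>(K::'v aec) \<mu>. AEC K \<Longrightarrow> LS_number K \<mu> \<Longrightarrow> \<mu> <o \<kappa> \<Longrightarrow> tame K \<kappa>"
  shows "almost_strongly_compact \<kappa>"
  unfolding almost_strongly_compact_def strongly_compact_inf_def strongly_compact_at_def
proof (intro allI impI, elim conjE)
  fix \<delta> \<theta> :: "'v rel"
  assume \<delta>: "cardinal \<delta>" "\<delta> <o \<kappa>" and \<theta>: "cardinal \<theta>" "\<kappa> \<le>o \<theta>"
  obtain S where S: "S \<subseteq> Field \<kappa>" "\<delta> \<le>o |S|" "|S| <o \<kappa>"
    using embed_in_Field[OF Card] \<delta> unfolding cardinal_def by blast
  obtain D and e :: "(nat \<Rightarrow> 'v) \<Rightarrow> 'v" and d0 d1 \<mu> where D: "small D" "infinite D" "|S| \<le>o |D|" "|D| <o \<kappa>"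
    and e: "inj_on e {\<phi>. range \<phi> \<subseteq> D}" "e ` {\<phi>. range \<phi> \<subseteq> D} \<subseteq> D"
    and d: "d0 \<in> D" "d1 \<in> D" "d0 \<noteq> d1"
    and K: "AEC (bundle_class D)" "LS_number (bundle_class D) \<mu>" "\<mu> <o \<kappa>"
    using coding_set[OF S(1,3)] .
  let ?X = "small_subsets \<kappa> \<theta>"
  define C where "C \<alpha> = {x \<in> ?X. \<alpha> \<in> x}" for \<alpha>
  have Card\<theta>: "Card_order \<theta>" and small\<theta>: "small (Field \<theta>)" using \<theta>(1) unfolding cardinal_def by auto
  have "|Field \<kappa>| \<le>o |Field \<theta>|" using \<theta>(2) by (rule card_of_mono2)
  then have "infinite (Field \<theta>)" using inf_Field card_of_ordLeq_infinite by blast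
  then obtain z0 where z0: "z0 \<in> Field \<theta>" by (metis finite.emptyI ex_in_conv)
  have X_iff: "x \<in> ?X \<longleftrightarrow> x \<subseteq> Field \<theta> \<and> |x| <o \<kappa>" for x unfolding small_subsets_def by simp
  have sing: "|{z0}| <o \<kappa>"
    using inf_Field card_order_on_well_order_on[OF Card]
    by (intro finite_ordLess_infinite) (simp_all add: card_of_well_order_on Field_card_of)
  have "{z0} \<in> C z0" unfolding C_def X_iff mem_Collect_eq using sing z0 by simp
  then have Cz0: "C z0 \<noteq> {}" by (metis empty_iff)
  have cod\<theta>: "codable TYPE('v) (Field \<theta>)" using codable_small[OF small\<theta>] .
  have codX: "codable TYPE('v) ?X"
    by (rule codable_inj[OF codable_Pow[OF cod\<theta>], of id]) (auto simp: X_iff)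
  have sub: "\<And>z. z \<in> Field \<theta> \<Longrightarrow> C z \<subseteq> ?X" unfolding C_def by blast
  have P: "Pow ?X \<subseteq> Pow ?X" "?X \<in> Pow ?X" "\<And>A. A \<in> Pow ?X \<Longrightarrow> ?X - A \<in> Pow ?X" by blast+
  interpret filter_problem ?X D e "Pow ?X" "Field \<theta>" C d0 d1 z0
    by unfold_locales (fact D(1,2) e d P sub codX cod\<theta> z0 Cz0)+
  have "\<kappa> \<le>o |tests|"
  proof -
    have "|Field \<theta>| \<le>o |tests|" unfolding tests_def using f0(1) by (intro card_of_Times2) blast
    moreover have "\<kappa> \<le>o |Field \<theta>|"
      using \<theta>(2) ordIso_symmetric[OF card_of_Field_ordIso[OF Card\<theta>]] by (rule ordLeq_ordIso_trans)
    ultimately show ?thesis by (rule ordLeq_transitive[rotated])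
  qed
  moreover have elems: "|tests| =o |elems (base tests)|"
    using card_base[OF subset_refl] by (rule ordIso_symmetric)
  ultimately have "\<kappa> \<le>o |elems (base tests)|" by (rule ordLeq_ordIso_trans)
  moreover have "cardinal |elems (base tests)|"
    by (rule cardinal_card_of[OF small_elems[OF base(1)[OF subset_refl]]])
  ultimately have tame': "tame_at K \<kappa> |elems (base tests)|"
    using tame[OF K] unfolding tame_def by blast
  have loc: "\<exists>x \<in> C z0. \<forall>t \<in> T. x \<in> C (snd t)" if T: "T \<subseteq> tests" "|T| <o \<kappa>" for T
  proof -
    define B where "B = insert z0 (snd ` T)"
    have "|snd ` T| <o \<kappa>" using card_of_image T(2) by (rule ordLeq_ordLess_trans)
    then have "|B| <o \<kappa>"
      unfolding B_def using sing inf_Field Card card_of_Un_ordLess_infinite_Field[of \<kappa> "{z0}" "snd ` T"]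
      by simp
    moreover have "B \<subseteq> Field \<theta>" unfolding B_def using z0 testsD(2) T(1) by blast
    ultimately have "B \<in> ?X" unfolding X_iff by blast
    then show ?thesis unfolding C_def B_def by blast
  qed
  obtain U where U: "filter_on ?X U" "\<And>S. S \<subseteq> U \<Longrightarrow> S \<noteq> {} \<Longrightarrow> |S| \<le>o |D| \<Longrightarrow> \<Inter> S \<in> U"
    "\<And>A. A \<in> Pow ?X \<Longrightarrow> A \<in> U \<or> ?X - A \<in> U" "\<And>B z. B \<in> U \<Longrightarrow> z \<in> Field \<theta> \<Longrightarrow> B \<inter> C z \<noteq> {}"
    using gtp_eq_imp_filter[OF tame_at_imp_gtp_eq[OF tame' elems loc]] by blast
  have "ultrafilter_on ?X U" unfolding ultrafilter_on_def using U(1,3) by blast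
  moreover have "complete_filter \<delta> U"
    unfolding complete_filter_def
  proof (intro allI impI, elim conjE)
    fix W assume W: "W \<subseteq> U" "W \<noteq> {}" "|W| <o \<delta>"
    show "\<Inter> W \<in> U"
      using W(1,2) ordLeq_transitive[OF ordLess_imp_ordLeq[OF W(3)] ordLeq_transitive[OF S(2) D(3)]]
      by (rule U(2))
  qed
  moreover have "fine \<kappa> \<theta> U"
    unfolding fine_def
  proof
    fix \<alpha> assume \<alpha>: "\<alpha> \<in> Field \<theta>"
    have "C \<alpha> \<in> U" by (rule measured_meeting[OF U(4,3) \<alpha>]) (use sub[OF \<alpha>] in blast)+
    then show "{x \<in> ?X. \<alpha> \<in> x} \<in> U" unfolding C_def .
  qed
  ultimately show "\<exists>U. ultrafilter_on ?X U \<and> complete_filter \<delta> U \<and> fine \<kappa> \<theta> U" by blast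
qed

end

theorem mainTheorem1:
  fixes \<kappa> :: "'v::zfc rel"
  assumes "cardinal \<kappa>" and "natLeq <o \<kappa>"
    and "\<forall>\<mu>::'v rel. cardinal \<mu> \<and> \<mu> <o \<kappa> \<longrightarrow> \<mu> ^c natLeq <o \<kappa>"
  shows "(weak_power \<kappa> =o \<kappa> \<and>
            (\<forall>(K::'v aec) \<mu>. AEC K \<and> LS_number K \<mu> \<and> \<mu> <o \<kappa> \<longrightarrow> tame_at K \<kappa> \<kappa>) \<longrightarrow>
          almost_weakly_compact \<kappa>) \<and>
         ((\<forall>(K::'v aec) \<mu>. AEC K \<and> LS_number K \<mu> \<and> \<mu> <o \<kappa> \<longrightarrow> local_at K \<kappa>) \<longrightarrow>
          almost_measurable \<kappa>) \<and>
         ((\<forall>(K::'v aec) \<mu>. AEC K \<and> LS_number K \<mu> \<and> \<mu> <o \<kappa> \<longrightarrow> tame K \<kappa>) \<longrightarrow>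
          almost_strongly_compact \<kappa>)"
proof -
  interpret power_closed_cardinal \<kappa> using assms by unfold_locales
  show ?thesis
    using almost_weakly_compactI almost_measurableI almost_strongly_compactI by blast
qed

end
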